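(* Let $A$ be a closed densely defined operator in a complex Hilbert space $\mathcal H$ and let $c\in\mathbb R_+$. Then the following two conditions are equivalent: (i) $A$ is weakly quasinormal with $\mathfrak c_A\leqslant c$; (ii) there exists $T\in\boldsymbol B(\mathcal H)$ such that $TA=|A|$, $T|A|\subseteq|A|T$ and $\|T\|\leqslant\sqrt c$. Moreover, the following assertions are valid: (iii) if $A$ is weakly quasinormal and $A\neq0$, then $\mathfrak c_A\geqslant1$; (iv) if $A$ is weakly quasinormal, then there exists $T\in\boldsymbol B(\mathcal H)$ such that $TA=|A|$, $T|A|\subseteq|A|T$, $\mathcal R(T)=\overline{\mathcal R(|A|)}$ and $\|T\|=\sqrt{\mathfrak c_A}$; (v) if $T\in\boldsymbol B(\mathcal H)$ satisfies $TA=|A|$, $T|A|\subseteq|A|T$ and $\|T\|\leqslant\sqrt c$, then $T|_{\overline{\mathcal R(A)}}\colon\overline{\mathcal R(A)}\to\mathcal H$ is an isometry, $T(\overline{\mathcal R(A)})=\overline{\mathcal R(|A|)}$, and the partial isometry $U$ in the polar decomposition $A=U|A|$ of $A$ takes the form $U=PT^*$, where $P\in\boldsymbol B(\mathcal H)$ is the orthogonal projection of $\mathcal H$ onto $\overline{\mathcal R(A)}$.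
   Context: All operators are linear and possibly unbounded; $\mathcal D(A)$ and $\mathcal R(A)$ denote the domain and the range of $A$; $\boldsymbol B(\mathcal H)$ is the algebra of bounded operators with domain $\mathcal H$. $\mathbb R_+=[0,\infty)$ and $\mathfrak B(\mathbb R_+)$ is its Borel $\sigma$-algebra. For a closed densely defined $A$, $|A|$ is the square root of the positive selfadjoint operator $A^*A$ (so $\mathcal D(|A|)=\mathcal D(A)$), and its spectral measure is regarded as defined on $\mathfrak B(\mathbb R_+)$. $S\subseteq T$ means $\mathcal D(S)\subseteq\mathcal D(T)$ and $Sf=Tf$ for $f\in\mathcal D(S)$. The polar decomposition is $A=U|A|$ with $U$ a partial isometry whose kernel equals the kernel of $A$. A closed densely defined operator $A$ in $\mathcal H$ is called weakly quasinormal if there exists $c\in\mathbb R_+$ such that $\langle E(\sigma)|A|f,|A|f\rangle\leqslant c\,\langle E(\sigma)Af,Af\rangle$ for all $\sigma\in\mathfrak B(\mathbb R_+)$ and $f\in\mathcal D(A)$, where $E$ is the spectral measure of $|A|$; the smallest such $c$ is denoted by $\mathfrak c_A$. *)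

theory Defs
  imports "HOL-Analysis.Analysis"
begin

text \<open>
  Complex Hilbert spaces. The inner product \<open>cinner\<close> is linear in the first argument. The class is built
  on top of \<^class>\<open>real_inner\<close>, whose real inner product is required to be the real part of
  \<open>cinner\<close>; positive definiteness and \<open>norm x = sqrt (Re (cinner x x))\<close> are thereby inherited.
\<close>

class complex_hilbert_space = real_inner + complete_space +
  fixes scaleC :: "complex \<Rightarrow> 'a \<Rightarrow> 'a"  (infixr \<open>*\<^sub>C\<close> 75)
    and cinner :: "'a \<Rightarrow> 'a \<Rightarrow> complex"
  assumes scaleC_of_real: "complex_of_real r *\<^sub>C x = r *\<^sub>R x"
    and scaleC_add_right: "a *\<^sub>C (x + y) = a *\<^sub>C x + a *\<^sub>C y"
    and scaleC_add_left: "(a + b) *\<^sub>C x = a *\<^sub>C x + b *\<^sub>C x"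
    and scaleC_scaleC: "a *\<^sub>C (b *\<^sub>C x) = (a * b) *\<^sub>C x"
    and cinner_commute: "cinner x y = cnj (cinner y x)"
    and cinner_add_left: "cinner (x + y) z = cinner x z + cinner y z"
    and cinner_scaleC_left: "cinner (a *\<^sub>C x) y = a * cinner x y"
    and inner_eq_Re_cinner: "x \<bullet> y = Re (cinner x y)"

instantiation complex :: complex_hilbert_space
begin

definition "scaleC_complex (a::complex) (x::complex) = a * x"
definition "cinner_complex (x::complex) (y::complex) = x * cnj y"

instance
  by standard
    (auto simp: scaleC_complex_def cinner_complex_def scaleR_conv_of_real inner_complex_def
      algebra_simps)

end


text \<open>
  A possibly unbounded operator is a partial map: \<^term>\<open>dom A\<close> is its domain, \<^term>\<open>ran A\<close> its range,
  \<^term>\<open>S \<circ>\<^sub>m T\<close> the product with its natural domain, and \<^term>\<open>S \<subseteq>\<^sub>m T\<close> the inclusion of operators.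
  An everywhere defined operator given by a total function enters these notions through \<open>everywhere\<close>.
\<close>

type_synonym 'h operator = "'h \<rightharpoonup> 'h"

abbreviation everywhere :: "('h \<Rightarrow> 'h) \<Rightarrow> 'h operator"
  where "everywhere T \<equiv> (\<lambda>x. Some (T x))"

definition linear_operator :: "'h::complex_hilbert_space operator \<Rightarrow> bool"
  where "linear_operator A \<longleftrightarrow>
    A 0 = Some 0 \<and>
    (\<forall>f\<in>dom A. \<forall>g\<in>dom A. A (f + g) = Some (the (A f) + the (A g))) \<and>
    (\<forall>a. \<forall>f\<in>dom A. A (a *\<^sub>C f) = Some (a *\<^sub>C the (A f)))"

definition densely_defined :: "'h::complex_hilbert_space operator \<Rightarrow> bool"
  where "densely_defined A \<longleftrightarrow> closure (dom A) = UNIV"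

definition closed_operator :: "'h::complex_hilbert_space operator \<Rightarrow> bool"
  where "closed_operator A \<longleftrightarrow> closed (Map.graph A)"

definition kernel :: "'h::complex_hilbert_space operator \<Rightarrow> 'h set"
  where "kernel A = {f. A f = Some 0}"

text \<open>The adjoint; meaningful for densely defined \<open>A\<close>, for which the vector \<open>h\<close> below is unique.\<close>

definition op_adjoint :: "'h::complex_hilbert_space operator \<Rightarrow> 'h operator"
  where "op_adjoint A = (\<lambda>g.
    if \<exists>h. \<forall>f\<in>dom A. cinner (the (A f)) g = cinner f h
    then Some (THE h. \<forall>f\<in>dom A. cinner (the (A f)) g = cinner f h)
    else None)"

definition selfadjoint :: "'h::complex_hilbert_space operator \<Rightarrow> bool"
  where "selfadjoint A \<longleftrightarrow> linear_operator A \<and> densely_defined A \<and> op_adjoint A = A"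

definition positive_operator :: "'h::complex_hilbert_space operator \<Rightarrow> bool"
  where "positive_operator A \<longleftrightarrow> (\<forall>f\<in>dom A. cinner (the (A f)) f \<in> \<real>\<^sub>\<ge>\<^sub>0)"

text \<open>
  The modulus \<open>|A|\<close>. A positive selfadjoint operator has exactly one positive selfadjoint square
  root, so the choice is immaterial for closed densely defined \<open>A\<close>.
\<close>

definition modulus :: "'h::complex_hilbert_space operator \<Rightarrow> 'h operator"
  where "modulus A = (SOME M.
    selfadjoint M \<and> positive_operator M \<and> M \<circ>\<^sub>m M = op_adjoint A \<circ>\<^sub>m A)"


text \<open>The algebra of bounded operators; the operator norm is \<^const>\<open>onorm\<close>.\<close>

definition bounded_clinear :: "('h::complex_hilbert_space \<Rightarrow> 'h) \<Rightarrow> bool"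
  where "bounded_clinear T \<longleftrightarrow> bounded_linear T \<and> (\<forall>a x. T (a *\<^sub>C x) = a *\<^sub>C T x)"

definition orthogonal_projection :: "('h::complex_hilbert_space \<Rightarrow> 'h) \<Rightarrow> bool"
  where "orthogonal_projection P \<longleftrightarrow>
    bounded_clinear P \<and> P \<circ> P = P \<and> (\<forall>x y. cinner (P x) y = cinner x (P y))"

definition projection_onto :: "'h::complex_hilbert_space set \<Rightarrow> 'h \<Rightarrow> 'h"
  where "projection_onto S = (THE P. orthogonal_projection P \<and> range P = S)"

definition partial_isometry :: "('h::complex_hilbert_space \<Rightarrow> 'h) \<Rightarrow> bool"
  where "partial_isometry U \<longleftrightarrow>
    bounded_clinear U \<and>
    (\<forall>x. (\<forall>y. U y = 0 \<longrightarrow> cinner x y = 0) \<longrightarrow> norm (U x) = norm x)"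

definition polar_isometry :: "'h::complex_hilbert_space operator \<Rightarrow> 'h \<Rightarrow> 'h"
  where "polar_isometry A = (THE U.
    partial_isometry U \<and> kernel (everywhere U) = kernel A \<and>
    A = everywhere U \<circ>\<^sub>m modulus A)"


abbreviation borel_nonneg :: "real measure"
  where "borel_nonneg \<equiv> restrict_space borel {0..}"

definition spectral_measure :: "(real set \<Rightarrow> 'h::complex_hilbert_space \<Rightarrow> 'h) \<Rightarrow> bool"
  where "spectral_measure E \<longleftrightarrow>
    (\<forall>\<sigma>\<in>sets borel_nonneg. orthogonal_projection (E \<sigma>)) \<and>
    E {0..} = id \<and>
    (\<forall>F. range F \<subseteq> sets borel_nonneg \<longrightarrow> disjoint_family F \<longrightarrow>
      (\<forall>x. (\<lambda>n::nat. E (F n) x) sums E (\<Union>n. F n) x))"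

text \<open>The finite positive measure \<open>\<sigma> \<mapsto> \<langle>E(\<sigma>)f, f\<rangle>\<close>.\<close>

definition scalar_measure ::
    "(real set \<Rightarrow> 'h::complex_hilbert_space \<Rightarrow> 'h) \<Rightarrow> 'h \<Rightarrow> real measure"
  where "scalar_measure E f =
    measure_of {0..} (sets borel_nonneg) (\<lambda>\<sigma>. ennreal (Re (cinner (E \<sigma> f) f)))"

text \<open>
  The relation \<open>M = \<integral> x dE(x)\<close>: the domain of the spectral integral consists of all \<open>f\<close> such that
  \<open>\<integral> x\<^sup>2 d\<langle>E(x)f, f\<rangle> < \<infinity>\<close>, and on this (dense) subspace the linear operator \<open>M\<close> is
  determined, by polarization, by its quadratic form \<open>\<langle>Mf, f\<rangle> = \<integral> x d\<langle>E(x)f, f\<rangle>\<close>.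
\<close>

definition has_spectral_measure ::
    "'h::complex_hilbert_space operator \<Rightarrow> (real set \<Rightarrow> 'h \<Rightarrow> 'h) \<Rightarrow> bool"
  where "has_spectral_measure M E \<longleftrightarrow>
    spectral_measure E \<and>
    dom M = {f. (\<integral>\<^sup>+x. ennreal (x\<^sup>2) \<partial>scalar_measure E f) < \<infinity>} \<and>
    (\<forall>f\<in>dom M. cinner (the (M f)) f = complex_of_real (\<integral>x. x \<partial>scalar_measure E f))"

text \<open>
  The spectral measure of a positive selfadjoint operator. Its values on Borel subsets of \<open>[0, \<infinity>)\<close>
  are uniquely determined; the values elsewhere are arbitrary and never used.
\<close>

definition spectral_measure_of ::
    "'h::complex_hilbert_space operator \<Rightarrow> real set \<Rightarrow> 'h \<Rightarrow> 'h"
  where "spectral_measure_of M = (SOME E. has_spectral_measure M E)"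


text \<open>
  Both inner products in the defining inequality are nonnegative real numbers, because \<open>E(\<sigma>)\<close> is
  an orthogonal projection; taking real parts only serves to compare them in \<^typ>\<open>real\<close>.
\<close>

definition weakly_quasinormal_bound :: "'h::complex_hilbert_space operator \<Rightarrow> real \<Rightarrow> bool"
  where "weakly_quasinormal_bound A c \<longleftrightarrow>
    0 \<le> c \<and>
    (\<forall>\<sigma>\<in>sets borel_nonneg. \<forall>f\<in>dom A.
      Re (cinner (spectral_measure_of (modulus A) \<sigma> (the (modulus A f))) (the (modulus A f)))
      \<le> c * Re (cinner (spectral_measure_of (modulus A) \<sigma> (the (A f))) (the (A f))))"

definition weakly_quasinormal :: "'h::complex_hilbert_space operator \<Rightarrow> bool"
  where "weakly_quasinormal A \<longleftrightarrow>
    linear_operator A \<and> closed_operator A \<and> densely_defined A \<and>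
    (\<exists>c. weakly_quasinormal_bound A c)"

definition quasinormal_const :: "'h::complex_hilbert_space operator \<Rightarrow> real"
  where "quasinormal_const A = (LEAST c. weakly_quasinormal_bound A c)"

end

theory Submission
  imports Defs
begin

text \<open>
  A bounded \<open>T\<close> with \<open>T |A| \<subseteq> |A| T\<close> commutes with the spectral measure \<open>E\<close> of \<open>|A|\<close>, so
  \<open>\<parallel>E(\<sigma>) |A| f\<parallel> = \<parallel>T E(\<sigma>) A f\<parallel> \<le> \<parallel>T\<parallel> \<parallel>E(\<sigma>) A f\<parallel>\<close> gives (i) from (ii). Conversely, the inequality in (i)
  makes \<open>\<Sum> E(\<sigma>\<^sub>i) A f\<^sub>i \<mapsto> \<Sum> E(\<sigma>\<^sub>i) |A| f\<^sub>i\<close> well defined and bounded; its extension by zero on the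
  orthogonal complement is \<open>T\<close>. Assertion (v) follows from \<open>\<parallel>T A f\<parallel> = \<parallel>|A| f\<parallel> = \<parallel>A f\<parallel>\<close>.

  Everything rests on the existence of \<open>|A|\<close> and \<open>E\<close>. With \<open>D = (1 + A\<^sup>* A)\<^sup>-\<^sup>1\<close>, a bounded positive
  operator, \<open>|A| = (1 - D)\<^sup>1\<^sup>/\<^sup>2 D\<^sup>-\<^sup>1\<^sup>/\<^sup>2\<close>. For a positive selfadjoint \<open>M\<close>, the projection \<open>E([0, t])\<close> is
  the one onto the kernel of \<open>|S| - S\<close> for \<open>S = (1 + M)\<^sup>-\<^sup>1 - (1 + t)\<^sup>-\<^sup>1\<close>; the scalar Stieltjes measures of this
  family determine the projections \<open>E(\<sigma>)\<close> for all Borel sets by a Dynkin argument. Operators are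
  treated over the real inner product, complex linear maps being the real linear ones that commute
  with complex scalars.
\<close>

section \<open>Bounded operators on real Hilbert spaces\<close>

text \<open>Both \<open>modulus\<close> and \<open>spectral_measure_of\<close> are
  \<open>SOME\<close> choices, so nothing about the operators and projections that prove existence
  survives into the later arguments: every property of |A| must come from selfadjointness,
  positivity and |A|^2 = A^* A, and every property of E from the domain condition and the quadratic
  form in \<open>has_spectral_measure\<close>. This is why D(|A|) = D(A) with equal norms needs
  D(A^* A) to be a core, and why commutation with E is proved for an arbitrary E with these
  properties. Square roots of bounded positive maps replace a functional calculus; their use rests
  on the clause that the root commutes with whatever commutes with the given map. The resolvent (1 +
  M)^-1 is the bounded substitute for M, being injective with range D(M).\<close>

lemma real_le_mult_square_eq_0:
  fixes b c :: real
  assumes "\<And>t. 2 * t * b \<le> t\<^sup>2 * c"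
  shows "b = 0"
proof (rule ccontr)
  assume b: "b \<noteq> 0"
  \<comment> \<open>As \<open>d\<close> is positive and larger than \<open>c\<close>, the choice t =
    b / d makes the quadratic term at most b^2 / d, half of the linear one.\<close>
  define d where "d = \<bar>c\<bar> + 1"
  have "2 * (b / d) * b \<le> (b / d)\<^sup>2 * c" by (rule assms)
  also have "\<dots> \<le> (b / d)\<^sup>2 * d" by (rule mult_left_mono) (auto simp: d_def)
  also have "\<dots> = (b / d) * b" by (simp add: power2_eq_square d_def)
  finally have "b * b / d \<le> 0" by simp
  moreover have "0 < b * b" using b by (simp flip: power2_eq_square)
  then have "0 < b * b / d" by (simp add: d_def add_nonneg_pos)
  ultimately show False by simp
qed

text \<open>The exponent covers both uses: Lipschitz domination with \<open>p = 1\<close>, and with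
  \<open>p = 2\<close> orthogonal increments, whose squared length is an increment of a monotone
  real sequence. The estimate is asked for \<open>n \<le> m\<close> only, where such increments have
  a sign.\<close>

lemma Cauchy_dominated:
  fixes f :: "nat \<Rightarrow> 'a::metric_space" and a :: "nat \<Rightarrow> 'b::metric_space"
  assumes a: "Cauchy a" and p: "0 < p" and C: "0 \<le> C"
    and le: "\<And>m n. n \<le> m \<Longrightarrow> dist (f m) (f n) ^ p \<le> C * dist (a m) (a n)"
  shows "Cauchy f"
proof (rule metric_CauchyI)
  fix e :: real assume e: "0 < e"
  then have "0 < e ^ p / (C + 1)" using C by simp
  then obtain N where N: "\<forall>m\<ge>N. \<forall>n\<ge>N. dist (a m) (a n) < e ^ p / (C + 1)"
    using metric_CauchyD[OF a] by blast
  have main: "dist (f m) (f n) < e" if "n \<le> m" "N \<le> n" for m n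
  proof -
    have "dist (f m) (f n) ^ p \<le> (C + 1) * dist (a m) (a n)"
      using le[OF that(1)] by (rule order_trans) (simp add: distrib_right)
    also have "\<dots> < e ^ p" using N that C by (simp add: field_simps)
    finally show ?thesis using e by (simp add: power_less_imp_less_base)
  qed
  show "\<exists>M. \<forall>m\<ge>M. \<forall>n\<ge>M. dist (f m) (f n) < e"
  proof (intro exI allI impI)
    fix m n assume "N \<le> m" "N \<le> n"
    then show "dist (f m) (f n) < e"
      using main[of m n] main[of n m] by (cases "n \<le> m") (auto simp: dist_commute)
  qed
qed

text \<open>A minimizing sequence is Cauchy by the parallelogram law, because midpoints stay in
  \<open>S\<close>; varying the minimizer along a vector of \<open>S\<close> gives orthogonality. As
  only a real inner product is assumed, the result also applies to graphs in the product
  space.\<close>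

lemma orthogonal_decomposition:
  fixes S :: "'a::{real_inner,complete_space} set"
  assumes S: "subspace S" and cl: "closed S"
  obtains p where "p \<in> S" "\<And>s. s \<in> S \<Longrightarrow> (x - p) \<bullet> s = 0"
proof -
  define D where "D = (INF s\<in>S. (norm (x - s))\<^sup>2)"
  have ne: "S \<noteq> {}" using subspace_0[OF S] by auto
  have bdd: "bdd_below ((\<lambda>s. (norm (x - s))\<^sup>2) ` S)" by (rule bdd_belowI2[of _ 0]) simp
  have D_le: "D \<le> (norm (x - s))\<^sup>2" if "s \<in> S" for s
    unfolding D_def by (rule cINF_lower[OF bdd that])
  have "\<exists>s\<in>S. (norm (x - s))\<^sup>2 < D + 1 / real (Suc n)" for n
    using cINF_less_iff[OF ne bdd, of "D + 1 / real (Suc n)"] by (simp add: D_def)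
  then obtain s where s: "\<And>n. s n \<in> S" "\<And>n. (norm (x - s n))\<^sup>2 < D + 1 / real (Suc n)" by metis
  have par: "(norm (s m - s n))\<^sup>2 \<le> 2 * (1 / real (Suc m)) + 2 * (1 / real (Suc n))" for m n
  proof -
    have "(1/2) *\<^sub>R (s m + s n) \<in> S" using s(1) S by (simp add: subspace_add subspace_scale)
    then have "D \<le> (norm (x - (1/2) *\<^sub>R (s m + s n)))\<^sup>2" by (rule D_le)
    moreover have "(norm (s m - s n))\<^sup>2 = 2 * (norm (x - s m))\<^sup>2 + 2 * (norm (x - s n))\<^sup>2
        - 4 * (norm (x - (1/2) *\<^sub>R (s m + s n)))\<^sup>2"
      by (simp add: power2_norm_eq_inner algebra_simps inner_commute)
    ultimately show ?thesis using s(2)[of m] s(2)[of n] by linarith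
  qed
  have "Cauchy s"
  proof (rule metric_CauchyI)
    fix e :: real assume e: "0 < e"
    then obtain N where N: "1 / real (Suc N) < e\<^sup>2 / 4"
      using nat_approx_posE[of "e\<^sup>2 / 4"] by auto
    have "dist (s m) (s n) < e" if "m \<ge> N" "n \<ge> N" for m n
    proof -
      have "1 / real (Suc m) \<le> 1 / real (Suc N)" "1 / real (Suc n) \<le> 1 / real (Suc N)"
        using that by (auto simp: field_simps)
      then have "(norm (s m - s n))\<^sup>2 < e\<^sup>2" using par[of m n] N by linarith
      then show ?thesis using e by (simp add: dist_norm power_less_imp_less_base)
    qed
    then show "\<exists>M. \<forall>m\<ge>M. \<forall>n\<ge>M. dist (s m) (s n) < e" by blast
  qed
  then obtain p where p: "s \<longlonglongrightarrow> p" using Cauchy_convergent convergent_def by blast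
  have pS: "p \<in> S" using closed_sequentially[OF cl] s(1) p by blast
  have "(\<lambda>n. (norm (x - s n))\<^sup>2) \<longlonglongrightarrow> (norm (x - p))\<^sup>2" by (intro tendsto_intros p)
  moreover have "(\<lambda>n. D + 1 / real (Suc n)) \<longlonglongrightarrow> D + 0"
    by (intro tendsto_intros LIMSEQ_Suc[OF lim_1_over_n])
  ultimately have pD: "(norm (x - p))\<^sup>2 \<le> D"
    using s(2) by (intro LIMSEQ_le[where Y="\<lambda>n. D + 1 / real (Suc n)"]) (auto intro!: exI[of _ 0] less_imp_le)
  have "(x - p) \<bullet> u = 0" if u: "u \<in> S" for u
  proof (rule real_le_mult_square_eq_0[of _ "u \<bullet> u"])
    fix t :: real
    have "p + t *\<^sub>R u \<in> S" using u pS S by (simp add: subspace_add subspace_scale)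
    then have "(norm (x - p))\<^sup>2 \<le> (norm (x - (p + t *\<^sub>R u)))\<^sup>2"
      using order_trans[OF pD D_le] by blast
    then show "2 * t * ((x - p) \<bullet> u) \<le> t\<^sup>2 * (u \<bullet> u)"
      unfolding power2_norm_eq_inner by (simp add: power2_eq_square algebra_simps inner_commute)
  qed
  with pS show ?thesis by (rule that)
qed

section \<open>Symmetric maps, positive maps and projections\<close>

definition symmetric_map :: "('a::real_inner \<Rightarrow> 'a) \<Rightarrow> bool"
  where "symmetric_map T \<longleftrightarrow> bounded_linear T \<and> (\<forall>x y. T x \<bullet> y = x \<bullet> T y)"

definition positive_map :: "('a::real_inner \<Rightarrow> 'a) \<Rightarrow> bool"
  where "positive_map T \<longleftrightarrow> symmetric_map T \<and> (\<forall>x. 0 \<le> T x \<bullet> x)"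

definition projection :: "('a::real_inner \<Rightarrow> 'a) \<Rightarrow> bool"
  where "projection P \<longleftrightarrow> symmetric_map P \<and> (\<forall>x. P (P x) = P x)"

lemma symmetric_mapD:
  assumes "symmetric_map T"
  shows "bounded_linear T" "T x \<bullet> y = x \<bullet> T y"
  using assms by (auto simp: symmetric_map_def)

lemma projectionD:
  assumes "projection P"
  shows "symmetric_map P" "bounded_linear P" "P x \<bullet> y = x \<bullet> P y" "P (P x) = P x"
    "P x \<bullet> x = (norm (P x))\<^sup>2" "norm (P x) \<le> norm x" "(x - P x) \<bullet> P y = 0"
proof -
  show 1: "symmetric_map P" "bounded_linear P" "P x \<bullet> y = x \<bullet> P y" "P (P x) = P x" for x y
    using assms by (auto simp: projection_def symmetric_map_def)
  show 2: "P x \<bullet> x = (norm (P x))\<^sup>2" by (metis 1(3,4) power2_norm_eq_inner)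
  have "norm (P x) * norm (P x) \<le> norm (P x) * norm x"
    using 2 norm_cauchy_schwarz[of "P x" x] by (simp add: power2_eq_square)
  then show "norm (P x) \<le> norm x"
    by (cases "norm (P x) = 0") (auto simp: mult_le_cancel_left)
  show "(x - P x) \<bullet> P y = 0" by (metis 1(3,4) inner_diff_left right_minus_eq)
qed

lemma bounded_linear_minus_id: "bounded_linear T \<Longrightarrow> bounded_linear (\<lambda>x. x - T x)"
  by (intro bounded_linear_sub bounded_linear_ident)

lemma projection_complement: "projection P \<Longrightarrow> projection (\<lambda>x. x - P x)"
  unfolding projection_def symmetric_map_def
  by (auto simp: bounded_linear_minus_id inner_diff linear_diff[OF bounded_linear.linear])

text \<open>A vector p of \<open>S\<close> with x - p orthogonal to \<open>S\<close> is unique;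
  linearity and idempotence of P follow from this uniqueness.\<close>

lemma projection_onto_exists:
  fixes S :: "'a::{real_inner,complete_space} set"
  assumes S: "subspace S" and cl: "closed S"
  obtains P where "projection P" "range P = S"
proof -
  have "\<exists>p. p \<in> S \<and> (\<forall>s\<in>S. (x - p) \<bullet> s = 0)" for x
    by (rule orthogonal_decomposition[OF assms, of x]) blast
  then obtain P where P: "\<And>x. P x \<in> S" "\<And>x s. s \<in> S \<Longrightarrow> (x - P x) \<bullet> s = 0" by metis
  have uniq: "p = P x" if "p \<in> S" "\<And>s. s \<in> S \<Longrightarrow> (x - p) \<bullet> s = 0" for p x
  proof -
    have "p - P x \<in> S" using that(1) P(1) S by (simp add: subspace_diff)
    then have "(p - P x) \<bullet> (p - P x) = 0"
      using that(2)[of "p - P x"] P(2)[of "p - P x" x] by (simp add: inner_diff_left)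
    then show ?thesis by simp
  qed
  have sym: "P x \<bullet> y = x \<bullet> P y" for x y
  proof -
    have "P x \<bullet> P y = x \<bullet> P y" using P(2)[OF P(1)[of y], of x] by (simp add: inner_diff_left)
    moreover have "P y \<bullet> P x = y \<bullet> P x"
      using P(2)[OF P(1)[of x], of y] by (simp add: inner_diff_left)
    ultimately show ?thesis by (simp add: inner_commute)
  qed
  have idem: "P s = s" if "s \<in> S" for s using uniq[of s s] that by simp
  have nm: "norm (P x) \<le> norm x" for x
  proof -
    have "norm (P x) * norm (P x) \<le> norm (P x) * norm x"
      using P(2)[OF P(1)[of x], of x] norm_cauchy_schwarz[of x "P x"]
      by (simp add: inner_diff_left dot_square_norm power2_eq_square mult.commute)
    then show ?thesis by (cases "norm (P x) = 0") (auto simp: mult_le_cancel_left)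
  qed
  have "bounded_linear P"
  proof (rule bounded_linear_intro[where K=1])
    show "P (x + y) = P x + P y" for x y
    proof (rule uniq[symmetric])
      show "P x + P y \<in> S" using P(1) S by (simp add: subspace_add)
      show "(x + y - (P x + P y)) \<bullet> s = 0" if "s \<in> S" for s
        using P(2)[OF that, of x] P(2)[OF that, of y]
        by (simp add: inner_left_distrib inner_diff_left)
    qed
    show "P (r *\<^sub>R x) = r *\<^sub>R P x" for r x
    proof (rule uniq[symmetric])
      show "r *\<^sub>R P x \<in> S" using P(1) S by (simp add: subspace_scale)
      show "(r *\<^sub>R x - r *\<^sub>R P x) \<bullet> s = 0" if "s \<in> S" for s
        using P(2)[OF that, of x] by (simp add: inner_diff_left)
    qed
    show "norm (P x) \<le> norm x * 1" for x using nm by simp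
  qed
  then have "projection P" using sym idem P(1) by (auto simp: projection_def symmetric_map_def)
  moreover have "range P = S" using P(1) idem by (metis image_subset_iff range_eqI subsetI subset_antisym)
  ultimately show ?thesis by (rule that)
qed

section \<open>Riesz representation, adjoints and quadratic forms\<close>

lemma riesz_representation:
  fixes \<phi> :: "'a::{real_inner,complete_space} \<Rightarrow> real"
  assumes "bounded_linear \<phi>"
  obtains h where "\<And>x. \<phi> x = x \<bullet> h"
proof (cases "\<forall>x. \<phi> x = 0")
  case True
  then show ?thesis using that[of 0] by simp
next
  case False
  then obtain x0 where x0: "\<phi> x0 \<noteq> 0" by blast
  interpret bounded_linear \<phi> by fact
  have S: "subspace {x. \<phi> x = 0}" by (auto simp: subspace_def add scaleR zero)
  have cl: "closed {x. \<phi> x = 0}"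
    by (intro closed_Collect_eq continuous_intros linear_continuous_on assms)
  obtain p where p: "\<phi> p = 0" "\<And>s. \<phi> s = 0 \<Longrightarrow> (x0 - p) \<bullet> s = 0"
    using orthogonal_decomposition[OF S cl, of x0] by auto
  define z where "z = x0 - p"
  have z: "\<phi> z \<noteq> 0" using x0 p(1) by (simp add: z_def diff)
  then have zz: "z \<bullet> z \<noteq> 0" using zero by auto
  have "\<phi> x = x \<bullet> ((\<phi> z / (z \<bullet> z)) *\<^sub>R z)" for x
  proof -
    have "\<phi> (x - (\<phi> x / \<phi> z) *\<^sub>R z) = 0" using z by (simp add: diff scaleR)
    from p(2)[OF this] have "z \<bullet> x = \<phi> x / \<phi> z * (z \<bullet> z)"
      by (simp add: z_def[symmetric] inner_diff_right)
    then show ?thesis using z zz by (simp add: inner_commute field_simps)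
  qed
  then show ?thesis by (rule that)
qed

lemma adjoint_map_exists:
  fixes T :: "'a::{real_inner,complete_space} \<Rightarrow> 'a"
  assumes T: "bounded_linear T"
  obtains T' where "bounded_linear T'" "\<And>x y. T x \<bullet> y = x \<bullet> T' y"
proof -
  interpret T: bounded_linear T by fact
  have "\<exists>h. \<forall>x. T x \<bullet> y = x \<bullet> h" for y
  proof -
    have "bounded_linear (\<lambda>x. T x \<bullet> y)" using T by (intro bounded_linear_inner_left_comp)
    then show ?thesis by (rule riesz_representation) blast
  qed
  then obtain T' where T': "\<And>x y. T x \<bullet> y = x \<bullet> T' y" by metis
  obtain K where K: "0 \<le> K" "\<And>x. norm (T x) \<le> norm x * K" using T.nonneg_bounded by blast
  have eqI: "u = v" if "\<And>x. x \<bullet> u = x \<bullet> v" for u v :: 'a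
    using that[of "u - v"] by (metis inner_diff_right inner_eq_zero_iff right_minus_eq)
  have "bounded_linear T'"
  proof (rule bounded_linear_intro[where K=K])
    show "T' (x + y) = T' x + T' y" for x y
      by (rule eqI) (simp add: inner_right_distrib flip: T')
    show "T' (r *\<^sub>R x) = r *\<^sub>R T' x" for r x by (rule eqI) (simp flip: T')
    fix y
    have "norm (T' y) * norm (T' y) = T (T' y) \<bullet> y"
      by (simp add: T' power2_norm_eq_inner flip: power2_eq_square)
    also have "\<dots> \<le> norm (T (T' y)) * norm y" by (rule norm_cauchy_schwarz)
    also have "\<dots> \<le> norm (T' y) * K * norm y" by (rule mult_right_mono[OF K(2)]) simp
    finally have "norm (T' y) * norm (T' y) \<le> norm (T' y) * (norm y * K)" by (simp add: ac_simps)
    then show "norm (T' y) \<le> norm y * K"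
      using K(1) by (cases "norm (T' y) = 0") (auto simp: mult_le_cancel_left)
  qed
  then show ?thesis using T' by (rule that)
qed

lemma inner_eqI: "(\<And>z. x \<bullet> z = y \<bullet> z) \<Longrightarrow> x = y"
  by (metis inner_diff_left inner_eq_zero_iff right_minus_eq)

lemma positive_form_Cauchy_Schwarz:
  fixes T :: "'a::real_inner \<Rightarrow> 'a"
  assumes T: "linear T" and sym: "\<And>x y. T x \<bullet> y = x \<bullet> T y" and pos: "\<And>x. 0 \<le> T x \<bullet> x"
  shows "(T x \<bullet> y)\<^sup>2 \<le> (T x \<bullet> x) * (T y \<bullet> y)"
proof -
  have q: "0 \<le> T x \<bullet> x + 2 * t * (T x \<bullet> y) + t\<^sup>2 * (T y \<bullet> y)" for t
    using pos[of "x + t *\<^sub>R y"] sym[of y x]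
    by (simp add: linear_add[OF T] linear_scale[OF T] power2_eq_square algebra_simps inner_commute)
  show ?thesis
  proof (cases "T y \<bullet> y = 0")
    case True
    have "T x \<bullet> y = 0"
    proof (rule ccontr)
      assume "T x \<bullet> y \<noteq> 0"
      \<comment> \<open>The polynomial in t is affine here, and this t gives it the value
        -1.\<close>
      then show False using q[of "- (T x \<bullet> x + 1) / (2 * (T x \<bullet> y))"] True by (simp add: field_simps)
    qed
    then show ?thesis using True by simp
  next
    case False
    then have c: "T y \<bullet> y > 0" using pos[of y] by simp
    have "0 \<le> T x \<bullet> x - (T x \<bullet> y)\<^sup>2 / (T y \<bullet> y)"
      using q[of "- (T x \<bullet> y) / (T y \<bullet> y)"] c by (simp add: power2_eq_square)
    then show ?thesis using c by (simp add: field_simps)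
  qed
qed

text \<open>Cauchy-Schwarz for the form of \<open>T\<close>, applied to x and T x, gives |T x|^4
  \<le> k |x|^2 k |T x|^2. Estimates obtained for quadratic forms become norm estimates this
  way.\<close>

lemma norm_le_of_form_le:
  fixes T :: "'a::real_inner \<Rightarrow> 'a"
  assumes T: "linear T" and sym: "\<And>x y. T x \<bullet> y = x \<bullet> T y"
    and pos: "\<And>x. 0 \<le> T x \<bullet> x" and le: "\<And>x. T x \<bullet> x \<le> k * (x \<bullet> x)" and k: "0 \<le> k"
  shows "norm (T x) \<le> k * norm x"
proof (cases "T x = 0")
  case False
  have "((norm (T x))\<^sup>2)\<^sup>2 = (T x \<bullet> T x)\<^sup>2" by (simp add: power2_norm_eq_inner)
  also have "\<dots> \<le> (T x \<bullet> x) * (T (T x) \<bullet> T x)"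
    by (rule positive_form_Cauchy_Schwarz[OF T sym pos])
  also have "\<dots> \<le> (k * (norm x)\<^sup>2) * (k * (norm (T x))\<^sup>2)"
    using le[of x] le[of "T x"] pos k by (intro mult_mono) (auto simp: power2_norm_eq_inner)
  finally have "(norm (T x))\<^sup>2 * (norm (T x))\<^sup>2 \<le> (k * norm x)\<^sup>2 * (norm (T x))\<^sup>2"
    by (simp add: power2_eq_square ac_simps)
  then have "(norm (T x))\<^sup>2 \<le> (k * norm x)\<^sup>2"
    by (rule mult_right_le_imp_le) (use False in simp)
  then show ?thesis by (rule power2_le_imp_le) (use k in simp)
qed (use k in simp)

lemma positive_map_eq_0:
  assumes "positive_map T" "T x \<bullet> x = 0"
  shows "T x = 0"
proof -
  have "(T x \<bullet> T x)\<^sup>2 \<le> (T x \<bullet> x) * (T (T x) \<bullet> T x)"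
    using assms(1) by (intro positive_form_Cauchy_Schwarz)
      (auto simp: positive_map_def symmetric_map_def bounded_linear.linear)
  then show ?thesis using assms(2) by simp
qed

lemma symmetric_map_limit:
  fixes Q :: "nat \<Rightarrow> 'a::real_inner \<Rightarrow> 'a"
  assumes Q: "\<And>n. symmetric_map (Q n)" and le: "\<And>n x. norm (Q n x) \<le> norm x"
    and P: "\<And>x. (\<lambda>n. Q n x) \<longlonglongrightarrow> P x"
  shows "symmetric_map P" and "norm (P x) \<le> norm x"
proof -
  have lin: "linear (Q n)" for n using symmetric_mapD(1)[OF Q] bounded_linear.linear by blast
  show bd: "norm (P x) \<le> norm x" for x
    by (rule LIMSEQ_le_const2[OF tendsto_norm[OF P]]) (use le in auto)
  have "bounded_linear P"
  proof (rule bounded_linear_intro[where K=1])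
    show "P (u + v) = P u + P v" for u v
      using tendsto_add[OF P[of u] P[of v]] P[of "u + v"] LIMSEQ_unique by (auto simp: linear_add[OF lin])
    show "P (r *\<^sub>R u) = r *\<^sub>R P u" for r u
      using tendsto_scaleR[OF tendsto_const[of r] P[of u]] P[of "r *\<^sub>R u"] LIMSEQ_unique
      by (auto simp: linear_scale[OF lin])
  qed (use bd in simp)
  moreover have "P u \<bullet> v = u \<bullet> P v" for u v
    using tendsto_inner[OF P[of u] tendsto_const[of v]] tendsto_inner[OF tendsto_const[of u] P[of v]]
    by (simp add: symmetric_mapD(2)[OF Q] LIMSEQ_unique)
  ultimately show "symmetric_map P" by (simp add: symmetric_map_def)
qed

section \<open>Square roots of bounded positive maps\<close>

fun sqrt_iter :: "('a::real_vector \<Rightarrow> 'a) \<Rightarrow> nat \<Rightarrow> 'a \<Rightarrow> 'a" where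
  "sqrt_iter X 0 x = 0"
| "sqrt_iter X (Suc n) x = (1/2) *\<^sub>R (X x + sqrt_iter X n (sqrt_iter X n x))"

text \<open>The iterates \<open>Y\<^sub>n\<close> are polynomials in \<open>X\<close> with nonnegative coefficients, and so are
  \<open>Y\<^sub>n\<^sub>+\<^sub>1 - Y\<^sub>n\<close>; their norms are therefore dominated by the scalar iteration for \<open>X = 1\<close>. The
  limit solves \<open>2 Y = X + Y\<^sup>2\<close>, that is, \<open>(1 - Y)\<^sup>2 = 1 - X\<close>.\<close>

lemma sqrt_iter_limit:
  fixes X :: "'a::{real_inner,complete_space} \<Rightarrow> 'a"
  assumes X: "symmetric_map X" and le: "\<And>x. norm (X x) \<le> norm x"
  shows "\<exists>Y. symmetric_map Y \<and> (\<forall>x. norm (Y x) \<le> norm x) \<and> (\<forall>x. 2 *\<^sub>R Y x = X x + Y (Y x)) \<and>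
    (\<forall>T. bounded_linear T \<longrightarrow> (\<forall>x. T (X x) = X (T x)) \<longrightarrow> (\<forall>x. T (Y x) = Y (T x)))"
proof -
  define y :: "nat \<Rightarrow> real" where "y = rec_nat 0 (\<lambda>_ a. (1 + a * a) / 2)"
  have y0: "y 0 = 0" and yS: "y (Suc n) = (1 + y n * y n) / 2" for n by (simp_all add: y_def)
  have y01: "0 \<le> y n \<and> y n \<le> 1" for n
    by (induction n) (auto simp: y0 yS mult_le_one)
  have yinc: "y n \<le> y (Suc n)" for n
  proof -
    have "0 \<le> (1 - y n) * (1 - y n)" by simp
    then show ?thesis by (simp add: yS algebra_simps)
  qed
  then have "incseq y" by (rule incseq_SucI)
  have Xl: "bounded_linear X" and Xs: "X x \<bullet> y = x \<bullet> X y" for x y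
    using symmetric_mapD[OF X] by auto
  let ?Y = "sqrt_iter X"
  have Yl: "bounded_linear (?Y n)" for n
  proof (induction n)
    case 0
    then show ?case by simp
  next
    case (Suc n)
    show ?case
      unfolding sqrt_iter.simps
      by (intro bounded_linear_scaleR_right bounded_linear_const_scaleR bounded_linear_add Xl bounded_linear_compose[OF Suc Suc])
  qed
  have Yadd: "?Y n (a + b) = ?Y n a + ?Y n b" and Ydiff: "?Y n (a - b) = ?Y n a - ?Y n b"
    for n a b
    using bounded_linear.linear[OF Yl[of n]] by (auto simp: linear_add linear_diff)
  have Ysym: "?Y n u \<bullet> v = u \<bullet> ?Y n v" for n u v
    by (induction n arbitrary: u v) (simp_all add: inner_left_distrib inner_right_distrib Xs)
  have comm: "T (?Y n x) = ?Y n (T x)" if "bounded_linear T" "\<And>x. T (X x) = X (T x)" for T n x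
    using that
    by (induction n arbitrary: x)
       (simp_all add: linear_0[OF bounded_linear.linear] linear_add[OF bounded_linear.linear]
          linear_scale[OF bounded_linear.linear])
  have commY: "?Y m (?Y n x) = ?Y n (?Y m x)" for m n x
  proof (rule comm[OF Yl])
    show "?Y m (X x) = X (?Y m x)" for x using comm[OF Xl refl] by metis
  qed
  have Yle: "norm (?Y n x) \<le> y n * norm x" for n x
  proof (induction n arbitrary: x)
    case (Suc n)
    have "norm (?Y n (?Y n x)) \<le> y n * norm (?Y n x)" by (rule Suc)
    also have "\<dots> \<le> y n * (y n * norm x)" using Suc y01 by (intro mult_left_mono) auto
    finally have "norm (X x + ?Y n (?Y n x)) \<le> norm x + y n * (y n * norm x)"
      using norm_triangle_ineq[of "X x" "?Y n (?Y n x)"] le[of x] by linarith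
    moreover have "norm (?Y (Suc n) x) = norm (X x + ?Y n (?Y n x)) / 2"
      by (simp del: scaleR_add_right scaleR_right_distrib)
    ultimately show ?case by (simp add: yS field_simps del: sqrt_iter.simps)
  qed (simp add: y0)
  have Ystep: "norm (?Y (Suc n) x - ?Y n x) \<le> (y (Suc n) - y n) * norm x" for n x
  proof (induction n arbitrary: x)
    case 0
    then show ?case using le by (simp add: yS y0)
  next
    case (Suc n)
    let ?d = "?Y (Suc n) x - ?Y n x"
    have "(1/2) *\<^sub>R (X x + a) - (1/2) *\<^sub>R (X x + b) = (1/2) *\<^sub>R (a - b)" for a b
      by (simp add: algebra_simps)
    then have "?Y (Suc (Suc n)) x - ?Y (Suc n) x
        = (1/2) *\<^sub>R (?Y (Suc n) (?Y (Suc n) x) - ?Y n (?Y n x))"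
      by (metis sqrt_iter.simps(2))
    \<comment> \<open>a^2 - b^2 = a (a - b) + b (a - b), legitimate for operators because the
      iterates commute.\<close>
    also have "\<dots> = (1/2) *\<^sub>R (?Y (Suc n) ?d + ?Y n ?d)"
      by (simp add: Ydiff commY[of n "Suc n"] del: sqrt_iter.simps)
    finally have eq: "?Y (Suc (Suc n)) x - ?Y (Suc n) x = (1/2) *\<^sub>R (?Y (Suc n) ?d + ?Y n ?d)" .
    have "norm (?Y (Suc n) ?d + ?Y n ?d) \<le> y (Suc n) * norm ?d + y n * norm ?d"
      by (intro norm_triangle_le add_mono Yle)
    also have "\<dots> = (y (Suc n) + y n) * norm ?d" by (simp add: algebra_simps)
    also have "\<dots> \<le> (y (Suc n) + y n) * ((y (Suc n) - y n) * norm x)"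
      using Suc y01 by (intro mult_left_mono add_nonneg_nonneg) auto
    also have "\<dots> = 2 * (y (Suc (Suc n)) - y (Suc n)) * norm x"
      unfolding yS[of "Suc n"] yS[of n] by (simp add: field_simps)
    finally have "norm (?Y (Suc n) ?d + ?Y n ?d) \<le> 2 * (y (Suc (Suc n)) - y (Suc n)) * norm x" .
    moreover have "norm ((1/2) *\<^sub>R v) = norm v / 2" for v :: 'a by simp
    ultimately show ?case unfolding eq by (simp only:)
  qed
  have Ydist: "norm (?Y (n + k) x - ?Y n x) \<le> (y (n + k) - y n) * norm x" for n k x
  proof (induction k)
    case (Suc k)
    have "norm (?Y (n + Suc k) x - ?Y n x)
        \<le> norm (?Y (Suc (n + k)) x - ?Y (n + k) x) + norm (?Y (n + k) x - ?Y n x)"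
      using norm_triangle_ineq[of "?Y (Suc (n + k)) x - ?Y (n + k) x" "?Y (n + k) x - ?Y n x"]
      by (simp del: sqrt_iter.simps)
    also have "\<dots> \<le> (y (Suc (n + k)) - y (n + k)) * norm x + (y (n + k) - y n) * norm x"
      by (intro add_mono Ystep Suc)
    finally show ?case by (simp add: algebra_simps del: sqrt_iter.simps)
  qed simp
  have yconv: "convergent y"
    using \<open>incseq y\<close> y01 by (metis convergent_def incseq_convergent)
  have Yconv: "convergent (\<lambda>n. ?Y n x)" for x
  proof (rule Cauchy_convergent, rule Cauchy_dominated[OF convergent_Cauchy[OF yconv], where p=1 and C="norm x"])
    fix m n :: nat assume "n \<le> m"
    then have "norm (?Y m x - ?Y n x) \<le> (y m - y n) * norm x" using Ydist[of n "m - n" x] by simp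
    also have "\<dots> \<le> norm x * dist (y m) (y n)"
      by (simp add: dist_real_def mult.commute mult_left_mono)
    finally show "dist (?Y m x) (?Y n x) ^ 1 \<le> norm x * dist (y m) (y n)" by (simp add: dist_norm)
  qed simp_all
  define Y where "Y x = lim (\<lambda>n. ?Y n x)" for x
  have Y: "(\<lambda>n. ?Y n x) \<longlonglongrightarrow> Y x" for x using Yconv by (simp add: Y_def convergent_LIMSEQ_iff)
  have Yle1: "norm (?Y n x) \<le> norm x" for n x
    using Yle[of n x] y01[of n] mult_right_mono[of "y n" 1 "norm x"] by simp
  have "symmetric_map (?Y n)" for n using Yl Ysym by (simp add: symmetric_map_def)
  note lim = symmetric_map_limit[OF this Yle1 Y]
  \<comment> \<open>The norm bound 1, uniform in n, lets the operator and its argument converge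
    together.\<close>
  have YY: "(\<lambda>n. ?Y n (?Y n x)) \<longlonglongrightarrow> Y (Y x)" for x
  proof -
    have "(\<lambda>n. norm (?Y n x - Y x)) \<longlonglongrightarrow> 0" using Y[of x] by (simp add: LIM_zero tendsto_norm_zero)
    then have "(\<lambda>n. ?Y n (?Y n x - Y x)) \<longlonglongrightarrow> 0"
      by (rule Lim_null_comparison[rotated]) (simp add: Yle1)
    from tendsto_add[OF this Y[of "Y x"]] show ?thesis by (simp add: Ydiff)
  qed
  have fixpt: "2 *\<^sub>R Y x = X x + Y (Y x)" for x
  proof -
    have "(\<lambda>n. 2 *\<^sub>R ?Y (Suc n) x) \<longlonglongrightarrow> 2 *\<^sub>R Y x"
      by (intro tendsto_intros LIMSEQ_Suc[OF Y])
    moreover have "(\<lambda>n. 2 *\<^sub>R ?Y (Suc n) x) \<longlonglongrightarrow> X x + Y (Y x)"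
      using tendsto_add[OF tendsto_const YY] by simp
    ultimately show ?thesis by (rule LIMSEQ_unique)
  qed
  have "T (Y x) = Y (T x)" if "bounded_linear T" "\<And>x. T (X x) = X (T x)" for T x
    using bounded_linear.tendsto[OF that(1) Y[of x]] Y[of "T x"]
    by (simp add: comm[OF that] LIMSEQ_unique)
  then show ?thesis using lim fixpt by blast
qed

text \<open>For K bounding the norm of S, X = 1 - S / K satisfies 0 \<le> X \<le> 1, so the limit Y
  for X gives (1 - Y)^2 = S / K and R = sqrt K (1 - Y). Positivity of R is |Y x| \<le> |x|. The
  commutation clause passes through, since commuting with S and with X is the same.\<close>

lemma positive_map_sqrt:
  fixes S :: "'a::{real_inner,complete_space} \<Rightarrow> 'a"
  assumes S: "positive_map S"
  shows "\<exists>R. positive_map R \<and> (\<forall>x. R (R x) = S x) \<and>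
    (\<forall>T. bounded_linear T \<longrightarrow> (\<forall>x. T (S x) = S (T x)) \<longrightarrow> (\<forall>x. T (R x) = R (T x)))"
proof -
  have Sl: "bounded_linear S" and Ss: "S x \<bullet> y = x \<bullet> S y" and Sp: "0 \<le> S x \<bullet> x" for x y
    using S by (auto simp: positive_map_def symmetric_map_def)
  interpret S: bounded_linear S by (rule Sl)
  obtain K where K: "0 < K" "\<And>x. norm (S x) \<le> norm x * K" using S.pos_bounded by blast
  define X where "X x = x - (1 / K) *\<^sub>R S x" for x
  have Xl: "bounded_linear X" unfolding X_def
    by (intro bounded_linear_sub bounded_linear_ident bounded_linear_const_scaleR Sl)
  have Xs: "X x \<bullet> y = x \<bullet> X y" for x y by (simp add: X_def inner_diff Ss)
  have Xle: "norm (X x) \<le> 1 * norm x" for x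
  proof (rule norm_le_of_form_le[OF bounded_linear.linear[OF Xl] Xs])
    fix x
    have "S x \<bullet> x \<le> norm (S x) * norm x" by (rule norm_cauchy_schwarz)
    also have "\<dots> \<le> norm x * K * norm x" by (rule mult_right_mono[OF K(2)]) simp
    finally have "S x \<bullet> x \<le> K * (x \<bullet> x)" by (simp add: dot_square_norm power2_eq_square ac_simps)
    then show "0 \<le> X x \<bullet> x" using K(1) by (simp add: X_def inner_diff_left field_simps)
    show "X x \<bullet> x \<le> 1 * (x \<bullet> x)" using K(1) Sp[of x] by (simp add: X_def inner_diff_left)
  qed simp
  have X: "symmetric_map X" using Xl Xs by (simp add: symmetric_map_def)
  have Xle': "norm (X x) \<le> norm x" for x using Xle by simp
  obtain Y where Y: "symmetric_map Y" "\<forall>x. norm (Y x) \<le> norm x"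
    "\<forall>x. 2 *\<^sub>R Y x = X x + Y (Y x)"
    "\<forall>T. bounded_linear T \<longrightarrow> (\<forall>x. T (X x) = X (T x)) \<longrightarrow> (\<forall>x. T (Y x) = Y (T x))"
    using sqrt_iter_limit[OF X Xle'] by blast
  have Yl: "bounded_linear Y" and Ys: "Y x \<bullet> y = x \<bullet> Y y" for x y
    using symmetric_mapD[OF Y(1)] by auto
  interpret Y: bounded_linear Y by (rule Yl)
  define R where "R x = sqrt K *\<^sub>R (x - Y x)" for x
  have "bounded_linear R" unfolding R_def
    by (intro bounded_linear_sub bounded_linear_ident bounded_linear_const_scaleR Yl)
  moreover have "R x \<bullet> y = x \<bullet> R y" for x y by (simp add: R_def inner_diff Ys)
  moreover have "0 \<le> R x \<bullet> x" for x
  proof -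
    have "Y x \<bullet> x \<le> norm (Y x) * norm x" by (rule norm_cauchy_schwarz)
    also have "\<dots> \<le> norm x * norm x" by (rule mult_right_mono[OF Y(2)[rule_format]]) simp
    finally show ?thesis
      using K(1) by (auto simp: R_def inner_diff_left dot_square_norm power2_eq_square)
  qed
  ultimately have "positive_map R" by (auto simp: positive_map_def symmetric_map_def)
  moreover have "R (R x) = S x" for x
  proof -
    have "R (R x) = K *\<^sub>R (x - 2 *\<^sub>R Y x + Y (Y x))"
      using K(1) by (simp add: R_def Y.diff Y.scaleR algebra_simps scaleR_2)
    also have "\<dots> = K *\<^sub>R (x - X x)" by (simp add: Y(3))
    finally show ?thesis using K(1) by (simp add: X_def)
  qed
  moreover have "T (R x) = R (T x)" if T: "bounded_linear T" "\<And>x. T (S x) = S (T x)" for T x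
  proof -
    interpret T: bounded_linear T by (rule T)
    have "T (Y x) = Y (T x)" using Y(4) T by (simp add: X_def T.diff T.scaleR)
    then show ?thesis by (simp add: R_def T.diff T.scaleR)
  qed
  ultimately show ?thesis by blast
qed

section \<open>Spectral projections and resolutions of the identity\<close>

text \<open>Invariance of the range of P under T' is invariance of its orthogonal complement under
  T.\<close>

lemma projection_commute:
  assumes P: "projection P" and T: "bounded_linear T" and adj: "\<And>x y. T x \<bullet> y = x \<bullet> T' y"
    and inv: "\<And>x. P x = x \<Longrightarrow> P (T x) = T x" "\<And>x. P x = x \<Longrightarrow> P (T' x) = T' x"
  shows "T (P x) = P (T x)"
proof -
  interpret P: bounded_linear P by (rule projectionD(2)[OF P])
  interpret T: bounded_linear T by (rule T)
  have "P (T (x - P x)) \<bullet> z = 0 \<bullet> z" for z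
  proof -
    have "P (T (x - P x)) \<bullet> z = (x - P x) \<bullet> T' (P z)" by (simp add: projectionD(3)[OF P] adj)
    also have "\<dots> = (x - P x) \<bullet> P (T' (P z))" by (simp add: inv(2) projectionD(4)[OF P])
    finally show ?thesis by (simp add: projectionD(7)[OF P])
  qed
  then have "P (T (x - P x)) = 0" by (rule inner_eqI)
  then have "P (T x) = P (T (P x))" by (simp add: T.diff P.diff)
  also have "\<dots> = T (P x)" by (rule inv(1)) (rule projectionD(4)[OF P])
  finally show ?thesis by simp
qed

text \<open>The adjoint T' is carried along as an explicit witness; for symmetric B it commutes with
  B as soon as T does, so only T B = B T is demanded.\<close>

definition bicommutes :: "('a::real_inner \<Rightarrow> 'a) \<Rightarrow> ('a \<Rightarrow> 'a) \<Rightarrow> bool"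
  where "bicommutes B P \<longleftrightarrow>
    (\<forall>T T'. bounded_linear T \<longrightarrow> bounded_linear T' \<longrightarrow> (\<forall>x y. T x \<bullet> y = x \<bullet> T' y) \<longrightarrow>
      (\<forall>x. T (B x) = B (T x)) \<longrightarrow> (\<forall>x. T (P x) = P (T x)))"

text \<open>With S = B - l and R = |S|, P projects onto the kernel of S - R. Since S and R commute
  and S^2 = R^2, (S - R)(S + R) = 0: the range of S + R lies in that kernel, hence S + R vanishes on
  the complement, where S = -R \<le> 0. The upper estimate is strict because R x = 0 would put x
  into the range of P.\<close>

lemma spectral_projection:
  fixes B :: "'a::{real_inner,complete_space} \<Rightarrow> 'a"
  assumes B: "symmetric_map B"
  shows "\<exists>P. projection P \<and> (\<forall>x. P x = x \<longrightarrow> l * (x \<bullet> x) \<le> B x \<bullet> x) \<and>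
    (\<forall>x. P x = 0 \<longrightarrow> x \<noteq> 0 \<longrightarrow> B x \<bullet> x < l * (x \<bullet> x)) \<and> bicommutes B P"
proof -
  have Bl: "bounded_linear B" and Bs: "\<And>x y. B x \<bullet> y = x \<bullet> B y" using symmetric_mapD[OF B] by auto
  interpret B: bounded_linear B by (rule Bl)
  define S where "S x = B x - l *\<^sub>R x" for x
  have Sl: "bounded_linear S" unfolding S_def
    by (intro bounded_linear_sub bounded_linear_scaleR_right Bl)
  interpret S: bounded_linear S by (rule Sl)
  have Ss: "S x \<bullet> y = x \<bullet> S y" for x y by (simp add: S_def inner_diff Bs)
  have SS: "positive_map (\<lambda>x. S (S x))"
    unfolding positive_map_def symmetric_map_def
  proof (intro conjI allI)
    show "0 \<le> S (S x) \<bullet> x" for x using Ss[of "S x" x] by simp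
  qed (simp_all add: Ss bounded_linear_compose[OF Sl Sl])
  obtain R where R: "positive_map R" "\<forall>x. R (R x) = S (S x)"
    "\<forall>T. bounded_linear T \<longrightarrow> (\<forall>x. T (S (S x)) = S (S (T x))) \<longrightarrow> (\<forall>x. T (R x) = R (T x))"
    using positive_map_sqrt[OF SS] by blast
  have Rl: "bounded_linear R" and Rs: "\<And>x y. R x \<bullet> y = x \<bullet> R y" and Rp: "\<And>x. 0 \<le> R x \<bullet> x"
    using R(1) by (auto simp: positive_map_def symmetric_map_def)
  interpret R: bounded_linear R by (rule Rl)
  have SR: "S (R x) = R (S x)" for x using R(3) Sl by simp
  let ?Z = "{x. S x = R x}"
  have Z: "subspace ?Z" "closed ?Z"
    by (auto simp: subspace_def S.zero R.zero S.add R.add S.scaleR R.scaleR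
        intro!: closed_Collect_eq linear_continuous_on Sl Rl)
  obtain P where P: "projection P" "range P = ?Z" using projection_onto_exists[OF Z] by blast
  interpret P: bounded_linear P by (rule projectionD(2)[OF P(1)])
  have PZ: "P x = x \<longleftrightarrow> S x = R x" for x
  proof
    assume "P x = x" then have "x \<in> range P" by (metis rangeI)
    then show "S x = R x" using P(2) by simp
  next
    assume "S x = R x" then obtain z where "x = P z" using P(2) by blast
    then show "P x = x" by (simp add: projectionD(4)[OF P(1)])
  qed
  have low: "l * (x \<bullet> x) \<le> B x \<bullet> x" if "P x = x" for x
    using that Rp[of x] PZ[of x] by (simp add: S_def inner_diff_left algebra_simps)
  have up: "B x \<bullet> x < l * (x \<bullet> x)" if x: "P x = 0" "x \<noteq> 0" for x
  proof -
    have "S x + R x = 0"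
    proof (rule inner_eqI)
      fix y
      have "P (S y + R y) = S y + R y" by (simp add: PZ S.add R.add SR R(2))
      then have "(S y + R y) \<bullet> x = (S y + R y) \<bullet> P x" by (metis projectionD(3)[OF P(1)])
      moreover have "(S x + R x) \<bullet> y = (S y + R y) \<bullet> x"
        using Ss[of x y] Rs[of x y] by (simp add: inner_left_distrib inner_right_distrib inner_commute)
      ultimately show "(S x + R x) \<bullet> y = 0 \<bullet> y" using x(1) by simp
    qed
    then have SR': "S x = - R x" by (simp add: eq_neg_iff_add_eq_0)
    have "R x \<bullet> x \<noteq> 0"
    proof
      assume "R x \<bullet> x = 0"
      then have "R x = 0" by (rule positive_map_eq_0[OF R(1)])
      then have "P x = x" using SR' by (simp add: PZ)
      then show False using x by simp
    qed
    then have "S x \<bullet> x < 0" using Rp[of x] SR' by simp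
    then show ?thesis by (simp add: S_def inner_diff_left)
  qed
  have comm: "T (P x) = P (T x)"
    if T: "bounded_linear T" "bounded_linear T'" "\<forall>x y. T x \<bullet> y = x \<bullet> T' y" "\<forall>x. T (B x) = B (T x)" for T T' x
  proof (rule projection_commute[OF P(1) T(1) T(3)[rule_format]])
    have inv: "P (V x) = V x" if V: "bounded_linear V" "\<And>x. V (B x) = B (V x)" and x: "P x = x" for V x
    proof -
      interpret V: bounded_linear V by (rule V)
      have VS: "V (S x) = S (V x)" for x by (simp add: S_def V.diff V.scaleR V(2))
      then have "V (R x) = R (V x)" using R(3) V(1) by simp
      then show ?thesis using VS[of x] x by (metis PZ)
    qed
    show "P (T x) = T x" if "P x = x" for x using inv[OF T(1)] T(4) that by blast
    have "T' (B x) = B (T' x)" for x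
    proof (rule inner_eqI)
      fix z show "T' (B x) \<bullet> z = B (T' x) \<bullet> z"
        using T(3,4) by (metis Bs inner_commute)
    qed
    then show "P (T' x) = T' x" if "P x = x" for x using inv[OF T(2)] that by blast
  qed
  have "bicommutes B P" unfolding bicommutes_def using comm by (intro allI impI)
  then show ?thesis using P(1) low up by blast
qed

section \<open>Ordered, orthogonal and summed projections\<close>

lemma projection_absorb_swap:
  assumes P: "projection P" and Q: "projection Q" and PQ: "\<And>x. P (Q x) = P x"
  shows "Q (P x) = P x"
  by (rule inner_eqI) (simp add: projectionD(3)[OF P] projectionD(3)[OF Q] PQ)

text \<open>By polarization. This is the uniqueness that later fixes a projection by its scalar
  measures.\<close>

lemma projection_eqI:
  assumes P: "projection P" and Q: "projection Q" and eq: "\<And>x. P x \<bullet> x = Q x \<bullet> x"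
  shows "P = Q"
proof
  fix x
  interpret P: bounded_linear P by (rule projectionD(2)[OF P])
  interpret Q: bounded_linear Q by (rule projectionD(2)[OF Q])
  show "P x = Q x"
  proof (rule inner_eqI)
    fix y
    have "P y \<bullet> x = P x \<bullet> y" "Q y \<bullet> x = Q x \<bullet> y"
      using projectionD(3)[OF P] projectionD(3)[OF Q] by (metis inner_commute)+
    then show "P x \<bullet> y = Q x \<bullet> y"
      using eq[of "x + y"] eq[of x] eq[of y]
      by (simp add: P.add Q.add inner_left_distrib inner_right_distrib)
  qed
qed

text \<open>|Q_n x - Q_m x|^2 is an increment of the bounded increasing sequence Q_n x . x, which
  therefore forces strong convergence.\<close>

lemma projection_limit:
  fixes Q :: "nat \<Rightarrow> 'a::{real_inner,complete_space} \<Rightarrow> 'a"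
  assumes Q: "\<And>n. projection (Q n)" and mono: "\<And>m n x. m \<le> n \<Longrightarrow> Q m (Q n x) = Q m x"
  shows "\<exists>P. projection P \<and> (\<forall>x. (\<lambda>n. Q n x) \<longlonglongrightarrow> P x)"
proof -
  have dist: "(norm (Q n x - Q m x))\<^sup>2 = Q n x \<bullet> x - Q m x \<bullet> x" if "m \<le> n" for m n x
  proof -
    have "Q n x \<bullet> Q m x = Q m x \<bullet> x"
      using mono[OF that] projectionD(3)[OF Q] by (metis inner_commute)
    moreover have "Q k x \<bullet> Q k x = Q k x \<bullet> x" for k
      using projectionD(3,4)[OF Q] by (metis)
    ultimately show ?thesis by (simp add: power2_norm_eq_inner inner_diff inner_commute)
  qed
  have conv: "convergent (\<lambda>n. Q n x)" for x
  proof -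
    have "incseq (\<lambda>n. Q n x \<bullet> x)"
    proof (rule incseq_SucI)
      fix n
      have "0 \<le> (norm (Q (Suc n) x - Q n x))\<^sup>2" by simp
      then show "Q n x \<bullet> x \<le> Q (Suc n) x \<bullet> x" using dist[of n "Suc n" x] by simp
    qed
    moreover have "Q n x \<bullet> x \<le> (norm x)\<^sup>2" for n
      using projectionD(5,6)[OF Q, of n x] by (simp add: power_mono)
    ultimately have "convergent (\<lambda>n. Q n x \<bullet> x)"
      by (metis convergent_def incseq_convergent)
    then have "Cauchy (\<lambda>n. Q n x \<bullet> x)" by (rule convergent_Cauchy)
    then have "Cauchy (\<lambda>n. Q n x)"
      by (rule Cauchy_dominated[where p=2 and C=1]) (auto simp: dist_norm dist)
    then show ?thesis by (rule Cauchy_convergent)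
  qed
  define P where "P x = lim (\<lambda>n. Q n x)" for x
  have P: "(\<lambda>n. Q n x) \<longlonglongrightarrow> P x" for x using conv by (simp add: P_def convergent_LIMSEQ_iff)
  have "symmetric_map P" by (rule symmetric_map_limit[OF projectionD(1)[OF Q] projectionD(6)[OF Q] P])
  moreover have "P (P x) = P x" for x
  proof -
    have QP: "Q m (P x) = Q m x" for m
    proof (rule LIMSEQ_unique)
      show "(\<lambda>n. Q m (Q n x)) \<longlonglongrightarrow> Q m (P x)"
        by (rule bounded_linear.tendsto[OF projectionD(2)[OF Q] P])
      have "eventually (\<lambda>n. Q m (Q n x) = Q m x) sequentially"
        using eventually_ge_at_top[of m] by eventually_elim (rule mono)
      then show "(\<lambda>n. Q m (Q n x)) \<longlonglongrightarrow> Q m x" by (rule tendsto_eventually)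
    qed
    then show ?thesis using P[of "P x"] P[of x] by (simp add: LIMSEQ_unique)
  qed
  ultimately have "projection P" by (auto simp: projection_def symmetric_map_def)
  with P show ?thesis by blast
qed

text \<open>Evaluated at Q x, the inequality reads |P Q x|^2 + |Q x|^2 \<le> |Q x|^2.\<close>

lemma projection_orthogonal:
  assumes P: "projection P" and Q: "projection Q" and le: "\<And>x. P x \<bullet> x + Q x \<bullet> x \<le> x \<bullet> x"
  shows "P (Q x) = 0"
proof -
  have "P (Q x) \<bullet> Q x \<le> 0" using le[of "Q x"] by (simp add: projectionD(4)[OF Q])
  then show ?thesis by (simp add: projectionD(5)[OF P])
qed

lemma projection_sums:
  fixes P :: "nat \<Rightarrow> 'a::{real_inner,complete_space} \<Rightarrow> 'a"
  assumes P: "\<And>n. projection (P n)" and orth: "\<And>m n x. m \<noteq> n \<Longrightarrow> P m (P n x) = 0"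
  shows "\<exists>Q. projection Q \<and> (\<forall>x. (\<lambda>n. P n x) sums Q x)"
proof -
  define S where "S n x = (\<Sum>k<n. P k x)" for n x
  have lin: "bounded_linear (P n)" for n by (rule projectionD(2)[OF P])
  have mult: "S m (S n x) = S m x" if "m \<le> n" for m n x
  proof -
    have "P k (S n x) = P k x" if "k < m" for k
    proof -
      have "P k (S n x) = (\<Sum>j<n. P k (P j x))"
        unfolding S_def by (rule linear_sum[OF bounded_linear.linear[OF lin]])
      also have "\<dots> = (\<Sum>j<n. if j = k then P k x else 0)"
        by (intro sum.cong refl) (auto simp: orth projectionD(4)[OF P])
      also have "\<dots> = P k x" using that \<open>m \<le> n\<close> by simp
      finally show ?thesis .
    qed
    then show ?thesis by (simp add: S_def[of m])
  qed
  have "projection (S n)" for n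
    unfolding projection_def symmetric_map_def
  proof (intro conjI allI)
    show "bounded_linear (S n)" unfolding S_def by (intro bounded_linear_sum lin)
    show "S n x \<bullet> y = x \<bullet> S n y" for x y
      by (simp add: S_def inner_sum_left inner_sum_right projectionD(3)[OF P])
  qed (rule mult[OF order_refl])
  from projection_limit[OF this mult] show ?thesis by (simp add: S_def sums_def)
qed

text \<open>Each x gives a finite Stieltjes measure. The Dynkin induction carries the existence of
  one projection representing the measures of a set for all x at once, so no operator has to be
  assembled from a family of measures. Complements and disjoint unions preserve this, since
  additivity makes the projections of disjoint sets orthogonal.\<close>

lemma spectral_resolution:
  fixes G :: "real \<Rightarrow> 'a::{real_inner,complete_space} \<Rightarrow> 'a"
  assumes G: "\<And>t. projection (G t)" and mono: "\<And>s t x. s \<le> t \<Longrightarrow> G s (G t x) = G s x"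
    and neg: "\<And>t x. t < 0 \<Longrightarrow> G t x = 0"
    and right: "\<And>t x. ((\<lambda>s. G s x) \<longlongrightarrow> G t x) (at_right t)"
    and top: "\<And>x. ((\<lambda>t. G t x) \<longlongrightarrow> x) at_top"
  shows "\<exists>E. (\<forall>\<sigma>\<in>sets borel. projection (E \<sigma>)) \<and> E {0..} = id \<and> (\<forall>t\<ge>0. E {0..t} = G t) \<and>
    (\<forall>F. range F \<subseteq> sets borel \<longrightarrow> disjoint_family F \<longrightarrow>
      (\<forall>x. (\<lambda>n::nat. E (F n) x) sums E (\<Union>n. F n) x))"
proof -
  define f where "f x t = G t x \<bullet> x" for x t
  have linG: "bounded_linear (G t)" for t by (rule projectionD(2)[OF G])
  have f_mono: "f x s \<le> f x t" if "s \<le> t" for x s t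
  proof -
    have "norm (G s x) \<le> norm (G t x)"
      using projectionD(6)[OF G, of s "G t x"] mono[OF that, of x] by simp
    then show ?thesis by (simp add: f_def projectionD(5)[OF G] power_mono)
  qed
  have f_right: "continuous (at_right t) (f x)" for x t
    unfolding continuous_within f_def by (intro tendsto_intros right)
  define \<mu> where "\<mu> x = interval_measure (f x)" for x
  have sets: "sets (\<mu> x) = sets borel" and space: "space (\<mu> x) = UNIV" for x
    by (simp_all add: \<mu>_def)
  have Ioc: "emeasure (\<mu> x) {a<..b} = ennreal (f x b - f x a)" if "a \<le> b" for x a b
    unfolding \<mu>_def by (rule emeasure_interval_measure_Ioc[OF that f_mono f_right])
  have f_neg: "f x t = 0" if "t < 0" for x t using neg[OF that] by (simp add: f_def)
  have total: "emeasure (\<mu> x) UNIV = ennreal ((norm x)\<^sup>2)" for x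
  proof (rule LIMSEQ_unique)
    \<comment> \<open>The left end stays below 0 for every n, where the distribution function
      vanishes.\<close>
    have "(\<lambda>n. emeasure (\<mu> x) {- 1 - real n<..real n}) \<longlonglongrightarrow> emeasure (\<mu> x) (\<Union>n. {- 1 - real n<..real n})"
      by (rule Lim_emeasure_incseq) (auto simp: sets incseq_def)
    moreover have "(\<Union>n. {- 1 - real n<..real n}) = UNIV"
    proof (intro set_eqI iffI UNIV_I)
      fix t :: real
      obtain n where "\<bar>t\<bar> < real n" using reals_Archimedean2 by blast
      then show "t \<in> (\<Union>n. {- 1 - real n<..real n})" by (auto intro!: exI[of _ n])
    qed
    ultimately show "(\<lambda>n. emeasure (\<mu> x) {- 1 - real n<..real n}) \<longlonglongrightarrow> emeasure (\<mu> x) UNIV" by simp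
    have "(\<lambda>n. G (real n) x) \<longlonglongrightarrow> x"
      using filterlim_compose[OF top filterlim_real_sequentially] .
    then have "(\<lambda>n. f x (real n)) \<longlonglongrightarrow> x \<bullet> x" unfolding f_def by (intro tendsto_intros)
    then show "(\<lambda>n. emeasure (\<mu> x) {- 1 - real n<..real n}) \<longlonglongrightarrow> ennreal ((norm x)\<^sup>2)"
      by (simp add: Ioc f_neg power2_norm_eq_inner tendsto_ennrealI)
  qed
  have fin: "finite_measure (\<mu> x)" for x
    by (rule finite_measureI) (simp add: space total)
  have m_total: "measure (\<mu> x) UNIV = x \<bullet> x" for x
    by (simp add: measure_def total power2_norm_eq_inner)
  define D where "D \<sigma> P \<longleftrightarrow> projection P \<and> (\<forall>x. P x \<bullet> x = measure (\<mu> x) \<sigma>)" for \<sigma> P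
  have D_orth: "P (Q x) = 0" if "D A P" "D B Q" "A \<inter> B = {}" "A \<in> sets borel" "B \<in> sets borel" for A B P Q x
  proof (rule projection_orthogonal[of P Q])
    show "projection P" "projection Q" using that by (auto simp: D_def)
    fix x
    interpret finite_measure "\<mu> x" by (rule fin)
    have "measure (\<mu> x) A + measure (\<mu> x) B = measure (\<mu> x) (A \<union> B)"
      using that by (simp add: finite_measure_Union sets)
    also have "\<dots> \<le> x \<bullet> x" using bounded_measure[of "A \<union> B"] by (simp add: space m_total)
    finally show "P x \<bullet> x + Q x \<bullet> x \<le> x \<bullet> x" using that by (simp add: D_def)
  qed
  have D_sums: "\<exists>Q. D (\<Union>i. A i) Q \<and> (\<forall>x. (\<lambda>i. P i x) sums Q x)"
    if A: "disjoint_family A" "range A \<subseteq> sets borel" "\<And>i::nat. D (A i) (P i)" for A P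
  proof -
    have "P m (P n x) = 0" if "m \<noteq> n" for m n x
      using D_orth[OF A(3) A(3), of m n] that A(1,2) by (auto simp: disjoint_family_on_def)
    then obtain Q where Q: "projection Q" "\<And>x. (\<lambda>i. P i x) sums Q x"
      using projection_sums[of P] A(3) unfolding D_def by blast
    have "Q x \<bullet> x = measure (\<mu> x) (\<Union>i. A i)" for x
    proof (rule sums_unique2)
      show "(\<lambda>i. P i x \<bullet> x) sums (Q x \<bullet> x)"
        using bounded_linear.sums[OF bounded_linear_inner_left Q(2)] .
      show "(\<lambda>i. P i x \<bullet> x) sums measure (\<mu> x) (\<Union>i. A i)"
        using finite_measure.finite_measure_UNION[OF fin _ A(1)] A(2,3) by (simp add: sets D_def)
    qed
    then show ?thesis using Q by (auto simp: D_def)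
  qed
  have ex: "\<exists>P. D \<sigma> P" if "\<sigma> \<in> sets borel" for \<sigma>
  proof -
    let ?G = "range (\<lambda>(a, b). {a<..b::real})"
    have "Int_stable ?G"
    proof (rule Int_stableI)
      fix A B assume "A \<in> ?G" "B \<in> ?G"
      then obtain a b c d where "A = {a<..b}" "B = {c<..d}" by auto
      then have "A \<inter> B = {max a c<..min b d}" by auto
      then show "A \<inter> B \<in> ?G" by (auto intro!: range_eqI[of _ _ "(max a c, min b d)"])
    qed
    moreover have "?G \<subseteq> Pow UNIV" by simp
    moreover have gen: "sigma_sets UNIV ?G = sets borel"
      by (subst borel_sigma_sets_Ioc) simp
    then have "\<sigma> \<in> sigma_sets UNIV ?G" using that by simp
    ultimately show ?thesis
    proof (induction rule: sigma_sets_induct_disjoint)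
      case (basic A)
      then obtain a b where A: "A = {a<..b}" by auto
      show ?case
      proof (cases "a \<le> b")
        case True
        have "G b (G a x) = G a x" for x
          by (rule projection_absorb_swap[OF G G mono[OF True]])
        then have "projection (\<lambda>x. G b x - G a x)"
          unfolding projection_def symmetric_map_def
          using mono[OF True] linear_diff[OF bounded_linear.linear[OF linG]]
          by (auto intro!: bounded_linear_sub linG
              simp: inner_diff projectionD(3)[OF G] projectionD(4)[OF G])
        moreover have "(G b x - G a x) \<bullet> x = measure (\<mu> x) A" for x
          using Ioc[OF True, of x] f_mono[OF True, of x]
          by (simp add: A measure_def f_def inner_diff_left)
        ultimately show ?thesis unfolding D_def by blast
      next
        case False
        then have "D A (\<lambda>_. 0)" by (simp add: A D_def projection_def symmetric_map_def)
        then show ?thesis by (rule exI[of "D A"])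
      qed
    next
      case empty
      have "D {} (\<lambda>_. 0)" by (simp add: D_def projection_def symmetric_map_def)
      then show ?case by (rule exI[of "D _"])
    next
      case (compl A)
      then obtain P where P: "D A P" by blast
      have "D (UNIV - A) (\<lambda>x. x - P x)"
        unfolding D_def
      proof (intro conjI allI)
        show "projection (\<lambda>x. x - P x)" using P by (simp add: D_def projection_complement)
        fix x
        have "measure (\<mu> x) (space (\<mu> x) - A) = measure (\<mu> x) (space (\<mu> x)) - measure (\<mu> x) A"
          using compl gen by (intro finite_measure.finite_measure_compl[OF fin]) (simp add: sets)
        then show "(x - P x) \<bullet> x = measure (\<mu> x) (UNIV - A)"
          using P by (simp add: D_def space m_total inner_diff_left)
      qed
      then show ?case by (rule exI[of "D _"])
    next
      case (union A)
      then obtain P where "\<And>i. D (A i) (P i)" by metis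
      then show ?case using D_sums[of A P] union gen by blast
    qed
  qed
  define E where "E \<sigma> = (SOME P. D \<sigma> P)" for \<sigma>
  have E: "D \<sigma> (E \<sigma>)" if "\<sigma> \<in> sets borel" for \<sigma>
    unfolding E_def using someI_ex[OF ex[OF that]] .
  have E_eqI: "E \<sigma> = P" if "\<sigma> \<in> sets borel" "D \<sigma> P" for \<sigma> P
    using E[OF that(1)] that(2) by (auto simp: D_def intro: projection_eqI)
  have null: "emeasure (\<mu> x) {..<0} = 0" for x
  proof -
    have "{..<0} = (\<Union>n. {- real (Suc n)<..- 1 / real (Suc n)})"
    proof (intro set_eqI iffI)
      fix t :: real assume t: "t \<in> {..<0}"
      obtain n where n: "1 / real (Suc n) < - t" using t nat_approx_posE[of "- t"] by auto
      obtain m where m: "- t < real m" using reals_Archimedean2 by blast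
      have "1 / real (Suc (max m n)) \<le> 1 / real (Suc n)" by (intro divide_left_mono) auto
      then have "t \<in> {- real (Suc (max m n))<..- 1 / real (Suc (max m n))}" using n m by auto
      then show "t \<in> (\<Union>n. {- real (Suc n)<..- 1 / real (Suc n)})" by blast
    next
      fix t assume "t \<in> (\<Union>n. {- real (Suc n)<..- 1 / real (Suc n)})"
      then obtain n where "t \<le> - 1 / real (Suc n)" by auto
      also have "\<dots> < 0" by simp
      finally show "t \<in> {..<0}" by simp
    qed
    moreover have "emeasure (\<mu> x) (\<Union>n. {- real (Suc n)<..- 1 / real (Suc n)}) = 0"
    proof (rule emeasure_UN_eq_0)
      fix n
      have "- real (Suc n) \<le> - 1 / real (Suc n)" by (simp add: field_simps)
      then show "emeasure (\<mu> x) {- real (Suc n)<..- 1 / real (Suc n)} = 0"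
        by (simp add: Ioc f_neg)
    qed (auto simp: sets)
    ultimately show ?thesis by simp
  qed
  \<comment> \<open>All measures are concentrated on [0, \<infinity>). This converts (-1, t] into
    [0, t] and so keeps a possible atom at 0.\<close>
  have drop: "measure (\<mu> x) (\<sigma> \<inter> {0..}) = measure (\<mu> x) \<sigma>" if "\<sigma> \<in> sets borel" for \<sigma> x
  proof -
    have "emeasure (\<mu> x) \<sigma> = emeasure (\<mu> x) (\<sigma> \<inter> {0..} \<union> \<sigma> \<inter> {..<0})"
      by (rule arg_cong[where f="emeasure (\<mu> x)"]) auto
    also have "\<dots> = emeasure (\<mu> x) (\<sigma> \<inter> {0..})"
    proof (rule emeasure_Un_null_set)
      have "{..<0} \<in> null_sets (\<mu> x)" using null by (intro null_setsI) (auto simp: sets)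
      then show "\<sigma> \<inter> {..<0} \<in> null_sets (\<mu> x)"
        by (rule null_sets_subset) (use that in \<open>auto simp: sets\<close>)
    qed (use that in \<open>auto simp: sets\<close>)
    finally show ?thesis by (simp add: measure_def)
  qed
  have "E {0..} = id"
  proof (rule E_eqI)
    show "D {0..} id"
      unfolding D_def
    proof (intro conjI allI)
      show "projection (id :: 'a \<Rightarrow> 'a)"
        by (auto simp: projection_def symmetric_map_def id_def bounded_linear_ident)
      show "id x \<bullet> x = measure (\<mu> x) {0..}" for x using drop[of UNIV x] by (simp add: m_total)
    qed
  qed simp
  moreover have "E {0..t} = G t" if "0 \<le> t" for t
  proof (rule E_eqI)
    have "{-1<..t} \<inter> {0..} = {0..t}" by auto
    then have "measure (\<mu> x) {0..t} = f x t" for x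
      using drop[of "{-1<..t}" x] Ioc[of "-1" t x] that f_mono[OF that, of x] f_mono[of "-1" t x]
      by (simp add: measure_def f_neg)
    then show "D {0..t} (G t)" by (simp add: D_def G f_def)
  qed simp
  moreover have "(\<lambda>n. E (F n) x) sums E (\<Union>n. F n) x"
    if F: "range F \<subseteq> sets borel" "disjoint_family F" for F :: "nat \<Rightarrow> real set" and x
  proof -
    have "D (F n) (E (F n))" for n using F(1) by (intro E) auto
    then obtain Q where Q: "D (\<Union>i. F i) Q" "\<And>x. (\<lambda>i. E (F i) x) sums Q x"
      using D_sums[OF F(2,1), of "\<lambda>i. E (F i)"] by blast
    moreover have "E (\<Union>i. F i) = Q" using F(1) Q(1) by (intro E_eqI) auto
    ultimately show ?thesis by simp
  qed
  moreover have "projection (E \<sigma>)" if "\<sigma> \<in> sets borel" for \<sigma> using E[OF that] by (simp add: D_def)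
  ultimately show ?thesis by blast
qed

section \<open>Scalar measures of a resolution of the identity\<close>

text \<open>The part of a spectral measure that refers to the real structure only, shared by the
  measure under construction and by an arbitrary one with \<open>has_spectral_measure\<close>.
  Complex linearity of the projections is treated separately.\<close>

locale resolution_of_identity =
  fixes E :: "real set \<Rightarrow> 'a::{real_inner,complete_space} \<Rightarrow> 'a"
  assumes E_proj: "\<sigma> \<in> sets borel_nonneg \<Longrightarrow> projection (E \<sigma>)"
    and E_space: "E {0..} = id"
    and E_sums: "range F \<subseteq> sets borel_nonneg \<Longrightarrow> disjoint_family F \<Longrightarrow>
      (\<lambda>n::nat. E (F n) x) sums E (\<Union>n. F n) x"
begin

lemma sets_borel_nonneg_iff: "\<sigma> \<in> sets borel_nonneg \<longleftrightarrow> \<sigma> \<subseteq> {0..} \<and> \<sigma> \<in> sets (borel :: real measure)"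
  by (subst sets_restrict_space_iff) auto

text \<open>Countable additivity makes the value the term of a convergent constant series.\<close>

lemma E_empty: "E {} x = 0"
proof -
  have "(\<lambda>n::nat. E ((\<lambda>_. {}) n) x) sums E (\<Union>n::nat. (\<lambda>_. {}) n) x"
    by (rule E_sums) (auto simp: disjoint_family_on_def)
  then have "summable (\<lambda>n::nat. E {} x)" by (simp add: sums_iff)
  then show ?thesis by (simp add: summable_const_iff)
qed

lemma E_Un:
  assumes "A \<in> sets borel_nonneg" "B \<in> sets borel_nonneg" "A \<inter> B = {}"
  shows "E (A \<union> B) x = E A x + E B x"
proof (rule sums_unique2)
  have "(\<lambda>n. E (binaryset A B n) x) sums E (\<Union>n. binaryset A B n) x"
  proof (rule E_sums)
    show "range (binaryset A B) \<subseteq> sets borel_nonneg" using assms by (simp add: range_binaryset_eq)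
    show "disjoint_family (binaryset A B)"
      using assms(3) by (auto simp: disjoint_family_on_def binaryset_def)
  qed
  then show "(\<lambda>n. E (binaryset A B n) x) sums E (A \<union> B) x" by (simp add: UN_binaryset_eq)
  show "(\<lambda>n. E (binaryset A B n) x) sums (E A x + E B x)"
    by (rule binaryset_sums) (rule E_empty)
qed

lemma E_Diff:
  assumes "A \<in> sets borel_nonneg" "B \<in> sets borel_nonneg" "A \<subseteq> B"
  shows "E (B - A) x = E B x - E A x"
proof -
  have "E (A \<union> (B - A)) x = E A x + E (B - A) x" using assms by (intro E_Un) auto
  moreover have "A \<union> (B - A) = B" using assms by auto
  ultimately show ?thesis by simp
qed

lemma space_in_sets: "{0..} \<in> sets borel_nonneg"
  by (simp add: sets_borel_nonneg_iff)

lemma E_compl: "A \<in> sets borel_nonneg \<Longrightarrow> E ({0..} - A) x = x - E A x"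
  using E_Diff[OF _ space_in_sets, of A x] by (simp add: sets_borel_nonneg_iff E_space)

lemma E_orth:
  assumes "A \<in> sets borel_nonneg" "B \<in> sets borel_nonneg" "A \<inter> B = {}"
  shows "E A (E B x) = 0"
proof (rule projection_orthogonal[of "E A" "E B"])
  fix x
  have "E A x \<bullet> x + E B x \<bullet> x = E (A \<union> B) x \<bullet> x" by (simp add: E_Un[OF assms] inner_left_distrib)
  also have "\<dots> = (norm (E (A \<union> B) x))\<^sup>2" using assms by (intro projectionD(5) E_proj) auto
  also have "\<dots> \<le> (norm x)\<^sup>2" using assms by (intro power_mono projectionD(6) E_proj) auto
  finally show "E A x \<bullet> x + E B x \<bullet> x \<le> x \<bullet> x" by (simp add: power2_norm_eq_inner)
qed (use assms E_proj in auto)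

lemma E_lin: "\<sigma> \<in> sets borel_nonneg \<Longrightarrow> bounded_linear (E \<sigma>)"
  by (rule projectionD(2)[OF E_proj])

lemma E_add: "\<sigma> \<in> sets borel_nonneg \<Longrightarrow> E \<sigma> (x + y) = E \<sigma> x + E \<sigma> y"
  and E_minus: "\<sigma> \<in> sets borel_nonneg \<Longrightarrow> E \<sigma> (x - y) = E \<sigma> x - E \<sigma> y"
  and E_scale: "\<sigma> \<in> sets borel_nonneg \<Longrightarrow> E \<sigma> (r *\<^sub>R x) = r *\<^sub>R E \<sigma> x"
  using bounded_linear.linear[OF E_lin, of \<sigma>]
  by (auto simp: linear_add linear_diff linear_scale)

lemma E_Int:
  assumes "A \<in> sets borel_nonneg" "B \<in> sets borel_nonneg"
  shows "E A (E B x) = E (A \<inter> B) x"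
proof -
  have AB: "A \<inter> B \<in> sets borel_nonneg" "A - B \<in> sets borel_nonneg" "B - A \<in> sets borel_nonneg"
    using assms by auto
  have "E B x = E (A \<inter> B \<union> (B - A)) x" by (rule arg_cong[where f="\<lambda>S. E S x"]) auto
  also have "\<dots> = E (A \<inter> B) x + E (B - A) x" using AB by (intro E_Un) auto
  finally have "E A (E B x) = E A (E (A \<inter> B) x) + E A (E (B - A) x)" using assms by (simp add: E_add)
  also have "E A (E (B - A) x) = 0" using assms AB by (intro E_orth) auto
  also have "E A (E (A \<inter> B) x) = E (A \<inter> B \<union> (A - B)) (E (A \<inter> B) x)"
    by (rule arg_cong[where f="\<lambda>S. E S _"]) auto
  also have "\<dots> = E (A \<inter> B) (E (A \<inter> B) x) + E (A - B) (E (A \<inter> B) x)" using AB by (intro E_Un) auto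
  also have "E (A - B) (E (A \<inter> B) x) = 0" using AB by (intro E_orth) auto
  finally show ?thesis using projectionD(4)[OF E_proj[OF AB(1)]] by simp
qed

lemma E_commute:
  "A \<in> sets borel_nonneg \<Longrightarrow> B \<in> sets borel_nonneg \<Longrightarrow> E A (E B x) = E B (E A x)"
  by (simp add: E_Int Int_commute)

lemma E_Pythagoras:
  assumes "A \<in> sets borel_nonneg" "B \<in> sets borel_nonneg"
  shows "(norm (E A x))\<^sup>2 = (norm (E (A \<inter> B) x))\<^sup>2 + (norm (E (A - B) x))\<^sup>2"
proof -
  have AB: "A \<inter> B \<in> sets borel_nonneg" "A - B \<in> sets borel_nonneg" using assms by auto
  have "E A x = E (A \<inter> B \<union> (A - B)) x" by (rule arg_cong[where f="\<lambda>S. E S x"]) auto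
  also have "\<dots> = E (A \<inter> B) x + E (A - B) x" using AB by (intro E_Un) auto
  finally have "E A x \<bullet> x = E (A \<inter> B) x \<bullet> x + E (A - B) x \<bullet> x" by (simp add: inner_left_distrib)
  then show ?thesis using projectionD(5)[OF E_proj] assms AB by simp
qed

section \<open>Scalar measures and integrals against them\<close>

definition sm :: "'a \<Rightarrow> real measure"
  where "sm f = measure_of {0..} (sets borel_nonneg) (\<lambda>\<sigma>. ennreal (E \<sigma> f \<bullet> f))"

lemma sigma_sets_borel_nonneg: "sigma_sets {0..} (sets borel_nonneg) = sets borel_nonneg"
  using sets.sigma_sets_eq[of borel_nonneg] by simp

lemma space_sm [simp]: "space (sm f) = {0..}"
  and sets_sm [simp, measurable_cong]: "sets (sm f) = sets borel_nonneg"
proof -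
  have "sets borel_nonneg \<subseteq> Pow {0..}" using sets.space_closed[of borel_nonneg] by simp
  then show "space (sm f) = {0..}" "sets (sm f) = sets borel_nonneg"
    by (simp_all add: sm_def space_measure_of sets_measure_of sigma_sets_borel_nonneg)
qed

lemma E_form_nonneg: "\<sigma> \<in> sets borel_nonneg \<Longrightarrow> 0 \<le> E \<sigma> x \<bullet> x"
  by (simp add: projectionD(5)[OF E_proj])

lemma emeasure_sm:
  assumes "\<sigma> \<in> sets borel_nonneg"
  shows "emeasure (sm f) \<sigma> = ennreal (E \<sigma> f \<bullet> f)"
proof (rule emeasure_measure_of[OF sm_def])
  show "sets borel_nonneg \<subseteq> Pow {0..}" using sets.space_closed[of borel_nonneg] by simp
  show "\<sigma> \<in> sets (sm f)" using assms by simp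
  show "positive (sets (sm f)) (\<lambda>\<sigma>. ennreal (E \<sigma> f \<bullet> f))" by (simp add: positive_def E_empty)
  show "countably_additive (sets (sm f)) (\<lambda>\<sigma>. ennreal (E \<sigma> f \<bullet> f))"
  proof (rule countably_additiveI)
    fix F :: "nat \<Rightarrow> real set"
    assume F: "range F \<subseteq> sets (sm f)" "disjoint_family F"
    then have "(\<lambda>n. E (F n) f \<bullet> f) sums (E (\<Union>n. F n) f \<bullet> f)"
      using bounded_linear.sums[OF bounded_linear_inner_left E_sums[of F f]] by simp
    moreover have "0 \<le> E (F n) f \<bullet> f" for n using F by (intro E_form_nonneg) auto
    ultimately show "(\<Sum>n. ennreal (E (F n) f \<bullet> f)) = ennreal (E (\<Union>n. F n) f \<bullet> f)"
      by (simp add: suminf_ennreal2 sums_iff)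
  qed
qed

lemma emeasure_sm_space: "emeasure (sm f) {0..} = ennreal ((norm f)\<^sup>2)"
  by (simp add: emeasure_sm space_in_sets E_space power2_norm_eq_inner)

lemma AE_sm_range:
  assumes "\<sigma> \<in> sets borel_nonneg" "E \<sigma> f = f"
  shows "AE x in sm f. x \<in> \<sigma>"
proof (rule AE_I')
  have "E ({0..} - \<sigma>) f = 0" using assms by (simp add: E_compl)
  moreover have "{0..} - \<sigma> \<in> sets borel_nonneg" using assms space_in_sets by (intro sets.Diff)
  ultimately show "{0..} - \<sigma> \<in> null_sets (sm f)"
    by (intro null_setsI) (simp_all add: emeasure_sm)
qed auto

text \<open>If T commutes with E at f, the scalar measure of T f is at most K^2 times that of f;
  integrability conditions thus pass from f to T f.\<close>

lemma nn_integral_sm_dominated: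
  assumes T: "\<And>\<sigma>. \<sigma> \<in> sets borel_nonneg \<Longrightarrow> T (E \<sigma> f) = E \<sigma> (T f)"
    and K: "\<And>x. norm (T x) \<le> K * norm x" "0 \<le> K"
    and h: "h \<in> borel_measurable borel_nonneg"
  shows "nn_integral (sm (T f)) h \<le> ennreal (K\<^sup>2) * nn_integral (sm f) h"
proof -
  have "sm (T f) \<le> scale_measure (ennreal (K\<^sup>2)) (sm f)"
  proof (subst le_measure)
    show "\<forall>A\<in>sets (sm (T f)). emeasure (sm (T f)) A \<le> emeasure (scale_measure (ennreal (K\<^sup>2)) (sm f)) A"
    proof
      fix A assume "A \<in> sets (sm (T f))"
      then have A: "A \<in> sets borel_nonneg" by simp
      have "(norm (T (E A f)))\<^sup>2 \<le> (K * norm (E A f))\<^sup>2" by (rule power_mono[OF K(1)]) simp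
      then have "E A (T f) \<bullet> T f \<le> K\<^sup>2 * (E A f \<bullet> f)"
        using projectionD(5)[OF E_proj[OF A]] T[OF A] by (simp add: power_mult_distrib)
      then show "emeasure (sm (T f)) A \<le> emeasure (scale_measure (ennreal (K\<^sup>2)) (sm f)) A"
        using A by (simp add: emeasure_sm ennreal_leI E_form_nonneg flip: ennreal_mult)
    qed
  qed simp
  then have "nn_integral (sm (T f)) h \<le> nn_integral (scale_measure (ennreal (K\<^sup>2)) (sm f)) h"
    by (intro nn_integral_mono_measure) simp_all
  also have "\<dots> = ennreal (K\<^sup>2) * nn_integral (sm f) h"
    using h by (intro nn_integral_scale_measure) simp
  finally show ?thesis .
qed

text \<open>Polarization without signed measures: an identity between bilinear forms of E is written
  as an equality of sums of two positive measures, which extends from sets to nonnegative functions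
  by monotone approximation.\<close>

lemma nn_integral_sm_balance:
  assumes eq: "\<And>\<sigma>. \<sigma> \<in> sets borel_nonneg \<Longrightarrow>
      E \<sigma> a \<bullet> a + E \<sigma> b \<bullet> b = E \<sigma> c \<bullet> c + E \<sigma> d \<bullet> d"
    and h: "h \<in> borel_measurable borel_nonneg"
  shows "nn_integral (sm a) h + nn_integral (sm b) h = nn_integral (sm c) h + nn_integral (sm d) h"
  using h
proof (induction rule: borel_measurable_induct)
  case (cong f g)
  have "nn_integral (sm z) f = nn_integral (sm z) g" for z
    by (rule nn_integral_cong) (use cong(3) in simp)
  then show ?case using cong by simp
next
  case (set A)
  then show ?case
    using eq[of A] by (simp add: emeasure_sm E_form_nonneg flip: ennreal_plus)
next
  case (mult u k)
  then have "u \<in> borel_measurable (sm z)" for z by simp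
  then show ?case using mult by (simp add: nn_integral_cmult flip: distrib_left)
next
  case (add u v)
  then have [measurable]: "u \<in> borel_measurable (sm z)" "v \<in> borel_measurable (sm z)" for z
    by simp_all
  have "nn_integral (sm a) (\<lambda>x. v x + u x) + nn_integral (sm b) (\<lambda>x. v x + u x)
      = (nn_integral (sm a) v + nn_integral (sm b) v) + (nn_integral (sm a) u + nn_integral (sm b) u)"
    by (simp add: nn_integral_add ac_simps)
  also have "\<dots> = (nn_integral (sm c) v + nn_integral (sm d) v) + (nn_integral (sm c) u + nn_integral (sm d) u)"
    using add by simp
  also have "\<dots> = nn_integral (sm c) (\<lambda>x. v x + u x) + nn_integral (sm d) (\<lambda>x. v x + u x)"
    by (simp add: nn_integral_add ac_simps)
  finally show ?case .
next
  case (seq U)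
  have *: "(\<lambda>i. nn_integral (sm z) (U i)) \<longlonglongrightarrow> nn_integral (sm z) (SUP i. U i)" for z
  proof -
    have U: "\<And>i. U i \<in> borel_measurable (sm z)" using seq.hyps(1) by simp
    have "nn_integral (sm z) (\<lambda>x. SUP i. U i x) = (SUP i. nn_integral (sm z) (U i))"
      by (rule nn_integral_monotone_convergence_SUP[OF seq.hyps(3) U])
    moreover have "(\<lambda>x. SUP i. U i x) = (SUP i. U i)" by (simp add: fun_eq_iff image_image)
    moreover have "incseq (\<lambda>i. nn_integral (sm z) (U i))"
      by (rule incseq_SucI, rule nn_integral_mono) (use seq.hyps(3) in \<open>simp add: incseq_SucD le_funD\<close>)
    ultimately show ?thesis using LIMSEQ_SUP[of "\<lambda>i. nn_integral (sm z) (U i)"] by simp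
  qed
  have "(\<lambda>i. nn_integral (sm a) (U i) + nn_integral (sm b) (U i))
      \<longlonglongrightarrow> nn_integral (sm a) (SUP i. U i) + nn_integral (sm b) (SUP i. U i)"
    by (intro tendsto_add *)
  moreover have "(\<lambda>i. nn_integral (sm a) (U i) + nn_integral (sm b) (U i))
      \<longlonglongrightarrow> nn_integral (sm c) (SUP i. U i) + nn_integral (sm d) (SUP i. U i)"
    by (subst seq.IH) (intro tendsto_add *)
  ultimately show ?case by (rule LIMSEQ_unique)
qed

text \<open>Right continuity at t: (t, \<infinity>) is the union of the tails (t + 1/(n+1),
  \<infinity>), and the projection of each of them annihilates y.\<close>

lemma E_tail_eq_0:
  assumes "0 \<le> t" and "\<And>s. t < s \<Longrightarrow> E {0..s} y = y"
  shows "E {0..t} y = y"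
proof -
  have m: "{r<..} \<in> sets borel_nonneg" if "0 \<le> r" for r :: real
    using that by (auto simp: sets_borel_nonneg_iff)
  have "{t<..} = (\<Union>n. {t + 1 / real (Suc n)<..})"
  proof (intro set_eqI iffI)
    fix x assume "x \<in> {t<..}"
    then obtain n where "1 / real (Suc n) < x - t" using nat_approx_posE[of "x - t"] by auto
    then show "x \<in> (\<Union>n. {t + 1 / real (Suc n)<..})" by (auto intro!: exI[of _ n])
  next
    fix x assume "x \<in> (\<Union>n. {t + 1 / real (Suc n)<..})"
    then obtain n where "t + 1 / real (Suc n) < x" by blast
    moreover have "0 < 1 / real (Suc n)" by simp
    ultimately have "t < x" by linarith
    then show "x \<in> {t<..}" by simp
  qed
  moreover have "emeasure (sm y) (\<Union>n. {t + 1 / real (Suc n)<..}) = 0"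
  proof (rule emeasure_UN_eq_0)
    fix n
    have s: "t < t + 1 / real (Suc n)" by simp
    have "{0..} - {0..d} = {d<..}" if "0 \<le> d" for d :: real using that by auto
    then have c: "{0..} - {0..t + 1 / real (Suc n)} = {t + 1 / real (Suc n)<..}" using assms(1) by simp
    have "E ({0..} - {0..t + 1 / real (Suc n)}) y = y - E {0..t + 1 / real (Suc n)} y"
      by (rule E_compl) (auto simp: sets_borel_nonneg_iff)
    then have "E {t + 1 / real (Suc n)<..} y = 0" using assms(2)[OF s] by (simp only: c) simp
    then show "emeasure (sm y) {t + 1 / real (Suc n)<..} = 0"
      using m[of "t + 1 / real (Suc n)"] assms(1) by (simp add: emeasure_sm)
  next
    show "range (\<lambda>n. {t + 1 / real (Suc n)<..}) \<subseteq> sets (sm y)"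
      unfolding sets_sm by (rule image_subsetI, rule m) (use assms(1) in simp)
  qed
  ultimately have "emeasure (sm y) {t<..} = 0" by simp
  then have "E {t<..} y \<bullet> y = 0"
    using m[OF assms(1)] by (simp add: emeasure_sm ennreal_eq_0_iff E_form_nonneg antisym)
  then have "E {t<..} y = 0" by (simp add: projectionD(5)[OF E_proj[OF m[OF assms(1)]]])
  moreover have "{0..} - {0..t} = {t<..}" using assms(1) by auto
  ultimately show ?thesis using E_compl[of "{0..t}" y] by (simp add: sets_borel_nonneg_iff)
qed

text \<open>Dynkin induction over all Borel sets, each cut down to [0, \<infinity>). The half-lines
  form an intersection-stable generator, and those ending below 0 contribute the empty set.\<close>

lemma commute_from_intervals:
  assumes T: "bounded_linear T" and comm: "\<And>t x. 0 \<le> t \<Longrightarrow> T (E {0..t} x) = E {0..t} (T x)"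
    and \<sigma>: "\<sigma> \<in> sets borel_nonneg"
  shows "T (E \<sigma> x) = E \<sigma> (T x)"
proof -
  interpret T: bounded_linear T by (rule T)
  let ?G = "range (\<lambda>a::real. {..a})"
  have "Int_stable ?G"
  proof (rule Int_stableI)
    fix A B assume "A \<in> ?G" "B \<in> ?G"
    then obtain a b where "A = {..a}" "B = {..b}" by auto
    then have "A \<inter> B = {..min a b}" by auto
    then show "A \<inter> B \<in> ?G" by auto
  qed
  moreover have "?G \<subseteq> Pow UNIV" by simp
  moreover have gen: "sigma_sets UNIV ?G = sets borel" by (subst borel_eq_atMost) simp
  then have "\<sigma> \<in> sigma_sets UNIV ?G" using \<sigma> by (simp add: sets_borel_nonneg_iff)
  ultimately have "\<forall>x. T (E (\<sigma> \<inter> {0..}) x) = E (\<sigma> \<inter> {0..}) (T x)"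
  proof (induction rule: sigma_sets_induct_disjoint)
    case (basic A)
    then obtain a where a: "A = {..a}" by auto
    show ?case
    proof (cases "0 \<le> a")
      case True
      then have "A \<inter> {0..} = {0..a}" using a by auto
      then show ?thesis using comm[OF True] by simp
    next
      case False
      then have "A \<inter> {0..} = {}" using a by auto
      then show ?thesis by (simp add: E_empty T.zero)
    qed
  next
    case empty
    then show ?case by (simp add: E_empty T.zero)
  next
    case (compl A)
    have "(UNIV - A) \<inter> {0..} = {0..} - A \<inter> {0..}" by auto
    moreover have "A \<inter> {0..} \<in> sets borel_nonneg" using compl gen by (simp add: sets_borel_nonneg_iff)
    ultimately show ?case using compl by (simp add: E_compl T.diff)
  next
    case (union A)
    show ?case
    proof
      fix x
      have F: "range (\<lambda>n. A n \<inter> {0..}) \<subseteq> sets borel_nonneg" "disjoint_family (\<lambda>n. A n \<inter> {0..})"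
        using union gen by (auto simp: sets_borel_nonneg_iff disjoint_family_on_def)
      have "(\<lambda>n. T (E (A n \<inter> {0..}) x)) sums T (E (\<Union>n. A n \<inter> {0..}) x)"
        by (rule T.sums[OF E_sums[OF F]])
      moreover have "(\<lambda>n. T (E (A n \<inter> {0..}) x)) sums E (\<Union>n. A n \<inter> {0..}) (T x)"
        using E_sums[OF F, of "T x"] union by simp
      ultimately have "T (E (\<Union>n. A n \<inter> {0..}) x) = E (\<Union>n. A n \<inter> {0..}) (T x)"
        by (rule sums_unique2)
      then show "T (E (\<Union> (range A) \<inter> {0..}) x) = E (\<Union> (range A) \<inter> {0..}) (T x)"
        by (simp add: Int_commute flip: Int_UN_distrib)
    qed
  qed
  moreover have "\<sigma> \<inter> {0..} = \<sigma>" using \<sigma> by (auto simp: sets_borel_nonneg_iff)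
  ultimately show ?thesis by simp
qed

end

section \<open>Complex Hilbert spaces and unbounded operators\<close>

lemma cinner_scaleC_right: "cinner (x::'h::complex_hilbert_space) (a *\<^sub>C y) = cnj a * cinner x y"
  by (subst cinner_commute, subst cinner_scaleC_left) (simp flip: cinner_commute)

lemma inner_scaleC_left: "(a *\<^sub>C (x::'h::complex_hilbert_space)) \<bullet> y = x \<bullet> (cnj a *\<^sub>C y)"
  by (simp add: inner_eq_Re_cinner cinner_scaleC_left cinner_scaleC_right)

text \<open>The complex inner product is recovered from the real one and multiplication by i, so for
  maps commuting with scalars complex identities reduce to real ones.\<close>

lemma cinner_eq_inner: "cinner (x::'h::complex_hilbert_space) y = Complex (x \<bullet> y) (x \<bullet> (\<i> *\<^sub>C y))"
  by (simp add: inner_eq_Re_cinner cinner_scaleC_right complex_eq_iff)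

lemma scaleC_scaleR_commute: "a *\<^sub>C (r *\<^sub>R (x::'h::complex_hilbert_space)) = r *\<^sub>R (a *\<^sub>C x)"
  by (simp add: scaleC_scaleC mult.commute flip: scaleC_of_real)

lemma norm_scaleC: "norm (a *\<^sub>C (x::'h::complex_hilbert_space)) = cmod a * norm x"
proof -
  have "(norm (a *\<^sub>C x))\<^sup>2 = x \<bullet> ((cnj a * a) *\<^sub>C x)"
    by (simp add: power2_norm_eq_inner inner_scaleC_left scaleC_scaleC)
  also have "cnj a * a = complex_of_real ((cmod a)\<^sup>2)" by (metis complex_norm_square mult.commute of_real_power)
  also have "x \<bullet> (complex_of_real ((cmod a)\<^sup>2) *\<^sub>C x) = (cmod a * norm x)\<^sup>2"
    by (simp only: scaleC_of_real) (simp add: power2_norm_eq_inner power_mult_distrib)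
  finally show ?thesis by (simp add: power2_eq_iff_nonneg)
qed

lemma bounded_linear_scaleC: "bounded_linear ((*\<^sub>C) a :: 'h::complex_hilbert_space \<Rightarrow> 'h)"
  by (rule bounded_linear_intro[where K="cmod a"])
     (simp_all add: scaleC_add_right scaleC_scaleR_commute norm_scaleC mult.commute)

lemma scaleC_minus: "a *\<^sub>C (x - y :: 'h::complex_hilbert_space) = a *\<^sub>C x - a *\<^sub>C y"
  using linear_diff[OF bounded_linear.linear[OF bounded_linear_scaleC]] .

lemma orthogonal_projection_iff:
  fixes P :: "'h::complex_hilbert_space \<Rightarrow> 'h"
  shows "orthogonal_projection P \<longleftrightarrow> projection P \<and> (\<forall>a x. P (a *\<^sub>C x) = a *\<^sub>C P x)"
proof -
  have "cinner (P x) y = cinner x (P y)"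
    if "\<forall>x y. P x \<bullet> y = x \<bullet> P y" "\<forall>a x. P (a *\<^sub>C x) = a *\<^sub>C P x" for x y
    using that by (simp add: cinner_eq_inner)
  moreover have "P x \<bullet> y = x \<bullet> P y" if "\<forall>x y. cinner (P x) y = cinner x (P y)" for x y
    using that by (simp add: inner_eq_Re_cinner)
  ultimately show ?thesis
    unfolding orthogonal_projection_def projection_def symmetric_map_def bounded_clinear_def
    by (auto simp: fun_eq_iff)
qed

lemma dense_inner_eqI:
  fixes h :: "'a::real_inner"
  assumes "closure D = UNIV" "\<And>f. f \<in> D \<Longrightarrow> f \<bullet> h = f \<bullet> k"
  shows "h = k"
proof -
  have "closed {f. f \<bullet> h = f \<bullet> k}" by (intro closed_Collect_eq continuous_intros)
  moreover have "D \<subseteq> {f. f \<bullet> h = f \<bullet> k}" using assms(2) by auto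
  ultimately have "closure D \<subseteq> {f. f \<bullet> h = f \<bullet> k}" by (rule closure_minimal[rotated])
  then have *: "f \<bullet> h = f \<bullet> k" for f using assms(1) by auto
  show ?thesis by (rule inner_eqI) (metis * inner_commute)
qed

section \<open>Linear and densely defined operators\<close>

locale linear_op =
  fixes A :: "'h::complex_hilbert_space operator"
  assumes linear: "linear_operator A"
begin

lemma zero: "A 0 = Some 0"
  using linear by (simp add: linear_operator_def)

lemma add: "A f = Some u \<Longrightarrow> A g = Some v \<Longrightarrow> A (f + g) = Some (u + v)"
  using linear unfolding linear_operator_def by (metis domI option.sel)

lemma scaleC: "A f = Some u \<Longrightarrow> A (a *\<^sub>C f) = Some (a *\<^sub>C u)"
  using linear unfolding linear_operator_def by (metis domI option.sel)

lemma scaleR: "A f = Some u \<Longrightarrow> A (r *\<^sub>R f) = Some (r *\<^sub>R u)"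
  using scaleC[of f u "complex_of_real r"] by (simp add: scaleC_of_real)

lemma minus: "A f = Some u \<Longrightarrow> A g = Some v \<Longrightarrow> A (f - g) = Some (u - v)"
  using add[of f u "(-1) *\<^sub>R g" "(-1) *\<^sub>R v"] scaleR[of g v "-1"] by simp

lemma graph_subspace: "subspace (Map.graph A)"
proof (rule subspaceI)
  show "0 \<in> Map.graph A" using zero by (simp add: Map.graph_def zero_prod_def)
  show "p + q \<in> Map.graph A" if "p \<in> Map.graph A" "q \<in> Map.graph A" for p q
    using that add by (cases p, cases q) (simp add: Map.graph_def)
  show "r *\<^sub>R p \<in> Map.graph A" if "p \<in> Map.graph A" for r p
    using that scaleR by (cases p) (simp add: Map.graph_def)
qed

lemma ran_subspace: "subspace (ran A)"
proof (rule subspaceI)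
  show "0 \<in> ran A" using zero by (rule ranI)
  show "u + v \<in> ran A" if "u \<in> ran A" "v \<in> ran A" for u v
  proof -
    obtain f g where "A f = Some u" "A g = Some v" using \<open>u \<in> ran A\<close> \<open>v \<in> ran A\<close> unfolding ran_def by blast
    from add[OF this] show ?thesis by (rule ranI)
  qed
  show "r *\<^sub>R u \<in> ran A" if "u \<in> ran A" for r u
  proof -
    obtain f where "A f = Some u" using \<open>u \<in> ran A\<close> unfolding ran_def by blast
    from scaleR[OF this] show ?thesis by (rule ranI)
  qed
qed

end

locale dense_op = linear_op +
  assumes dense: "densely_defined A"
begin

lemma dense_eqI: "(\<And>f u. A f = Some u \<Longrightarrow> f \<bullet> h = f \<bullet> k) \<Longrightarrow> h = k"
  using dense by (intro dense_inner_eqI[of "dom A"]) (auto simp: densely_defined_def dom_def)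

text \<open>The adjoint for the real inner product is the complex one: the real identity at the
  multiple \<open>cnj \<i> *\<^sub>C f\<close> supplies the imaginary part. Density makes h unique,
  as \<open>THE\<close> requires.\<close>

lemma op_adjoint_iff: "op_adjoint A g = Some h \<longleftrightarrow> (\<forall>f u. A f = Some u \<longrightarrow> u \<bullet> g = f \<bullet> h)"
proof -
  have c_iff: "(\<forall>f\<in>dom A. cinner (the (A f)) g = cinner f h) \<longleftrightarrow> (\<forall>f u. A f = Some u \<longrightarrow> u \<bullet> g = f \<bullet> h)" for h
  proof
    assume "\<forall>f\<in>dom A. cinner (the (A f)) g = cinner f h"
    then show "\<forall>f u. A f = Some u \<longrightarrow> u \<bullet> g = f \<bullet> h" by (force simp: inner_eq_Re_cinner)
  next
    assume *: "\<forall>f u. A f = Some u \<longrightarrow> u \<bullet> g = f \<bullet> h"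
    show "\<forall>f\<in>dom A. cinner (the (A f)) g = cinner f h"
    proof
      fix f assume "f \<in> dom A"
      then obtain u where u: "A f = Some u" by blast
      have "(cnj \<i> *\<^sub>C u) \<bullet> g = (cnj \<i> *\<^sub>C f) \<bullet> h" using * scaleC[OF u] by blast
      then show "cinner (the (A f)) g = cinner f h"
        using * u by (simp add: cinner_eq_inner inner_scaleC_left)
    qed
  qed
  have uniq: "h = k" if "\<forall>f u. A f = Some u \<longrightarrow> u \<bullet> g = f \<bullet> h" "\<forall>f u. A f = Some u \<longrightarrow> u \<bullet> g = f \<bullet> k" for h k
    by (rule dense_eqI) (use that in metis)
  show ?thesis
  proof
    assume "op_adjoint A g = Some h"
    then have ex: "\<exists>h. \<forall>f\<in>dom A. cinner (the (A f)) g = cinner f h"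
      and h: "h = (THE h. \<forall>f\<in>dom A. cinner (the (A f)) g = cinner f h)"
      by (auto simp: op_adjoint_def split: if_splits)
    have "\<exists>!h. \<forall>f\<in>dom A. cinner (the (A f)) g = cinner f h"
      using ex uniq unfolding c_iff by metis
    then show "\<forall>f u. A f = Some u \<longrightarrow> u \<bullet> g = f \<bullet> h"
      unfolding c_iff[symmetric] h by (rule theI')
  next
    assume *: "\<forall>f u. A f = Some u \<longrightarrow> u \<bullet> g = f \<bullet> h"
    then have "(THE h. \<forall>f\<in>dom A. cinner (the (A f)) g = cinner f h) = h"
      unfolding c_iff using uniq by (intro the_equality) blast+
    moreover have "\<exists>h. \<forall>f\<in>dom A. cinner (the (A f)) g = cinner f h" unfolding c_iff using * by blast
    ultimately show "op_adjoint A g = Some h" by (simp add: op_adjoint_def)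
  qed
qed

lemma op_adjoint_D: "op_adjoint A g = Some h \<Longrightarrow> A f = Some u \<Longrightarrow> u \<bullet> g = f \<bullet> h"
  by (simp add: op_adjoint_iff)

lemma op_adjoint_I: "(\<And>f u. A f = Some u \<Longrightarrow> u \<bullet> g = f \<bullet> h) \<Longrightarrow> op_adjoint A g = Some h"
  by (simp add: op_adjoint_iff)

end

section \<open>Positive selfadjoint operators\<close>

locale positive_selfadjoint =
  fixes M :: "'h::complex_hilbert_space operator"
  assumes sa: "selfadjoint M" and pos: "positive_operator M"

sublocale positive_selfadjoint \<subseteq> dense_op M
  using sa by unfold_locales (auto simp: selfadjoint_def)

context positive_selfadjoint
begin

text \<open>The inclusion of the adjoint in M turns a weak identity into membership in D(M) together
  with the value there.\<close>

lemma M_maximal: "(\<And>f u. M f = Some u \<Longrightarrow> u \<bullet> g = f \<bullet> h) \<Longrightarrow> M g = Some h"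
  using op_adjoint_I[of g h] sa by (simp add: selfadjoint_def)

lemma M_sym: "M f = Some u \<Longrightarrow> M g = Some v \<Longrightarrow> u \<bullet> g = f \<bullet> v"
  using op_adjoint_D[of g v f u] sa by (simp add: selfadjoint_def)

lemma M_cinner:
  assumes "M f = Some u"
  shows "cinner u f = complex_of_real (u \<bullet> f)" "0 \<le> u \<bullet> f"
proof -
  have "cinner (the (M f)) f \<in> \<real>\<^sub>\<ge>\<^sub>0"
    using pos assms unfolding positive_operator_def by blast
  then have "Im (cinner u f) = 0" "0 \<le> Re (cinner u f)"
    using assms by (auto simp: complex_nonneg_Reals_iff)
  then show "cinner u f = complex_of_real (u \<bullet> f)" "0 \<le> u \<bullet> f"
    by (simp_all add: inner_eq_Re_cinner complex_eq_iff)
qed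

lemma M_closed:
  assumes "f \<longlonglongrightarrow> g" "u \<longlonglongrightarrow> v" "\<And>n. M (f n) = Some (u n)"
  shows "M g = Some v"
proof (rule M_maximal)
  fix k w assume w: "M k = Some w"
  have "(\<lambda>n. w \<bullet> f n) \<longlonglongrightarrow> w \<bullet> g" by (intro tendsto_intros assms)
  moreover have "(\<lambda>n. w \<bullet> f n) \<longlonglongrightarrow> k \<bullet> v"
    using tendsto_inner[OF tendsto_const[of k] assms(2)] M_sym[OF w assms(3)] by simp
  ultimately show "w \<bullet> g = k \<bullet> v" by (rule LIMSEQ_unique)
qed

lemma adjoint_intertwines:
  assumes adj: "\<And>x y. T x \<bullet> y = x \<bullet> T' y" and T: "\<And>f u. M f = Some u \<Longrightarrow> M (T f) = Some (T u)"
    and u: "M f = Some u"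
  shows "M (T' f) = Some (T' u)"
proof (rule M_maximal)
  fix g v assume g: "M g = Some v"
  show "v \<bullet> T' f = g \<bullet> T' u"
    using M_sym[OF T[OF g] u] by (simp add: adj)
qed

end

section \<open>Commutation with the spectral measure\<close>

lemma bounded_linear_nonneg_bound:
  assumes "bounded_linear T"
  shows "\<exists>K\<ge>0. \<forall>x. norm (T x) \<le> K * norm x"
  using bounded_linear.nonneg_bounded[OF assms] by (metis mult.commute)

text \<open>M P is everywhere defined, symmetric and positive with form bounded by t, so
  \<open>norm_le_of_form_le\<close> bounds it without a closed graph argument. Symmetry comes from
  the reduction of M by P, which keeps the values of M P in the range of P.\<close>

lemma (in positive_selfadjoint) norm_le_of_reduced_form:
  assumes P: "projection P" and t: "0 \<le> t"
    and low: "\<And>x. P x = x \<Longrightarrow> \<exists>v. M x = Some v \<and> v \<bullet> x \<le> t * (x \<bullet> x)"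
    and red: "\<And>x v. M x = Some v \<Longrightarrow> M (P x) = Some (P v)"
    and f: "P f = f" and u: "M f = Some u"
  shows "norm u \<le> t * norm f"
proof -
  define N where "N x = the (M (P x))" for x
  have PP: "P (P x) = P x" for x by (rule projectionD(4)[OF P])
  have lin: "linear P" using projectionD(2)[OF P] bounded_linear.linear by blast
  have N: "M (P x) = Some (N x) \<and> P (N x) = N x \<and> N x \<bullet> P x \<le> t * (P x \<bullet> P x)" for x
    using low[OF PP[of x]] red[of "P x"] by (auto simp: N_def PP)
  have NP: "N x \<bullet> y = N x \<bullet> P y" for x y by (metis N projectionD(3)[OF P])
  have "linear N"
  proof (rule linearI)
    show "N (x + y) = N x + N y" for x y
      using add[of "P x" "N x" "P y" "N y"] N[of x] N[of y] N[of "x + y"] by (simp add: linear_add[OF lin])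
    show "N (r *\<^sub>R x) = r *\<^sub>R N x" for r x
      using scaleR[of "P x" "N x" r] N[of x] N[of "r *\<^sub>R x"] by (simp add: linear_scale[OF lin])
  qed
  then have "norm (N f) \<le> t * norm f"
  proof (rule norm_le_of_form_le)
    show "N x \<bullet> y = x \<bullet> N y" for x y
      using M_sym[of "P x" "N x" "P y" "N y"] N[of x] N[of y] NP[of x y] NP[of y x]
      by (simp add: inner_commute)
    show "0 \<le> N x \<bullet> x" for x using M_cinner(2)[of "P x" "N x"] N[of x] NP[of x x] by simp
    fix x
    have "P x \<bullet> P x \<le> x \<bullet> x"
      using projectionD(6)[OF P, of x] by (simp add: norm_le)
    then have "t * (P x \<bullet> P x) \<le> t * (x \<bullet> x)" using t by (rule mult_left_mono)
    then show "N x \<bullet> x \<le> t * (x \<bullet> x)" using N[of x] NP[of x x] by linarith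
  qed (rule t)
  then show ?thesis using f u by (simp add: N_def)
qed

locale spectral_operator = positive_selfadjoint M for M :: "'h::complex_hilbert_space operator" +
  fixes E
  assumes hsm: "has_spectral_measure M E"

sublocale spectral_operator \<subseteq> resolution_of_identity E
proof
  have *: "spectral_measure E" using hsm by (simp add: has_spectral_measure_def)
  show "projection (E \<sigma>)" if "\<sigma> \<in> sets borel_nonneg" for \<sigma>
    using * that by (simp add: spectral_measure_def orthogonal_projection_iff)
  show "E {0..} = id" using * by (simp add: spectral_measure_def)
  show "(\<lambda>n::nat. E (F n) x) sums E (\<Union>n. F n) x"
    if "range F \<subseteq> sets borel_nonneg" "disjoint_family F" for F x
    using * that by (simp add: spectral_measure_def)
qed

context resolution_of_identity
begin

lemma interval_in_sets: "{0..t} \<in> sets borel_nonneg" for t :: real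
  by (simp add: sets_borel_nonneg_iff)

lemma ident_measurable [measurable]: "(\<lambda>x. x) \<in> borel_measurable borel_nonneg"
  by (rule measurable_restrict_space1) simp

lemma nn_integral_sm_const: "(\<integral>\<^sup>+x. ennreal c \<partial>sm f) = ennreal c * ennreal ((norm f)\<^sup>2)"
  by (simp add: emeasure_sm_space)

end

context spectral_operator
begin

lemma scalar_measure_eq: "scalar_measure E f = sm f"
  by (simp add: scalar_measure_def sm_def inner_eq_Re_cinner)

lemma dom_iff: "f \<in> dom M \<longleftrightarrow> (\<integral>\<^sup>+x. ennreal (x\<^sup>2) \<partial>sm f) < \<infinity>"
  using hsm unfolding has_spectral_measure_def scalar_measure_eq by blast

lemma form_eq:
  assumes "M f = Some u"
  shows "(\<integral>\<^sup>+x. ennreal x \<partial>sm f) = ennreal (u \<bullet> f)"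
proof -
  have d: "f \<in> dom M" using assms by blast
  then have "cinner (the (M f)) f = complex_of_real (\<integral>x. x \<partial>sm f)"
    using hsm unfolding has_spectral_measure_def scalar_measure_eq by blast
  then have 1: "u \<bullet> f = (\<integral>x. x \<partial>sm f)" using assms by (simp add: inner_eq_Re_cinner)
  have m: "(\<lambda>x. x) \<in> borel_measurable (sm f)" by simp
  have nn: "AE x in sm f. 0 \<le> x" by (rule AE_I2) simp
  \<comment> \<open>The Bochner integral of a nonintegrable function is 0 by convention, so its
    value is informative only once integrability is known; x \<le> 1 + x^2 derives that from the
    domain condition.\<close>
  have "(\<integral>\<^sup>+x. ennreal x \<partial>sm f) \<le> (\<integral>\<^sup>+x. (ennreal 1 + ennreal (x\<^sup>2)) \<partial>sm f)"
  proof (rule nn_integral_mono)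
    fix x :: real
    have "0 \<le> (x - 1)\<^sup>2 + x\<^sup>2" by simp
    then have "x \<le> 1 + x\<^sup>2" by (simp add: power2_eq_square algebra_simps)
    then show "ennreal x \<le> ennreal 1 + ennreal (x\<^sup>2)"
      using ennreal_leI[of x "1 + x\<^sup>2"] ennreal_plus[of 1 "x\<^sup>2"] by simp
  qed
  also have "\<dots> = (\<integral>\<^sup>+x. ennreal 1 \<partial>sm f) + (\<integral>\<^sup>+x. ennreal (x\<^sup>2) \<partial>sm f)"
    using m by (intro nn_integral_add) (auto intro!: measurable_compose[OF m])
  also have "\<dots> < \<infinity>" using d dom_iff by (simp add: emeasure_sm_space)
  finally have "integrable (sm f) (\<lambda>x. x)" by (intro integrableI_nonneg m nn)
  then show ?thesis unfolding 1 by (rule nn_integral_eq_integral[OF _ nn])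
qed

lemma E_scaleC: "\<sigma> \<in> sets borel_nonneg \<Longrightarrow> E \<sigma> (a *\<^sub>C x) = a *\<^sub>C E \<sigma> x"
  using hsm by (simp add: has_spectral_measure_def spectral_measure_def orthogonal_projection_iff)

text \<open>Domination of scalar measures puts T f into D(M). The value w there is compared with T u
  weakly, against g in D(M): commutation equates the set functions E(\<sigma>) f . T' g and
  E(\<sigma>) T f . g, and polarizing the form of M turns this into u . T' g = w . g.\<close>

lemma commute_imp_intertwines:
  assumes T: "bounded_linear T" and comm: "\<And>\<sigma> x. \<sigma> \<in> sets borel_nonneg \<Longrightarrow> T (E \<sigma> x) = E \<sigma> (T x)"
    and u: "M f = Some u"
  shows "M (T f) = Some (T u)"
proof -
  obtain T' where T': "bounded_linear T'" and adj: "\<And>x y. T x \<bullet> y = x \<bullet> T' y"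
    using adjoint_map_exists[OF T] by blast
  have comm': "T' (E \<sigma> x) = E \<sigma> (T' x)" if \<sigma>: "\<sigma> \<in> sets borel_nonneg" for \<sigma> x
  proof (rule inner_eqI)
    fix z
    have "z \<bullet> T' (E \<sigma> x) = E \<sigma> (T z) \<bullet> x" by (simp add: projectionD(3)[OF E_proj[OF \<sigma>]] flip: adj)
    also have "\<dots> = z \<bullet> E \<sigma> (T' x)"
      using projectionD(3)[OF E_proj[OF \<sigma>], of z "T' x"] by (simp add: adj flip: comm[OF \<sigma>])
    finally show "T' (E \<sigma> x) \<bullet> z = E \<sigma> (T' x) \<bullet> z" by (simp add: inner_commute)
  qed
  have dom: "V g \<in> dom M"
    if V: "bounded_linear V" "\<And>\<sigma> x. \<sigma> \<in> sets borel_nonneg \<Longrightarrow> V (E \<sigma> x) = E \<sigma> (V x)" and g: "g \<in> dom M" for V g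
  proof -
    obtain K where K: "0 \<le> K" "\<forall>x. norm (V x) \<le> K * norm x"
      using bounded_linear_nonneg_bound[OF V(1)] by blast
    have "nn_integral (sm (V g)) (\<lambda>x. ennreal (x\<^sup>2)) \<le> ennreal (K\<^sup>2) * nn_integral (sm g) (\<lambda>x. ennreal (x\<^sup>2))"
      using K V(2) by (intro nn_integral_sm_dominated) (auto intro!: measurable_compose[OF ident_measurable])
    also have "\<dots> < \<infinity>" using g dom_iff by (simp add: ennreal_mult_less_top)
    finally show ?thesis using dom_iff by simp
  qed
  have "f \<in> dom M" using u by blast
  then obtain w where w: "M (T f) = Some w" using dom[OF T comm] by blast
  have "w = T u"
  proof (rule dense_eqI)
    fix g v assume g: "M g = Some v"
    then have "g \<in> dom M" by blast
    then obtain v' where v': "M (T' g) = Some v'" using dom[OF T' comm'] by blast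
    let ?q = "\<lambda>a. \<integral>\<^sup>+x. ennreal x \<partial>sm a"
    \<comment> \<open>The identity M f . T' g = M (T f) . g, polarized and rearranged so that no
      subtraction occurs in \<open>ennreal\<close>.\<close>
    have "?q (f + T' g) + ?q (T f - g) = ?q (f - T' g) + ?q (T f + g)"
    proof (rule nn_integral_sm_balance)
      fix \<sigma> assume \<sigma>: "\<sigma> \<in> sets borel_nonneg"
      have s: "E \<sigma> a \<bullet> b = E \<sigma> b \<bullet> a" for a b
        using projectionD(3)[OF E_proj[OF \<sigma>], of a b] by (simp add: inner_commute)
      have e: "E \<sigma> f \<bullet> T' g = E \<sigma> (T f) \<bullet> g" by (simp add: comm[OF \<sigma>] flip: adj)
      show "E \<sigma> (f + T' g) \<bullet> (f + T' g) + E \<sigma> (T f - g) \<bullet> (T f - g)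
          = E \<sigma> (f - T' g) \<bullet> (f - T' g) + E \<sigma> (T f + g) \<bullet> (T f + g)"
        using e s[of f "T' g"] s[of "T f" g]
        by (simp add: E_add[OF \<sigma>] E_minus[OF \<sigma>] inner_left_distrib inner_right_distrib inner_diff)
    qed (auto intro!: measurable_compose[OF ident_measurable])
    moreover have "?q (f + T' g) = ennreal ((u + v') \<bullet> (f + T' g))" "0 \<le> (u + v') \<bullet> (f + T' g)"
      using form_eq M_cinner(2) add[OF u v'] by blast+
    moreover have "?q (f - T' g) = ennreal ((u - v') \<bullet> (f - T' g))" "0 \<le> (u - v') \<bullet> (f - T' g)"
      using form_eq M_cinner(2) minus[OF u v'] by blast+
    moreover have "?q (T f + g) = ennreal ((w + v) \<bullet> (T f + g))" "0 \<le> (w + v) \<bullet> (T f + g)"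
      using form_eq M_cinner(2) add[OF w g] by blast+
    moreover have "?q (T f - g) = ennreal ((w - v) \<bullet> (T f - g))" "0 \<le> (w - v) \<bullet> (T f - g)"
      using form_eq M_cinner(2) minus[OF w g] by blast+
    ultimately have eq: "(u + v') \<bullet> (f + T' g) + (w - v) \<bullet> (T f - g)
        = (u - v') \<bullet> (f - T' g) + (w + v) \<bullet> (T f + g)"
      by (simp flip: ennreal_plus)
    have "v' \<bullet> f = u \<bullet> T' g" using M_sym[OF v' u] by (simp add: inner_commute)
    moreover have "v \<bullet> T f = w \<bullet> g" using M_sym[OF g w] by (simp add: inner_commute)
    ultimately have "u \<bullet> T' g = w \<bullet> g"
      using eq by (simp add: inner_left_distrib inner_right_distrib inner_diff)
    then show "g \<bullet> w = g \<bullet> T u" by (simp add: inner_commute flip: adj)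
  qed
  with w show ?thesis by simp
qed

lemma E_intertwines:
  assumes "\<sigma> \<in> sets borel_nonneg" "M f = Some u"
  shows "M (E \<sigma> f) = Some (E \<sigma> u)"
  by (rule commute_imp_intertwines[OF E_lin[OF assms(1)] _ assms(2)]) (rule E_commute[OF assms(1)])

lemma E_interval_in_dom:
  assumes t: "0 \<le> t" and f: "E {0..t} f = f"
  obtains u where "M f = Some u" "E {0..t} u = u" "u \<bullet> f \<le> t * (f \<bullet> f)"
proof -
  have AE: "AE x in sm f. x \<in> {0..t}" by (rule AE_sm_range[OF interval_in_sets f])
  have "(\<integral>\<^sup>+x. ennreal (x\<^sup>2) \<partial>sm f) \<le> (\<integral>\<^sup>+x. ennreal (t\<^sup>2) \<partial>sm f)"
    by (rule nn_integral_mono_AE) (use AE in eventually_elim, auto intro!: ennreal_leI power_mono)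
  also have "\<dots> < \<infinity>" unfolding nn_integral_sm_const by (simp add: ennreal_mult_less_top)
  finally obtain u where u: "M f = Some u" using dom_iff by blast
  have "ennreal (u \<bullet> f) \<le> (\<integral>\<^sup>+x. ennreal t \<partial>sm f)"
    unfolding form_eq[OF u, symmetric]
    by (rule nn_integral_mono_AE) (use AE in eventually_elim, auto intro!: ennreal_leI)
  also have "\<dots> = ennreal (t * (f \<bullet> f))"
    unfolding nn_integral_sm_const using t by (simp add: power2_norm_eq_inner flip: ennreal_mult)
  finally have le: "u \<bullet> f \<le> t * (f \<bullet> f)" using t by (simp add: ennreal_le_iff)
  have "M f = Some (E {0..t} u)" using E_intertwines[OF interval_in_sets u, of t] f by simp
  then have "E {0..t} u = u" using u by simp
  with u le show ?thesis using that by blast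
qed

lemma form_ge_above:
  assumes t: "0 \<le> t" and f: "E {0..t} f = 0" and u: "M f = Some u"
  shows "t * (f \<bullet> f) \<le> u \<bullet> f"
proof -
  have "E ({0..} - {0..t}) f = f" using f by (simp add: E_compl interval_in_sets)
  then have AE: "AE x in sm f. x \<in> {0..} - {0..t}"
    using interval_in_sets space_in_sets by (intro AE_sm_range sets.Diff)
  have "ennreal (t * (f \<bullet> f)) = (\<integral>\<^sup>+x. ennreal t \<partial>sm f)"
    unfolding nn_integral_sm_const using t by (simp add: power2_norm_eq_inner flip: ennreal_mult)
  also have "\<dots> \<le> ennreal (u \<bullet> f)"
    unfolding form_eq[OF u, symmetric]
    by (rule nn_integral_mono_AE) (use AE in eventually_elim, auto intro!: ennreal_leI)
  finally show ?thesis using M_cinner(2)[OF u] by (simp add: ennreal_le_iff)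
qed

lemma norm_le_on_interval:
  assumes t: "0 \<le> t" and f: "E {0..t} f = f" and u: "M f = Some u"
  shows "norm u \<le> t * norm f"
proof (rule norm_le_of_reduced_form[OF E_proj[OF interval_in_sets] t _ E_intertwines[OF interval_in_sets] f u])
  show "\<exists>v. M x = Some v \<and> v \<bullet> x \<le> t * (x \<bullet> x)" if "E {0..t} x = x" for x
    by (rule E_interval_in_dom[OF t that]) blast
qed

text \<open>If \<open>T\<close> intertwines \<open>M\<close> with itself, then \<open>K = E (s, \<infinity>) T E [0, t]\<close> satisfies \<open>M K = K M E [0, t]\<close>,
  where \<open>M \<ge> s\<close> on the range of \<open>K\<close> and \<open>\<parallel>M E [0, t]\<parallel> \<le> t\<close>. Hence \<open>s \<parallel>K\<parallel> \<le> t \<parallel>K\<parallel>\<close>, so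
  \<open>K = 0\<close> as soon as \<open>t < s\<close>.\<close>

lemma intertwines_imp_no_transition:
  assumes T: "bounded_linear T" and TM: "\<And>f u. M f = Some u \<Longrightarrow> M (T f) = Some (T u)"
    and t: "0 \<le> t" "t < s"
  shows "E {0..s} (T (E {0..t} x)) = T (E {0..t} x)"
proof -
  let ?P = "E {0..t}" and ?Q = "\<lambda>x. x - E {0..s} x"
  have s: "0 < s" using t by simp
  have P: "projection ?P" and Q: "projection ?Q"
    by (auto intro: E_proj interval_in_sets projection_complement)
  define K where "K x = ?Q (T (?P x))" for x
  have K: "bounded_linear K"
    unfolding K_def
    using bounded_linear_compose[OF projectionD(2)[OF Q] bounded_linear_compose[OF T projectionD(2)[OF P]]] .
  have le: "norm (K x) \<le> (onorm K * t / s) * norm x" for x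
  proof -
    obtain u where u: "M (?P x) = Some u" "?P u = u"
      using E_interval_in_dom[OF t(1) projectionD(4)[OF P, of x]] by blast
    have Tu: "M (T (?P x)) = Some (T u)" by (rule TM[OF u(1)])
    have MK: "M (K x) = Some (K u)"
      using minus[OF Tu E_intertwines[OF interval_in_sets Tu, of s]] by (simp add: K_def u(2))
    have "s * (K x \<bullet> K x) \<le> K u \<bullet> K x"
    proof (rule form_ge_above[OF _ _ MK])
      show "E {0..s} (K x) = 0"
        using projectionD(4)[OF E_proj[OF interval_in_sets]] by (simp add: K_def E_minus interval_in_sets)
    qed (use s in simp)
    also have "\<dots> \<le> norm (K u) * norm (K x)" by (rule norm_cauchy_schwarz)
    finally have "norm (K x) * (s * norm (K x)) \<le> norm (K x) * norm (K u)"
      by (simp add: power2_eq_square ac_simps flip: power2_norm_eq_inner)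
    then have "s * norm (K x) \<le> norm (K u)" by (cases "norm (K x) = 0") (auto simp: mult_le_cancel_left)
    also have "\<dots> \<le> onorm K * norm u" by (rule onorm[OF K])
    also have "\<dots> \<le> onorm K * (t * norm x)"
    proof (rule mult_left_mono[OF _ onorm_pos_le[OF K]])
      have "norm u \<le> t * norm (?P x)" by (rule norm_le_on_interval[OF t(1) projectionD(4)[OF P] u(1)])
      also have "\<dots> \<le> t * norm x" by (rule mult_left_mono[OF projectionD(6)[OF P] t(1)])
      finally show "norm u \<le> t * norm x" .
    qed
    finally show ?thesis using s by (simp add: field_simps)
  qed
  have "onorm K \<le> onorm K * t / s" by (rule onorm_bound[OF _ le]) (use t s onorm_pos_le[OF K] in simp)
  then have "onorm K * s \<le> onorm K * t" using s by (simp add: field_simps)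
  then have "onorm K \<le> 0" using t(2) by (metis mult_le_cancel_left not_le)
  then have "onorm K = 0" using onorm_pos_le[OF K] by simp
  then have "K x = 0" using onorm_eq_0[OF K] by simp
  then show ?thesis by (simp add: K_def)
qed

text \<open>By \<open>intertwines_imp_no_transition\<close>, T maps the range of E [0, t] into that
  of E [0, s] for all s > t, hence by right continuity into itself. The adjoint of T intertwines M
  with itself too, so E [0, t] reduces T.\<close>

lemma intertwines_imp_commute:
  assumes T: "bounded_linear T" and TM: "\<And>f u. M f = Some u \<Longrightarrow> M (T f) = Some (T u)"
    and \<sigma>: "\<sigma> \<in> sets borel_nonneg"
  shows "T (E \<sigma> x) = E \<sigma> (T x)"
proof (rule commute_from_intervals[OF T _ \<sigma>])
  fix t :: real and x assume t: "0 \<le> t"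
  obtain T' where T': "bounded_linear T'" and adj: "\<And>x y. T x \<bullet> y = x \<bullet> T' y"
    using adjoint_map_exists[OF T] by blast
  have T'M: "M (T' f) = Some (T' u)" if "M f = Some u" for f u
    by (rule adjoint_intertwines[OF adj TM that])
  have stay: "E {0..t} (V y) = V y"
    if V: "bounded_linear V" "\<And>f u. M f = Some u \<Longrightarrow> M (V f) = Some (V u)" and y: "E {0..t} y = y" for V y
    using intertwines_imp_no_transition[OF V t, of _ y] y by (intro E_tail_eq_0[OF t]) metis
  show "T (E {0..t} x) = E {0..t} (T x)"
    by (rule projection_commute[OF E_proj[OF interval_in_sets] T adj stay[OF T TM] stay[OF T' T'M]])
qed

end

section \<open>The spectral theorem for positive selfadjoint operators\<close>

text \<open>A relation with bounded inverse carries Cauchy sequences from the second coordinate back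
  to the first, so closedness passes to the range. Stated for relations, it serves the resolvent,
  extensions by closure and isometric images alike.\<close>

lemma closed_subspace_snd_image:
  fixes \<Gamma> :: "('a::{real_normed_vector,complete_space} \<times> 'b::real_normed_vector) set"
  assumes \<Gamma>: "subspace \<Gamma>" "closed \<Gamma>" and le: "\<And>x y. (x, y) \<in> \<Gamma> \<Longrightarrow> norm x \<le> K * norm y"
  shows "subspace (snd ` \<Gamma>)" "closed (snd ` \<Gamma>)"
proof -
  show "subspace (snd ` \<Gamma>)" by (rule linear_subspace_image[OF _ \<Gamma>(1)]) (simp add: linear_snd)
  show "closed (snd ` \<Gamma>)"
    unfolding closed_sequential_limits
  proof (intro allI impI, elim conjE)
    fix y l assume y: "\<forall>n. y n \<in> snd ` \<Gamma>" and l: "y \<longlonglongrightarrow> l"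
    then have "\<forall>n. \<exists>x. (x, y n) \<in> \<Gamma>" by force
    then obtain x where x: "\<And>n. (x n, y n) \<in> \<Gamma>" by metis
    have "norm (x m - x n) \<le> \<bar>K\<bar> * norm (y m - y n)" for m n
    proof -
      have "(x m, y m) - (x n, y n) \<in> \<Gamma>" by (rule subspace_diff[OF \<Gamma>(1) x x])
      then have "norm (x m - x n) \<le> K * norm (y m - y n)" by (intro le) simp
      also have "\<dots> \<le> \<bar>K\<bar> * norm (y m - y n)" by (rule mult_right_mono) auto
      finally show ?thesis .
    qed
    then have "Cauchy x"
      by (intro Cauchy_dominated[OF LIMSEQ_imp_Cauchy[OF l], where p=1 and C="\<bar>K\<bar>"]) (auto simp: dist_norm)
    then obtain p where "x \<longlonglongrightarrow> p" using Cauchy_convergent convergent_def by blast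
    then have "(\<lambda>n. (x n, y n)) \<longlonglongrightarrow> (p, l)" using l by (rule tendsto_Pair)
    then have "(p, l) \<in> \<Gamma>" by (rule closed_sequentially[OF \<Gamma>(2) x])
    then show "l \<in> snd ` \<Gamma>" by force
  qed
qed

lemma norm_sum_orthogonal:
  fixes v :: "'i \<Rightarrow> 'a::real_inner"
  assumes "finite A" "\<And>i j. i \<noteq> j \<Longrightarrow> v i \<bullet> v j = 0"
  shows "(norm (sum v A))\<^sup>2 = (\<Sum>i\<in>A. (norm (v i))\<^sup>2)"
  using assms(1)
proof (induction rule: finite_induct)
  case (insert x F)
  have "v x \<bullet> sum v F = 0"
    unfolding inner_sum_right by (rule sum.neutral) (use insert(2) assms(2) in metis)
  then show ?case
    using insert by (simp add: power2_norm_eq_inner inner_left_distrib inner_right_distrib inner_commute)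
qed simp

lemma orthogonal_summable:
  fixes v :: "nat \<Rightarrow> 'a::{real_inner,complete_space}"
  assumes orth: "\<And>i j. i \<noteq> j \<Longrightarrow> v i \<bullet> v j = 0" and sm: "summable (\<lambda>k. (norm (v k))\<^sup>2)"
  shows "summable v"
proof -
  have "Cauchy (\<lambda>n. \<Sum>k<n. (norm (v k))\<^sup>2)"
    using sm by (simp add: summable_iff_convergent convergent_Cauchy)
  then have "Cauchy (\<lambda>n. \<Sum>k<n. v k)"
  proof (rule Cauchy_dominated[where p=2 and C=1])
    fix m n :: nat assume "n \<le> m"
    then have "(\<Sum>k<m. v k) - (\<Sum>k<n. v k) = (\<Sum>k=n..<m. v k)"
      "(\<Sum>k<m. (norm (v k))\<^sup>2) - (\<Sum>k<n. (norm (v k))\<^sup>2) = (\<Sum>k=n..<m. (norm (v k))\<^sup>2)"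
      by (simp_all add: sum_diff_nat_ivl flip: atLeast0LessThan)
    then show "dist (\<Sum>k<m. v k) (\<Sum>k<n. v k) ^ 2
        \<le> 1 * dist (\<Sum>k<m. (norm (v k))\<^sup>2) (\<Sum>k<n. (norm (v k))\<^sup>2)"
      using norm_sum_orthogonal[of "{n..<m}" v, OF _ orth] by (simp add: dist_norm)
  qed simp_all
  then show ?thesis
    using Cauchy_convergent summable_iff_convergent by blast
qed

section \<open>The resolvent at -1 and single spectral projections\<close>

context positive_selfadjoint
begin

text \<open>Positivity gives |f| \<le> |(1 + M) f|, hence a closed range. A vector h orthogonal to
  the range satisfies M h = -h by maximality, and positivity leaves only h = 0; the same argument
  makes solutions unique.\<close>

lemma resolvent_exists:
  "\<exists>B. bounded_linear B \<and> (\<forall>g. M (B g) = Some (g - B g)) \<and> (\<forall>f u. M f = Some u \<longrightarrow> B (f + u) = f)"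
proof -
  let ?\<Gamma> = "{(f, g). M f = Some (g - f)}"
  have le: "norm f \<le> 1 * norm g" if "(f, g) \<in> ?\<Gamma>" for f g
  proof -
    have "0 \<le> (g - f) \<bullet> f" using that M_cinner(2) by auto
    then have "norm f * norm f \<le> g \<bullet> f"
      by (simp add: inner_diff_left power2_norm_eq_inner flip: power2_eq_square)
    also have "\<dots> \<le> norm g * norm f" by (rule norm_cauchy_schwarz)
    finally show ?thesis by (cases "norm f = 0") (auto simp: mult_le_cancel_right)
  qed
  have sub: "subspace ?\<Gamma>"
  proof (rule subspaceI)
    show "0 \<in> ?\<Gamma>" using zero by (simp add: zero_prod_def)
    show "p + q \<in> ?\<Gamma>" if "p \<in> ?\<Gamma>" "q \<in> ?\<Gamma>" for p q
    proof -
      have "M (fst p + fst q) = Some ((snd p - fst p) + (snd q - fst q))"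
        using that by (intro add) auto
      then show ?thesis by (simp add: case_prod_beta algebra_simps)
    qed
    show "r *\<^sub>R p \<in> ?\<Gamma>" if "p \<in> ?\<Gamma>" for r p
    proof -
      have "M (r *\<^sub>R fst p) = Some (r *\<^sub>R (snd p - fst p))" using that by (intro scaleR) auto
      then show ?thesis by (simp add: case_prod_beta algebra_simps)
    qed
  qed
  have cl: "closed ?\<Gamma>"
    unfolding closed_sequential_limits
  proof (intro allI impI, elim conjE)
    fix p l assume p: "\<forall>n. p n \<in> ?\<Gamma>" and l: "p \<longlonglongrightarrow> l"
    have "M (fst l) = Some (snd l - fst l)"
    proof (rule M_closed)
      show "(\<lambda>n. fst (p n)) \<longlonglongrightarrow> fst l" by (intro tendsto_intros l)
      show "(\<lambda>n. snd (p n) - fst (p n)) \<longlonglongrightarrow> snd l - fst l" by (intro tendsto_intros l)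
      show "M (fst (p n)) = Some (snd (p n) - fst (p n))" for n using p by (auto simp: case_prod_beta)
    qed
    then show "l \<in> ?\<Gamma>" by (simp add: case_prod_beta)
  qed
  note range = closed_subspace_snd_image[OF sub cl le]
  have surj: "\<exists>f. M f = Some (g - f)" for g
  proof -
    obtain p where p: "p \<in> snd ` ?\<Gamma>" "\<And>s. s \<in> snd ` ?\<Gamma> \<Longrightarrow> (g - p) \<bullet> s = 0"
      by (rule orthogonal_decomposition[OF range, of g]) blast+
    have "M (g - p) = Some (- (g - p))"
    proof (rule M_maximal)
      fix f u assume "M f = Some u"
      then have "f + u \<in> snd ` ?\<Gamma>" by (intro image_eqI[of _ _ "(f, f + u)"]) auto
      then have "(g - p) \<bullet> (f + u) = 0" by (rule p(2))
      then show "u \<bullet> (g - p) = f \<bullet> - (g - p)"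
        by (simp add: inner_right_distrib inner_diff_left inner_diff_right inner_commute)
    qed
    then have "0 \<le> - (g - p) \<bullet> (g - p)" by (rule M_cinner(2))
    then have "g - p = 0" by (metis inner_minus_left inner_ge_zero inner_eq_zero_iff neg_0_le_iff_le antisym)
    then show ?thesis using p(1) by auto
  qed
  then obtain B where B: "\<And>g. M (B g) = Some (g - B g)" by metis
  have uniq: "B g = f" if "M f = Some (g - f)" for f g
  proof -
    have "M (B g - f) = Some (- (B g - f))" using minus[OF B that, of g] by simp
    then have "0 \<le> - (B g - f) \<bullet> (B g - f)" by (rule M_cinner(2))
    then have "B g - f = 0" by (metis inner_minus_left inner_ge_zero inner_eq_zero_iff neg_0_le_iff_le antisym)
    then show ?thesis by simp
  qed
  have "bounded_linear B"
  proof (rule bounded_linear_intro[where K=1])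
    show "B (x + y) = B x + B y" for x y by (rule uniq) (use add[OF B[of x] B[of y]] in \<open>simp add: algebra_simps\<close>)
    show "B (r *\<^sub>R x) = r *\<^sub>R B x" for r x by (rule uniq) (use scaleR[OF B[of x], of r] in \<open>simp add: algebra_simps\<close>)
    show "norm (B x) \<le> norm x * 1" for x using le[of "B x" x] B by simp
  qed
  moreover have "B (f + u) = f" if "M f = Some u" for f u by (rule uniq) (use that in simp)
  ultimately show ?thesis using B by blast
qed

text \<open>The bounded inverse of 1 + M.\<close>

definition B where "B = (SOME B. bounded_linear B \<and> (\<forall>g. M (B g) = Some (g - B g)) \<and> (\<forall>f u. M f = Some u \<longrightarrow> B (f + u) = f))"

lemma B_lin: "bounded_linear B" and M_B: "M (B g) = Some (g - B g)"
  and B_M: "M f = Some u \<Longrightarrow> B (f + u) = f"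
  using someI_ex[OF resolvent_exists] unfolding B_def[symmetric] by blast+

lemma B_positive: "positive_map B"
  unfolding positive_map_def symmetric_map_def
proof (intro conjI allI)
  show "B g \<bullet> h = g \<bullet> B h" for g h
    using M_sym[OF M_B M_B, of g h] by (simp add: inner_diff)
  show "0 \<le> B g \<bullet> g" for g
  proof -
    have "0 \<le> (g - B g) \<bullet> B g" by (rule M_cinner(2)[OF M_B])
    then have "B g \<bullet> B g \<le> g \<bullet> B g" by (simp add: inner_diff_left)
    then have "0 \<le> g \<bullet> B g" by (rule order_trans[OF inner_ge_zero])
    then show ?thesis by (simp add: inner_commute)
  qed
qed (rule B_lin)

lemma B_sym: "B x \<bullet> y = x \<bullet> B y"
  using B_positive by (simp add: positive_map_def symmetric_map_def)

lemma B_zero: "B 0 = 0"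
  using linear_0[OF bounded_linear.linear[OF B_lin]] .

lemma B_inj: "B g = 0 \<Longrightarrow> g = 0"
  using M_B[of g] zero by simp

lemma B_commute:
  assumes "linear T" "\<And>f u. M f = Some u \<Longrightarrow> M (T f) = Some (T u)"
  shows "T (B g) = B (T g)"
  using B_M[OF assms(2)[OF M_B[of g]]] by (simp add: linear_diff[OF assms(1)])

text \<open>Together with \<open>B_commute\<close>, this makes commuting with B equivalent to
  intertwining M with itself; facts about projections obtained from the bounded B are carried over
  to M this way.\<close>

lemma intertwines_of_B_commute:
  assumes T: "linear T" and TB: "\<And>g. T (B g) = B (T g)" and u: "M f = Some u"
  shows "M (T f) = Some (T u)"
proof -
  have "B (T f + T u) = T f" using TB[of "f + u"] B_M[OF u] by (simp add: linear_add[OF T])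
  then show ?thesis using M_B[of "T f + T u"] by simp
qed

text \<open>Large values of B are small values of M, with l = 1 / (1 + t) matching t. For f = B g
  one has M f . f = f . g - f . f. With R the square root of B, f . g = |R g|^2 and f . f = B (R g)
  . R g, so the form estimates for B at R g are those for M at f.\<close>

lemma spectral_projection_at:
  assumes t: "0 \<le> t"
  shows "\<exists>P. projection P \<and> (\<forall>x. P x = x \<longrightarrow> (\<exists>u. M x = Some u \<and> u \<bullet> x \<le> t * (x \<bullet> x))) \<and>
    (\<forall>x u. M x = Some u \<longrightarrow> P x = 0 \<longrightarrow> x \<noteq> 0 \<longrightarrow> t * (x \<bullet> x) < u \<bullet> x) \<and> bicommutes B P"
proof -
  define l where "l = 1 / (1 + t)"
  have l: "0 < l" "l * (1 + t) = 1" using t by (auto simp: l_def)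
  have Bs: "symmetric_map B" using B_positive by (simp add: positive_map_def)
  obtain P where P: "projection P" "\<forall>x. P x = x \<longrightarrow> l * (x \<bullet> x) \<le> B x \<bullet> x"
    "\<forall>x. P x = 0 \<longrightarrow> x \<noteq> 0 \<longrightarrow> B x \<bullet> x < l * (x \<bullet> x)"
    "bicommutes B P"
    using spectral_projection[OF Bs, of l] by blast
  obtain R where R: "positive_map R" "\<forall>x. R (R x) = B x"
    "\<forall>T. bounded_linear T \<longrightarrow> (\<forall>x. T (B x) = B (T x)) \<longrightarrow> (\<forall>x. T (R x) = R (T x))"
    using positive_map_sqrt[OF B_positive] by blast
  have Rl: "bounded_linear R" and Rs: "\<And>x y. R x \<bullet> y = x \<bullet> R y"
    using R(1) by (auto simp: positive_map_def symmetric_map_def)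
  have BR: "B (R x) = R (B x)" for x using R(3) B_lin by simp
  have RP: "R (P x) = P (R x)" for x using P(4) Rl Rs BR unfolding bicommutes_def by metis
  have BP: "B (P x) = P (B x)" for x using P(4) B_lin B_sym unfolding bicommutes_def by metis
  have BRR: "B (R g) \<bullet> R g = B g \<bullet> B g" for g
    by (metis BR R(2) Rs)
  have RR: "R g \<bullet> R g = B g \<bullet> g" for g by (metis R(2) Rs)
  have Plin: "linear P" using projectionD(2)[OF P(1)] bounded_linear.linear by blast
  \<comment> \<open>On the range of P the map B is bounded below by l, so its image there is closed;
    a vector of the range orthogonal to this image has vanishing B-form and is 0. Hence the range of
    P lies in D(M).\<close>
  have in_range: "\<exists>g. B g = f \<and> P g = g" if f: "P f = f" for f
  proof -
    let ?\<Gamma> = "{p. P (fst p) = fst p \<and> B (fst p) = snd p}"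
    have cont: "continuous_on UNIV B" "continuous_on UNIV P"
      using linear_continuous_on[OF B_lin] linear_continuous_on[OF projectionD(2)[OF P(1)]] by auto
    have Blin: "linear B" using B_lin bounded_linear.linear by blast
    have sub: "subspace ?\<Gamma>"
      unfolding subspace_def
      by (auto simp: linear_0[OF Plin] linear_0[OF Blin] linear_add[OF Plin] linear_add[OF Blin]
          linear_scale[OF Plin] linear_scale[OF Blin])
    have cl: "closed ?\<Gamma>"
      by (intro closed_Collect_conj closed_Collect_eq continuous_intros
          continuous_on_compose2[OF cont(1)] continuous_on_compose2[OF cont(2)]) auto
    have le: "norm x \<le> (1 + t) * norm y" if "(x, y) \<in> ?\<Gamma>" for x y
    proof -
      have "l * (norm x * norm x) \<le> y \<bullet> x"
        using P(2) that by (auto simp: power2_norm_eq_inner simp flip: power2_eq_square)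
      also have "\<dots> \<le> norm y * norm x" by (rule norm_cauchy_schwarz)
      finally have "l * norm x \<le> norm y"
        by (cases "norm x = 0") (auto simp: mult_le_cancel_right simp flip: mult.assoc)
      then have "(1 + t) * (l * norm x) \<le> (1 + t) * norm y" using t by (intro mult_left_mono) auto
      then show ?thesis using l(2) by (simp add: mult.commute flip: mult.assoc)
    qed
    obtain p where p: "p \<in> snd ` ?\<Gamma>" "\<And>s. s \<in> snd ` ?\<Gamma> \<Longrightarrow> (f - p) \<bullet> s = 0"
      by (rule orthogonal_decomposition[OF closed_subspace_snd_image[OF sub cl le], of f]) blast+
    obtain g where g: "P g = g" "B g = p" using p(1) by auto
    have Pfp: "P (f - p) = f - p" using f g BP[of g] by (simp add: linear_diff[OF Plin])
    then have "B (f - p) \<in> snd ` ?\<Gamma>" by (intro image_eqI[of _ _ "(f - p, B (f - p))"]) auto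
    then have "(f - p) \<bullet> B (f - p) = 0" by (rule p(2))
    then have "B (f - p) \<bullet> (f - p) = 0" by (simp only: inner_commute)
    then have "l * ((f - p) \<bullet> (f - p)) \<le> 0" using P(2) Pfp by metis
    then have "f = p" using l(1) inner_ge_zero[of "f - p"] by (simp add: mult_le_0_iff)
    then show ?thesis using g by blast
  qed
  have low: "\<exists>u. M f = Some u \<and> u \<bullet> f \<le> t * (f \<bullet> f)" if f: "P f = f" for f
  proof -
    obtain g where g: "B g = f" "P g = g" using in_range[OF f] by blast
    have "l * (R g \<bullet> R g) \<le> B (R g) \<bullet> R g" using P(2) RP[of g] g(2) by simp
    then have "l * (f \<bullet> g) \<le> f \<bullet> f" by (simp add: BRR RR g(1))
    then have "(1 + t) * (l * (f \<bullet> g)) \<le> (1 + t) * (f \<bullet> f)" using t by (intro mult_left_mono) auto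
    then have "f \<bullet> g \<le> (1 + t) * (f \<bullet> f)" using l(2) by (simp add: mult.commute flip: mult.assoc)
    then have "(g - f) \<bullet> f \<le> t * (f \<bullet> f)" by (simp add: inner_diff_left inner_commute algebra_simps)
    then show ?thesis using M_B[of g] g(1) by auto
  qed
  have high: "t * (f \<bullet> f) < u \<bullet> f" if u: "M f = Some u" and f: "P f = 0" "f \<noteq> 0" for f u
  proof -
    define g where "g = f + u"
    have g: "B g = f" using B_M[OF u] by (simp add: g_def)
    have "B (P g) = 0" using BP g f by simp
    then have "P g = 0" by (rule B_inj)
    then have "P (R g) = 0" using RP[of g] linear_0[OF bounded_linear.linear[OF Rl]] by simp
    moreover have "R g \<noteq> 0" using R(2) g f(2) linear_0[OF bounded_linear.linear[OF Rl]] by metis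
    ultimately have "B (R g) \<bullet> R g < l * (R g \<bullet> R g)" using P(3) by blast
    then have "f \<bullet> f < l * (f \<bullet> g)" by (simp add: BRR RR g)
    then have "(1 + t) * (f \<bullet> f) < (1 + t) * (l * (f \<bullet> g))" using t by (intro mult_strict_left_mono) auto
    then have "(1 + t) * (f \<bullet> f) < f \<bullet> g" using l(2) by (simp add: mult.commute flip: mult.assoc)
    then show ?thesis by (simp add: g_def inner_right_distrib inner_commute algebra_simps)
  qed
  show ?thesis using P(1,4) low high by blast
qed

end

section \<open>The spectral family of a positive selfadjoint operator\<close>

context positive_selfadjoint
begin

definition is_spectral_projection :: "real \<Rightarrow> ('h \<Rightarrow> 'h) \<Rightarrow> bool"
  where "is_spectral_projection t P \<longleftrightarrow> projection P \<and>
    (\<forall>x. P x = x \<longrightarrow> (\<exists>u. M x = Some u \<and> u \<bullet> x \<le> t * (x \<bullet> x))) \<and>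
    (\<forall>x u. M x = Some u \<longrightarrow> P x = 0 \<longrightarrow> x \<noteq> 0 \<longrightarrow> t * (x \<bullet> x) < u \<bullet> x) \<and> bicommutes B P"

text \<open>The value 0 below 0 extends the family to the whole real line, as the Stieltjes measures
  need, while keeping their mass on [0, \<infinity>).\<close>

definition G :: "real \<Rightarrow> 'h \<Rightarrow> 'h"
  where "G t = (if t < 0 then (\<lambda>_. 0) else (SOME P. is_spectral_projection t P))"

lemma is_spectral_projection_G: "0 \<le> t \<Longrightarrow> is_spectral_projection t (G t)"
  using someI_ex[OF spectral_projection_at[of t, folded is_spectral_projection_def]] by (simp add: G_def)

lemma G_neg: "t < 0 \<Longrightarrow> G t x = 0"
  by (simp add: G_def)

lemma G_proj: "projection (G t)"
proof (cases "0 \<le> t")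
  case True
  then show ?thesis using is_spectral_projection_G[OF True] by (simp add: is_spectral_projection_def)
next
  case False
  then show ?thesis by (simp add: G_def projection_def symmetric_map_def)
qed

lemma G_low: "0 \<le> t \<Longrightarrow> G t x = x \<Longrightarrow> \<exists>u. M x = Some u \<and> u \<bullet> x \<le> t * (x \<bullet> x)"
  using is_spectral_projection_G[of t] unfolding is_spectral_projection_def by blast

lemma G_high: "0 \<le> t \<Longrightarrow> M x = Some u \<Longrightarrow> G t x = 0 \<Longrightarrow> x \<noteq> 0 \<Longrightarrow> t * (x \<bullet> x) < u \<bullet> x"
  using is_spectral_projection_G[of t] unfolding is_spectral_projection_def by blast

lemma G_lin: "bounded_linear (G t)"
  by (rule projectionD(2)[OF G_proj])

lemma G_diff: "G t (x - y) = G t x - G t y"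
  by (rule linear_diff[OF bounded_linear.linear[OF G_lin]])

lemma G_idem: "G t (G t x) = G t x"
  by (rule projectionD(4)[OF G_proj])

lemma G_bicommutes:
  assumes T: "bounded_linear T" "bounded_linear T'" "\<And>x y. T x \<bullet> y = x \<bullet> T' y" "\<And>x. T (B x) = B (T x)"
  shows "T (G t x) = G t (T x)"
proof (cases "0 \<le> t")
  case True
  then have "bicommutes B (G t)" using is_spectral_projection_G[OF True] by (simp add: is_spectral_projection_def)
  then show ?thesis using T unfolding bicommutes_def by metis
next
  case False
  then show ?thesis using linear_0[OF bounded_linear.linear[OF T(1)]] by (simp add: G_neg)
qed

lemma G_B: "B (G t x) = G t (B x)"
  by (rule G_bicommutes[OF B_lin B_lin B_sym refl])

lemma G_commute: "G s (G t x) = G t (G s x)"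
  by (rule G_bicommutes[OF G_lin G_lin projectionD(3)[OF G_proj]]) (simp add: G_B)

lemma G_scaleC: "a *\<^sub>C G t x = G t (a *\<^sub>C x)"
proof (rule G_bicommutes[OF bounded_linear_scaleC bounded_linear_scaleC inner_scaleC_left])
  show "a *\<^sub>C B x = B (a *\<^sub>C x)" for x
    by (rule B_commute[OF bounded_linear.linear[OF bounded_linear_scaleC] scaleC])
qed

text \<open>The form of M at y is at most s |y|^2 for all s > t, but strictly above t |y|^2 if y is
  not 0; an s between t and the quotient of the form by |y|^2 gives the contradiction.\<close>

lemma G_between_eq_0:
  assumes st: "0 \<le> t" and y: "\<And>s. t < s \<Longrightarrow> G s y = y" and 0: "G t y = 0"
  shows "y = 0"
proof (rule ccontr)
  assume ne: "y \<noteq> 0"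
  obtain u where u: "M y = Some u" using G_low[of "t + 1" y] y[of "t + 1"] st by auto
  have less: "t * (y \<bullet> y) < u \<bullet> y" by (rule G_high[OF st u 0 ne])
  have pos: "0 < y \<bullet> y" using ne by simp
  have "t < u \<bullet> y / (y \<bullet> y)" using less pos by (simp add: field_simps)
  then obtain s where s: "t < s" "s < u \<bullet> y / (y \<bullet> y)" using dense_order_class.dense by blast
  then have "u \<bullet> y \<le> s * (y \<bullet> y)" using G_low[of s y] y[OF s(1)] st u by auto
  then show False using s(2) pos by (simp add: field_simps)
qed

text \<open>The part y of G s x killed by G t has M-form at most s |y|^2 and, unless y = 0, above t
  |y|^2.\<close>

lemma G_mono:
  assumes "s \<le> t"
  shows "G s (G t x) = G s x"
proof (cases "0 \<le> s")
  case True
  define y where "y = G s x - G t (G s x)"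
  have Gs: "G s y = y" unfolding y_def by (simp add: G_diff G_idem G_commute[of s t])
  have Gt: "G t y = 0" unfolding y_def by (simp add: G_diff G_idem)
  have "y = 0"
  proof (rule ccontr)
    assume ne: "y \<noteq> 0"
    obtain u where u: "M y = Some u" "u \<bullet> y \<le> s * (y \<bullet> y)" using G_low[OF True Gs] by blast
    have "t * (y \<bullet> y) < u \<bullet> y" using True assms by (intro G_high[OF _ u(1) Gt ne]) simp
    moreover have "s * (y \<bullet> y) \<le> t * (y \<bullet> y)" using assms by (intro mult_right_mono) auto
    ultimately show False using u(2) by linarith
  qed
  then show ?thesis by (simp add: y_def G_commute[of s t])
next
  case False
  then show ?thesis by (simp add: G_neg)
qed

lemma G_mono': "s \<le> t \<Longrightarrow> G t (G s x) = G s x"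
  using G_mono[of s t x] by (simp add: G_commute[of t s])

text \<open>The limit z of G (t + 1/(n+1)) x is fixed by every G s with s > t, so its component
  outside the range of G t vanishes by \<open>G_between_eq_0\<close>. Monotonicity passes from the
  sequence to the one-sided limit.\<close>

lemma G_right: "((\<lambda>s. G s x) \<longlongrightarrow> G t x) (at_right t)"
proof (cases "0 \<le> t")
  case False
  then have "eventually (\<lambda>s. s \<in> {t<..<0}) (at_right t)" by (intro eventually_at_right_real) simp
  then have "eventually (\<lambda>s. G s x = G t x) (at_right t)"
    by eventually_elim (use False in \<open>simp add: G_neg\<close>)
  then show ?thesis by (rule tendsto_eventually)
next
  case True
  define r where "r n = t + 1 / real (Suc n)" for n
  have r: "t < r n" "m \<le> n \<Longrightarrow> r n \<le> r m" for m n by (auto simp: r_def field_simps)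
  \<comment> \<open>\<open>projection_limit\<close> concerns increasing families, hence the
    complements.\<close>
  have lim: "\<exists>P. projection P \<and> (\<forall>x. (\<lambda>n. x - G (r n) x) \<longlonglongrightarrow> P x)"
  proof (rule projection_limit)
    show "projection (\<lambda>x. x - G (r n) x)" for n by (rule projection_complement[OF G_proj])
    show "x - G (r n) x - G (r m) (x - G (r n) x) = x - G (r m) x" if "m \<le> n" for m n x
      using G_mono'[OF r(2)[OF that]] by (simp add: G_diff)
  qed
  then obtain P where P: "\<And>x. (\<lambda>n. x - G (r n) x) \<longlonglongrightarrow> P x" by blast
  define z where "z = x - P x"
  have z: "(\<lambda>n. G (r n) x) \<longlonglongrightarrow> z"
    using tendsto_diff[OF tendsto_const[of x] P[of x]] by (simp add: z_def)
  have fixed: "G s z = z" if "t < s" for s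
  proof (rule LIMSEQ_unique)
    show "(\<lambda>n. G s (G (r n) x)) \<longlonglongrightarrow> G s z" by (rule bounded_linear.tendsto[OF G_lin z])
    obtain N where N: "1 / real (Suc N) < s - t" using nat_approx_posE[of "s - t"] \<open>t < s\<close> by auto
    have "eventually (\<lambda>n. G s (G (r n) x) = G (r n) x) sequentially"
      using eventually_ge_at_top[of N]
    proof eventually_elim
      case (elim n)
      then have "r n \<le> s" using r(2)[OF elim] N by (simp add: r_def)
      then show ?case by (rule G_mono')
    qed
    then have "(\<lambda>n. G s (G (r n) x) - G (r n) x) \<longlonglongrightarrow> 0"
      by (intro tendsto_eventually) (auto elim: eventually_mono)
    from tendsto_add[OF this z] show "(\<lambda>n. G s (G (r n) x)) \<longlonglongrightarrow> z" by simp
  qed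
  have "z - G t z = 0"
  proof (rule G_between_eq_0[OF True])
    show "G s (z - G t z) = z - G t z" if "t < s" for s
      using fixed[OF that] G_mono'[of t s z] that by (simp add: G_diff)
  qed (simp add: G_diff G_idem)
  moreover have "G t z = G t x"
  proof (rule LIMSEQ_unique)
    show "(\<lambda>n. G t (G (r n) x)) \<longlonglongrightarrow> G t z" by (rule bounded_linear.tendsto[OF G_lin z])
    show "(\<lambda>n. G t (G (r n) x)) \<longlonglongrightarrow> G t x" using G_mono[OF less_imp_le[OF r(1)]] by simp
  qed
  ultimately have zx: "z = G t x" by simp
  show ?thesis
  proof (rule tendstoI)
    fix e :: real assume "0 < e"
    then obtain n where n: "dist (G (r n) x) z < e"
      using metric_LIMSEQ_D[OF z, of e] by blast
    have "eventually (\<lambda>s. s \<in> {t<..<r n}) (at_right t)" by (rule eventually_at_right_real[OF r(1)])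
    then show "eventually (\<lambda>s. dist (G s x) (G t x) < e) (at_right t)"
    proof eventually_elim
      case (elim s)
      have "G s x - G t x = G s (G (r n) x - G t x)"
        using elim G_mono[of s "r n" x] G_mono'[of t s x] by (simp add: G_diff)
      then have "norm (G s x - G t x) \<le> norm (G (r n) x - G t x)"
        by (metis projectionD(6)[OF G_proj])
      then show ?case using n zx by (simp add: dist_norm)
    qed
  qed
qed

lemma G_top: "((\<lambda>t. G t x) \<longlongrightarrow> x) at_top"
proof -
  have "\<exists>P. projection P \<and> (\<forall>x. (\<lambda>n. G (real n) x) \<longlonglongrightarrow> P x)"
    by (rule projection_limit[OF G_proj G_mono]) simp
  then obtain P where P: "\<And>x. (\<lambda>n. G (real n) x) \<longlonglongrightarrow> P x" by blast
  define y where "y = x - P x"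
  have 0: "G (real n) y = 0" for n
  proof -
    have "G (real n) (P x) = G (real n) x"
    proof (rule LIMSEQ_unique)
      show "(\<lambda>m. G (real n) (G (real m) x)) \<longlonglongrightarrow> G (real n) (P x)"
        by (rule bounded_linear.tendsto[OF G_lin P])
      have "eventually (\<lambda>m. G (real n) (G (real m) x) = G (real n) x) sequentially"
        using eventually_ge_at_top[of n] by eventually_elim (simp add: G_mono)
      then show "(\<lambda>m. G (real n) (G (real m) x)) \<longlonglongrightarrow> G (real n) x" by (rule tendsto_eventually)
    qed
    then show ?thesis by (simp add: y_def G_diff)
  qed
  \<comment> \<open>The vector y need not lie in D(M), but B y does, and every G n annihilates it as
    well; if it were not 0, its M-form would exceed n |B y|^2 for all n.\<close>
  have "B y = 0"
  proof (rule ccontr)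
    assume ne: "B y \<noteq> 0"
    then have pos: "0 < B y \<bullet> B y" by simp
    obtain n where n: "(y - B y) \<bullet> B y / (B y \<bullet> B y) < real n" using reals_Archimedean2 by blast
    have "G (real n) (B y) = 0" using G_B[of "real n" y] by (simp add: 0 B_zero)
    then have "real n * (B y \<bullet> B y) < (y - B y) \<bullet> B y" by (intro G_high[OF _ M_B _ ne]) auto
    then show False using n pos by (simp add: field_simps)
  qed
  then have "y = 0" by (rule B_inj)
  then have lim: "(\<lambda>n. G (real n) x) \<longlonglongrightarrow> x" using P[of x] by (simp add: y_def)
  show ?thesis
  proof (rule tendstoI)
    fix e :: real assume "0 < e"
    then obtain n where n: "dist (G (real n) x) x < e" using metric_LIMSEQ_D[OF lim, of e] by blast
    show "eventually (\<lambda>t. dist (G t x) x < e) at_top"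
      using eventually_ge_at_top[of "real n"]
    proof eventually_elim
      case (elim t)
      have "x - G t x = (x - G (real n) x) - G t (x - G (real n) x)"
        using G_mono'[OF elim] by (simp add: G_diff)
      then have "norm (x - G t x) \<le> norm (x - G (real n) x)"
        using projectionD(6)[OF projection_complement[OF G_proj]] by metis
      then show ?case using n by (simp add: dist_norm norm_minus_commute)
    qed
  qed
qed

lemma spectral_measure_exists:
  "\<exists>E. resolution_of_identity E \<and> (\<forall>t\<ge>0. E {0..t} = G t)"
proof -
  obtain E where E: "\<forall>\<sigma>\<in>sets borel. projection (E \<sigma>)" "E {0..} = id" "\<forall>t\<ge>0. E {0..t} = G t"
    "\<forall>F. range F \<subseteq> sets borel \<longrightarrow> disjoint_family F \<longrightarrow>
      (\<forall>x. (\<lambda>n::nat. E (F n) x) sums E (\<Union>n. F n) x)"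
    using spectral_resolution[of G, OF G_proj G_mono G_neg G_right G_top] by blast
  have b: "sets borel_nonneg \<subseteq> sets (borel :: real measure)"
    by (auto simp: sets_restrict_space)
  have "resolution_of_identity E"
  proof
    show "projection (E \<sigma>)" if "\<sigma> \<in> sets borel_nonneg" for \<sigma> using E(1) b that by blast
    show "(\<lambda>n. E (F n) x) sums E (\<Union>n. F n) x"
      if "range F \<subseteq> sets borel_nonneg" "disjoint_family F" for F :: "nat \<Rightarrow> real set" and x
      using E(4) subset_trans[OF that(1) b] that(2) by blast
  qed (rule E(2))
  with E(3) show ?thesis by blast
qed

end

section \<open>The constructed measure represents M\<close>

locale spectral_construction = positive_selfadjoint M + resolution_of_identity E
  for M :: "'h::complex_hilbert_space operator" and E :: "real set \<Rightarrow> 'h \<Rightarrow> 'h" +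
  assumes E_interval: "0 \<le> t \<Longrightarrow> E {0..t} = G t"
begin

lemma E_intertwines:
  assumes \<sigma>: "\<sigma> \<in> sets borel_nonneg" and u: "M f = Some u"
  shows "M (E \<sigma> f) = Some (E \<sigma> u)"
proof (rule intertwines_of_B_commute[OF bounded_linear.linear[OF E_lin[OF \<sigma>]] _ u])
  show "E \<sigma> (B g) = B (E \<sigma> g)" for g
    by (rule commute_from_intervals[OF B_lin _ \<sigma>, symmetric]) (simp add: E_interval G_B)
qed

lemma E_scaleC: "\<sigma> \<in> sets borel_nonneg \<Longrightarrow> E \<sigma> (a *\<^sub>C x) = a *\<^sub>C E \<sigma> x"
  by (rule commute_from_intervals[OF bounded_linear_scaleC, symmetric])
     (simp_all add: E_interval G_scaleC)

text \<open>For \<epsilon> > 0 the blocks are [0, \<epsilon>] and then (k \<epsilon>, (k + 1)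
  \<epsilon>]; the point 0 belongs to the first one.\<close>

definition I :: "real \<Rightarrow> nat \<Rightarrow> real set"
  where "I \<epsilon> = disjointed (\<lambda>k. {0..real (Suc k) * \<epsilon>})"

lemma I_sets: "I \<epsilon> k \<in> sets borel_nonneg"
proof -
  have "range (I \<epsilon>) \<subseteq> sets borel_nonneg"
    unfolding I_def by (rule sets.range_disjointed_sets) (use interval_in_sets in auto)
  then show ?thesis by auto
qed

lemma I_disjoint: "disjoint_family (I \<epsilon>)"
  unfolding I_def by (rule disjoint_family_disjointed)

lemma I_UN: "0 < \<epsilon> \<Longrightarrow> (\<Union>k. I \<epsilon> k) = {0..}"
proof -
  assume \<epsilon>: "0 < \<epsilon>"
  have "x \<in> (\<Union>k. {0..real (Suc k) * \<epsilon>})" if "0 \<le> x" for x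
  proof -
    obtain k where "x / \<epsilon> < real k" using reals_Archimedean2 by blast
    then have "x \<le> real (Suc k) * \<epsilon>" using \<epsilon> by (simp add: field_simps)
    then show ?thesis using that by auto
  qed
  then show ?thesis unfolding I_def UN_disjointed_eq by auto
qed

lemma I_upper: "x \<in> I \<epsilon> k \<Longrightarrow> 0 \<le> x \<and> x \<le> real (Suc k) * \<epsilon>"
  by (auto simp: I_def disjointed_def)

lemma I_lower: "x \<in> I \<epsilon> k \<Longrightarrow> real k * \<epsilon> \<le> x"
  by (cases k) (auto simp: I_def disjointed_def not_le intro: less_imp_le)

text \<open>The upper estimates come from G at (k + 1) \<epsilon>, the lower one from G at k
  \<epsilon>, or from positivity of M when k = 0.\<close>

lemma block:
  assumes \<epsilon>: "0 < \<epsilon>" and h: "E (I \<epsilon> k) h = h"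
  shows "\<exists>u. M h = Some u \<and> real k * \<epsilon> * (norm h)\<^sup>2 \<le> u \<bullet> h \<and>
    u \<bullet> h \<le> real (Suc k) * \<epsilon> * (norm h)\<^sup>2 \<and> norm u \<le> real (Suc k) * \<epsilon> * norm h"
proof -
  define t where "t = real (Suc k) * \<epsilon>"
  have t: "0 \<le> t" using \<epsilon> by (simp add: t_def)
  have "E {0..t} h = E ({0..t} \<inter> I \<epsilon> k) h"
    using E_Int[OF interval_in_sets I_sets, of t \<epsilon> k h] h by simp
  also have "{0..t} \<inter> I \<epsilon> k = I \<epsilon> k" using I_upper[of _ \<epsilon> k] by (auto simp: t_def)
  finally have Gt: "G t h = h" using h t by (simp add: E_interval)
  obtain u where u: "M h = Some u" "u \<bullet> h \<le> t * (h \<bullet> h)" using G_low[OF t Gt] by blast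
  have nu: "norm u \<le> t * norm h"
  proof (rule norm_le_of_reduced_form[OF G_proj t _ _ Gt u(1)])
    show "\<exists>v. M x = Some v \<and> v \<bullet> x \<le> t * (x \<bullet> x)" if "G t x = x" for x by (rule G_low[OF t that])
    show "M (G t x) = Some (G t v)" if "M x = Some v" for x v
      using E_intertwines[OF interval_in_sets that, of t] t by (simp add: E_interval)
  qed
  have "real k * \<epsilon> * (h \<bullet> h) \<le> u \<bullet> h"
  proof (cases k)
    case 0
    then show ?thesis using M_cinner(2)[OF u(1)] by simp
  next
    case (Suc j)
    define s where "s = real k * \<epsilon>"
    have s: "0 \<le> s" using \<epsilon> by (simp add: s_def)
    have "E {0..s} h = E ({0..s} \<inter> I \<epsilon> k) h"
      using E_Int[OF interval_in_sets I_sets, of s \<epsilon> k h] h by simp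
    also have "{0..s} \<inter> I \<epsilon> k = {}" using Suc by (auto simp: I_def disjointed_def s_def)
    finally have "G s h = 0" using s by (simp add: E_interval E_empty)
    then show ?thesis using G_high[OF s u(1)] by (cases "h = 0") (auto simp: s_def)
  qed
  with u nu show ?thesis by (auto simp: t_def power2_norm_eq_inner)
qed

lemma nn_integral_blocks:
  assumes \<epsilon>: "0 < \<epsilon>" and H: "H \<in> borel_measurable borel_nonneg"
  shows "nn_integral (sm f) H = (\<Sum>k. \<integral>\<^sup>+x\<in>I \<epsilon> k. H x \<partial>sm f)"
proof -
  have "nn_integral (sm f) H = (\<integral>\<^sup>+x\<in>(\<Union>k. I \<epsilon> k). H x \<partial>sm f)"
    unfolding I_UN[OF \<epsilon>] by (rule nn_integral_cong) simp
  also have "\<dots> = (\<Sum>k. \<integral>\<^sup>+x\<in>I \<epsilon> k. H x \<partial>sm f)"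
    by (rule nn_integral_disjoint_family) (use H I_sets I_disjoint in auto)
  finally show ?thesis .
qed

lemma emeasure_block: "emeasure (sm f) (I \<epsilon> k) = ennreal ((norm (E (I \<epsilon> k) f))\<^sup>2)"
  by (simp add: emeasure_sm I_sets projectionD(5)[OF E_proj[OF I_sets]])

lemma nn_integral_block_le:
  assumes "\<And>x. x \<in> I \<epsilon> k \<Longrightarrow> H x \<le> ennreal b" "0 \<le> b"
  shows "(\<integral>\<^sup>+x\<in>I \<epsilon> k. H x \<partial>sm f) \<le> ennreal (b * (norm (E (I \<epsilon> k) f))\<^sup>2)"
proof -
  have "(\<integral>\<^sup>+x\<in>I \<epsilon> k. H x \<partial>sm f) \<le> (\<integral>\<^sup>+x. ennreal b * indicator (I \<epsilon> k) x \<partial>sm f)"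
    by (rule nn_integral_mono) (auto simp: indicator_def assms(1))
  also have "\<dots> = ennreal (b * (norm (E (I \<epsilon> k) f))\<^sup>2)"
    using assms(2) by (simp add: nn_integral_cmult_indicator I_sets emeasure_block ennreal_mult)
  finally show ?thesis .
qed

lemma nn_integral_block_ge:
  assumes "\<And>x. x \<in> I \<epsilon> k \<Longrightarrow> ennreal b \<le> H x" "0 \<le> b"
  shows "ennreal (b * (norm (E (I \<epsilon> k) f))\<^sup>2) \<le> (\<integral>\<^sup>+x\<in>I \<epsilon> k. H x \<partial>sm f)"
proof -
  have "ennreal (b * (norm (E (I \<epsilon> k) f))\<^sup>2) = (\<integral>\<^sup>+x. ennreal b * indicator (I \<epsilon> k) x \<partial>sm f)"
    using assms(2) by (simp add: nn_integral_cmult_indicator I_sets emeasure_block ennreal_mult)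
  also have "\<dots> \<le> (\<integral>\<^sup>+x\<in>I \<epsilon> k. H x \<partial>sm f)"
    by (rule nn_integral_mono) (auto simp: indicator_def assms(1))
  finally show ?thesis .
qed

lemma block_sums:
  assumes \<epsilon>: "0 < \<epsilon>"
  shows "(\<lambda>k. E (I \<epsilon> k) u \<bullet> E (I \<epsilon> k) f) sums (u \<bullet> f)"
proof -
  have "(\<lambda>k. E (I \<epsilon> k) u) sums E (\<Union>k. I \<epsilon> k) u"
    by (rule E_sums) (use I_sets I_disjoint in auto)
  then have "(\<lambda>k. E (I \<epsilon> k) u) sums u" by (simp add: I_UN[OF \<epsilon>] E_space)
  then have "(\<lambda>k. E (I \<epsilon> k) u \<bullet> f) sums (u \<bullet> f)"
    by (rule bounded_linear.sums[OF bounded_linear_inner_left])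
  moreover have "E (I \<epsilon> k) u \<bullet> E (I \<epsilon> k) f = E (I \<epsilon> k) u \<bullet> f" for k
    using projectionD(3,4)[OF E_proj[OF I_sets]] by metis
  ultimately show ?thesis by simp
qed

lemma block_norm_sums:
  "0 < \<epsilon> \<Longrightarrow> (\<lambda>k. (norm (E (I \<epsilon> k) f))\<^sup>2) sums (norm f)\<^sup>2"
  using block_sums[of \<epsilon> f f] by (simp add: power2_norm_eq_inner)

lemma block_data:
  assumes \<epsilon>: "0 < \<epsilon>" and u: "M f = Some u"
  shows "real k * \<epsilon> * (norm (E (I \<epsilon> k) f))\<^sup>2 \<le> E (I \<epsilon> k) u \<bullet> E (I \<epsilon> k) f"
    "E (I \<epsilon> k) u \<bullet> E (I \<epsilon> k) f \<le> real (Suc k) * \<epsilon> * (norm (E (I \<epsilon> k) f))\<^sup>2"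
  using block[OF \<epsilon> projectionD(4)[OF E_proj[OF I_sets]], of k f] E_intertwines[OF I_sets u, of \<epsilon> k]
  by auto

text \<open>Comparison of Riemann sums: on each block the integral of x and the form of M both lie
  between k \<epsilon> and (k + 1) \<epsilon> times the squared norm, so in total they differ by at
  most \<epsilon> |f|^2, for every \<epsilon> > 0.\<close>

lemma form_eq:
  assumes u: "M f = Some u"
  shows "(\<integral>\<^sup>+x. ennreal x \<partial>sm f) = ennreal (u \<bullet> f)"
proof -
  let ?q = "\<integral>\<^sup>+x. ennreal x \<partial>sm f"
  have meas: "(\<lambda>x. ennreal x) \<in> borel_measurable borel_nonneg" by measurable
  have approx: "?q \<le> ennreal (u \<bullet> f) + ennreal (\<epsilon> * (norm f)\<^sup>2)"
    "ennreal (u \<bullet> f) \<le> ?q + ennreal (\<epsilon> * (norm f)\<^sup>2)" if \<epsilon>: "0 < \<epsilon>" for \<epsilon>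
  proof -
    let ?\<alpha> = "\<lambda>k. (norm (E (I \<epsilon> k) f))\<^sup>2" and ?w = "\<lambda>k. E (I \<epsilon> k) u \<bullet> E (I \<epsilon> k) f"
      and ?q' = "\<lambda>k. \<integral>\<^sup>+x\<in>I \<epsilon> k. ennreal x \<partial>sm f"
    have w0: "0 \<le> ?w k" for k
      by (rule order_trans[OF _ block_data(1)[OF \<epsilon> u]]) (use \<epsilon> in simp)
    have qs: "?q = (\<Sum>k. ?q' k)" by (rule nn_integral_blocks[OF \<epsilon> meas])
    have ws: "(\<Sum>k. ennreal (?w k)) = ennreal (u \<bullet> f)" by (rule suminf_ennreal_eq[OF w0 block_sums[OF \<epsilon>]])
    have as: "(\<Sum>k. ennreal (\<epsilon> * ?\<alpha> k)) = ennreal (\<epsilon> * (norm f)\<^sup>2)"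
      by (rule suminf_ennreal_eq[OF _ sums_mult[OF block_norm_sums[OF \<epsilon>]]]) (use \<epsilon> in simp)
    have "?q' k \<le> ennreal (?w k) + ennreal (\<epsilon> * ?\<alpha> k)" for k
    proof -
      have "?q' k \<le> ennreal (real (Suc k) * \<epsilon> * ?\<alpha> k)"
        by (rule nn_integral_block_le) (use \<epsilon> I_upper in \<open>auto intro!: ennreal_leI\<close>)
      also have "\<dots> \<le> ennreal (?w k + \<epsilon> * ?\<alpha> k)"
        using block_data(1)[OF \<epsilon> u, of k] by (intro ennreal_leI) (simp add: algebra_simps)
      finally show ?thesis using w0 \<epsilon> by simp
    qed
    then have "?q \<le> (\<Sum>k. ennreal (?w k) + ennreal (\<epsilon> * ?\<alpha> k))"
      unfolding qs by (rule suminf_le) (rule summableI)+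
    then show "?q \<le> ennreal (u \<bullet> f) + ennreal (\<epsilon> * (norm f)\<^sup>2)"
      by (simp only: suminf_add[OF summableI summableI, symmetric] ws as)
    have "ennreal (?w k) \<le> ?q' k + ennreal (\<epsilon> * ?\<alpha> k)" for k
    proof -
      have "ennreal (?w k) \<le> ennreal (real k * \<epsilon> * ?\<alpha> k + \<epsilon> * ?\<alpha> k)"
        using block_data(2)[OF \<epsilon> u, of k] by (intro ennreal_leI) (simp add: algebra_simps)
      also have "\<dots> = ennreal (real k * \<epsilon> * ?\<alpha> k) + ennreal (\<epsilon> * ?\<alpha> k)" using \<epsilon> by simp
      also have "ennreal (real k * \<epsilon> * ?\<alpha> k) \<le> ?q' k"
        by (rule nn_integral_block_ge) (use \<epsilon> I_lower in \<open>auto intro!: ennreal_leI\<close>)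
      finally show ?thesis by (simp add: add_right_mono)
    qed
    then have "ennreal (u \<bullet> f) \<le> (\<Sum>k. ?q' k + ennreal (\<epsilon> * ?\<alpha> k))"
      unfolding ws[symmetric] by (rule suminf_le) (rule summableI)+
    then show "ennreal (u \<bullet> f) \<le> ?q + ennreal (\<epsilon> * (norm f)\<^sup>2)"
      by (simp only: suminf_add[OF summableI summableI, symmetric] qs as)
  qed
  have small: "\<exists>\<epsilon>>0. ennreal (\<epsilon> * (norm f)\<^sup>2) \<le> ennreal e" if "0 < e" for e :: real
  proof (intro exI conjI)
    have p: "0 < (norm f)\<^sup>2 + 1" by (simp add: add_nonneg_pos)
    show "0 < e / ((norm f)\<^sup>2 + 1)" using that p by simp
    have "e * (norm f)\<^sup>2 \<le> e * ((norm f)\<^sup>2 + 1)" using that by simp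
    then show "ennreal (e / ((norm f)\<^sup>2 + 1) * (norm f)\<^sup>2) \<le> ennreal e"
      using p by (intro ennreal_leI) (simp add: pos_divide_le_eq)
  qed
  show ?thesis
  proof (rule antisym; rule ennreal_le_epsilon)
    fix e :: real assume "0 < e"
    then obtain \<epsilon> where \<epsilon>: "0 < \<epsilon>" "ennreal (\<epsilon> * (norm f)\<^sup>2) \<le> ennreal e" using small by blast
    show "?q \<le> ennreal (u \<bullet> f) + ennreal e"
      by (rule order_trans[OF approx(1)[OF \<epsilon>(1)] add_left_mono[OF \<epsilon>(2)]])
    show "ennreal (u \<bullet> f) \<le> ?q + ennreal e"
      by (rule order_trans[OF approx(2)[OF \<epsilon>(1)] add_left_mono[OF \<epsilon>(2)]])
  qed
qed

lemma square_measurable: "(\<lambda>x. ennreal (x\<^sup>2)) \<in> borel_measurable borel_nonneg"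
  by measurable

text \<open>Writing f_k and u_k for the components of f and u in the unit blocks, the k-th integral
  is at most (k + 1)^2 |f_k|^2 \<le> 2 k^2 |f_k|^2 + 2 |f_k|^2 \<le> 2 |u_k|^2 + 2 |f_k|^2, which is
  summable. The first comparison of squares is (k - 1)^2 \<ge> 0, the second is M \<ge> k on the
  block.\<close>

lemma square_integral_finite:
  assumes u: "M f = Some u"
  shows "(\<integral>\<^sup>+x. ennreal (x\<^sup>2) \<partial>sm f) < \<infinity>"
proof -
  let ?f = "\<lambda>k. E (I 1 k) f" and ?u = "\<lambda>k. E (I 1 k) u"
  have term_le: "(\<integral>\<^sup>+x\<in>I 1 k. ennreal (x\<^sup>2) \<partial>sm f) \<le> ennreal (2 * (norm (?u k))\<^sup>2 + 2 * (norm (?f k))\<^sup>2)" for k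
  proof -
    have "real k * (norm (?f k) * norm (?f k)) \<le> norm (?u k) * norm (?f k)"
      using order_trans[OF block_data(1)[OF _ u, of 1 k] norm_cauchy_schwarz] by (simp add: power2_eq_square)
    then have "real k * norm (?f k) \<le> norm (?u k)"
      by (cases "norm (?f k) = 0") (auto simp: mult_le_cancel_right simp flip: mult.assoc)
    then have "(real k * norm (?f k))\<^sup>2 \<le> (norm (?u k))\<^sup>2" by (rule power_mono) simp
    moreover have "0 \<le> (real k - 1)\<^sup>2 * (norm (?f k))\<^sup>2" by simp
    ultimately have "(real (Suc k))\<^sup>2 * (norm (?f k))\<^sup>2 \<le> 2 * (norm (?u k))\<^sup>2 + 2 * (norm (?f k))\<^sup>2"
      by (simp add: power2_eq_square algebra_simps)
    moreover have "(\<integral>\<^sup>+x\<in>I 1 k. ennreal (x\<^sup>2) \<partial>sm f) \<le> ennreal ((real (Suc k))\<^sup>2 * (norm (?f k))\<^sup>2)"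
      by (rule nn_integral_block_le) (use I_upper[of _ 1 k] in \<open>auto intro!: ennreal_leI power_mono\<close>)
    ultimately show ?thesis using ennreal_leI order_trans by blast
  qed
  have "(\<integral>\<^sup>+x. ennreal (x\<^sup>2) \<partial>sm f) = (\<Sum>k. \<integral>\<^sup>+x\<in>I 1 k. ennreal (x\<^sup>2) \<partial>sm f)"
    by (rule nn_integral_blocks[OF _ square_measurable]) simp
  also have "\<dots> \<le> (\<Sum>k. ennreal (2 * (norm (?u k))\<^sup>2 + 2 * (norm (?f k))\<^sup>2))"
    by (rule suminf_le[OF term_le summableI summableI])
  also have "\<dots> = ennreal (2 * (norm u)\<^sup>2 + 2 * (norm f)\<^sup>2)"
    by (rule suminf_ennreal_eq) (auto intro!: sums_add sums_mult block_norm_sums)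
  finally show ?thesis by (rule le_less_trans) simp
qed

text \<open>The images u_k of the block components f_k are mutually orthogonal with |u_k| \<le> (k +
  1) |f_k|, so square integrability makes their series converge; closedness of M then carries the
  partial sums to f.\<close>

lemma in_dom_of_square_integral_finite:
  assumes fin: "(\<integral>\<^sup>+x. ennreal (x\<^sup>2) \<partial>sm f) < \<infinity>"
  shows "f \<in> dom M"
proof -
  let ?f = "\<lambda>k. E (I 1 k) f"
  have idem: "E (I 1 k) (?f k) = ?f k" for k by (rule projectionD(4)[OF E_proj[OF I_sets]])
  have "\<exists>u. M (?f k) = Some u \<and> norm u \<le> real (Suc k) * norm (?f k)" for k
    using block[OF _ idem, of k] by auto
  then obtain u where u: "\<And>k. M (?f k) = Some (u k)" "\<And>k. norm (u k) \<le> real (Suc k) * norm (?f k)"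
    by metis
  have Eu: "E (I 1 k) (u k) = u k" for k
    using E_intertwines[OF I_sets u(1)[of k], of 1 k] u(1)[of k] by (simp add: idem)
  have orth: "u i \<bullet> u j = 0" if "i \<noteq> j" for i j
  proof -
    have "u i \<bullet> u j = u i \<bullet> E (I 1 i) (E (I 1 j) (u j))"
      using projectionD(3)[OF E_proj[OF I_sets]] Eu by metis
    also have "E (I 1 i) (E (I 1 j) (u j)) = 0"
      using I_disjoint that by (intro E_orth I_sets) (auto simp: disjoint_family_on_def)
    finally show ?thesis by simp
  qed
  have "summable (\<lambda>k. (real k)\<^sup>2 * (norm (?f k))\<^sup>2)"
  proof (rule summable_suminf_not_top)
    have "(\<Sum>k. ennreal ((real k)\<^sup>2 * (norm (?f k))\<^sup>2)) \<le> (\<Sum>k. \<integral>\<^sup>+x\<in>I 1 k. ennreal (x\<^sup>2) \<partial>sm f)"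
    proof (rule suminf_le[OF _ summableI summableI])
      show "ennreal ((real k)\<^sup>2 * (norm (?f k))\<^sup>2) \<le> (\<integral>\<^sup>+x\<in>I 1 k. ennreal (x\<^sup>2) \<partial>sm f)" for k
        by (rule nn_integral_block_ge) (use I_lower[of _ 1 k] in \<open>auto intro!: ennreal_leI power_mono\<close>)
    qed
    also have "\<dots> = (\<integral>\<^sup>+x. ennreal (x\<^sup>2) \<partial>sm f)"
      by (rule nn_integral_blocks[OF _ square_measurable, symmetric]) simp
    finally show "(\<Sum>k. ennreal ((real k)\<^sup>2 * (norm (?f k))\<^sup>2)) \<noteq> top" using fin by (auto simp: top_unique)
  qed simp
  then have s: "summable (\<lambda>k. 2 * ((real k)\<^sup>2 * (norm (?f k))\<^sup>2) + 2 * (norm (?f k))\<^sup>2)"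
    using block_norm_sums[of 1 f] by (intro summable_add summable_mult) (auto simp: sums_iff)
  have "summable (\<lambda>k. (norm (u k))\<^sup>2)"
  proof (rule summable_comparison_test'[OF s])
    fix k
    have "(norm (u k))\<^sup>2 \<le> (real (Suc k) * norm (?f k))\<^sup>2" by (rule power_mono[OF u(2)]) simp
    moreover have "0 \<le> (real k - 1)\<^sup>2 * (norm (?f k))\<^sup>2" by simp
    ultimately have "(norm (u k))\<^sup>2 \<le> 2 * ((real k)\<^sup>2 * (norm (?f k))\<^sup>2) + 2 * (norm (?f k))\<^sup>2"
      by (simp add: power2_eq_square algebra_simps)
    then show "norm ((norm (u k))\<^sup>2) \<le> 2 * ((real k)\<^sup>2 * (norm (?f k))\<^sup>2) + 2 * (norm (?f k))\<^sup>2" by simp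
  qed
  then have "summable u" using orthogonal_summable[of u] orth by blast
  then have lim: "(\<lambda>n. \<Sum>k<n. u k) \<longlonglongrightarrow> suminf u" by (rule summable_LIMSEQ)
  have "?f sums E (\<Union>k. I 1 k) f" by (rule E_sums) (use I_sets I_disjoint in auto)
  then have flim: "(\<lambda>n. \<Sum>k<n. ?f k) \<longlonglongrightarrow> f" by (simp add: I_UN E_space sums_def)
  have "M (\<Sum>k<n. ?f k) = Some (\<Sum>k<n. u k)" for n
    by (induction n) (simp_all add: zero add u(1))
  then have "M f = Some (suminf u)" by (rule M_closed[OF flim lim])
  then show ?thesis by blast
qed

lemma has_spectral_measure: "has_spectral_measure M E"
  unfolding has_spectral_measure_def
proof (intro conjI ballI)
  have sm: "scalar_measure E f = sm f" for f
    by (simp add: scalar_measure_def sm_def inner_eq_Re_cinner)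
  show "spectral_measure E"
    unfolding spectral_measure_def using E_space E_sums
    by (simp add: orthogonal_projection_iff E_proj E_scaleC)
  show "dom M = {f. (\<integral>\<^sup>+x. ennreal (x\<^sup>2) \<partial>scalar_measure E f) < \<infinity>}"
    unfolding sm using square_integral_finite in_dom_of_square_integral_finite by blast
  fix f assume "f \<in> dom M"
  then obtain u where u: "M f = Some u" by blast
  have "(\<integral>x. x \<partial>sm f) = enn2real (\<integral>\<^sup>+x. ennreal x \<partial>sm f)"
    by (rule integral_eq_nn_integral) (auto intro!: AE_I2)
  also have "\<dots> = u \<bullet> f" using M_cinner(2)[OF u] by (simp add: form_eq[OF u])
  finally show "cinner (the (M f)) f = complex_of_real (\<integral>x. x \<partial>scalar_measure E f)"
    by (simp add: u sm M_cinner(1)[OF u])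
qed

end

lemma (in positive_selfadjoint) has_spectral_measure_of: "has_spectral_measure M (spectral_measure_of M)"
proof -
  obtain E where E: "resolution_of_identity E" "\<forall>t\<ge>0. E {0..t} = G t"
    using spectral_measure_exists by blast
  interpret R: resolution_of_identity E by (rule E(1))
  interpret spectral_construction M E by unfold_locales (use E(2) in blast)
  show ?thesis unfolding spectral_measure_of_def by (rule someI[of "has_spectral_measure M", OF has_spectral_measure])
qed

section \<open>The modulus of a closed densely defined operator\<close>

lemma map_comp_Some: "(S \<circ>\<^sub>m T) f = Some z \<longleftrightarrow> (\<exists>u. T f = Some u \<and> S u = Some z)"
  by (auto simp: map_comp_Some_iff)

lemma option_fun_eqI: "(\<And>x y. f x = Some y \<longleftrightarrow> g x = Some y) \<Longrightarrow> f = g"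
  by (rule ext) (metis option.exhaust)

lemma subspace_closure:
  fixes S :: "'a::real_normed_vector set"
  assumes "subspace S"
  shows "subspace (closure S)"
proof (rule subspaceI)
  show "0 \<in> closure S" using subspace_0[OF assms] closure_subset by blast
  show "x + y \<in> closure S" if xy: "x \<in> closure S" "y \<in> closure S" for x y
  proof -
    obtain f g where f: "\<And>n. f n \<in> S" "f \<longlonglongrightarrow> x" and g: "\<And>n. g n \<in> S" "g \<longlonglongrightarrow> y"
      using xy unfolding closure_sequential by blast
    have "f n + g n \<in> S" for n by (rule subspace_add[OF assms f(1) g(1)])
    then show ?thesis unfolding closure_sequential using tendsto_add[OF f(2) g(2)]
      by (intro exI[of _ "\<lambda>n. f n + g n"]) simp
  qed
  show "r *\<^sub>R x \<in> closure S" if x: "x \<in> closure S" for r x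
  proof -
    obtain f where f: "\<And>n. f n \<in> S" "f \<longlonglongrightarrow> x" using x unfolding closure_sequential by blast
    have "r *\<^sub>R f n \<in> S" for n by (rule subspace_scale[OF assms f(1)])
    then show ?thesis unfolding closure_sequential using tendsto_scaleR[OF tendsto_const[of r] f(2)]
      by (intro exI[of _ "\<lambda>n. r *\<^sub>R f n"]) simp
  qed
qed

lemma dense_subspaceI:
  fixes S :: "'a::{real_inner,complete_space} set"
  assumes S: "subspace S" and 0: "\<And>x. (\<And>s. s \<in> S \<Longrightarrow> x \<bullet> s = 0) \<Longrightarrow> x = 0"
  shows "closure S = UNIV"
proof -
  have "x \<in> closure S" for x
  proof -
    obtain p where p: "p \<in> closure S" "\<And>s. s \<in> closure S \<Longrightarrow> (x - p) \<bullet> s = 0"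
      by (rule orthogonal_decomposition[OF subspace_closure[OF S] closed_closure, of x]) blast
    have "x - p = 0" by (rule 0) (use p(2) closure_subset in blast)
    then show ?thesis using p(1) by simp
  qed
  then show ?thesis by blast
qed

section \<open>Closed operators and the construction of |A|\<close>

locale closed_op = dense_op +
  assumes closed_A: "closed_operator A"
begin

lemma graph_closed: "closed (Map.graph A)"
  using closed_A by (simp add: closed_operator_def)

lemma in_graph: "(f, v) \<in> Map.graph A \<longleftrightarrow> A f = Some v"
  by (simp add: Map.graph_def)

lemma A_closed:
  assumes "f \<longlonglongrightarrow> g" "u \<longlonglongrightarrow> v" "\<And>n. A (f n) = Some (u n)"
  shows "A g = Some v"
proof -
  have lim: "(\<lambda>n. (f n, u n)) \<longlonglongrightarrow> (g, v)" using assms(1,2) by (rule tendsto_Pair)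
  have "(f n, u n) \<in> Map.graph A" for n using assms(3) by (simp add: in_graph)
  then have "(g, v) \<in> Map.graph A" by (rule closed_sequentially[OF graph_closed _ lim])
  then show ?thesis by (simp add: in_graph)
qed

text \<open>The orthogonal projection of \<open>(g, 0)\<close> onto the graph of \<open>A\<close> solves \<open>f + A\<^sup>* A f = g\<close>.\<close>

lemma one_plus_AA_surj: "\<exists>f v. A f = Some v \<and> op_adjoint A v = Some (g - f)"
proof -
  obtain p where p: "p \<in> Map.graph A" "\<And>s. s \<in> Map.graph A \<Longrightarrow> ((g, 0) - p) \<bullet> s = 0"
    by (rule orthogonal_decomposition[OF graph_subspace graph_closed, of "(g, 0)"]) blast
  obtain f v where fv: "p = (f, v)" by (cases p)
  have "op_adjoint A v = Some (g - f)"
  proof (rule op_adjoint_I)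
    fix f' u assume "A f' = Some u"
    then show "u \<bullet> v = f' \<bullet> (g - f)"
      using p(2)[of "(f', u)"] by (simp add: in_graph fv inner_diff_left inner_diff_right inner_commute)
  qed
  then show ?thesis using p(1) fv by (auto simp: in_graph)
qed

definition D :: "'a \<Rightarrow> 'a"
  where "D g = (SOME f. \<exists>v. A f = Some v \<and> op_adjoint A v = Some (g - f))"

lemma D: "\<exists>v. A (D g) = Some v \<and> op_adjoint A v = Some (g - D g)"
  unfolding D_def using someI_ex[OF one_plus_AA_surj] .

lemma adj_add: "op_adjoint A f = Some u \<Longrightarrow> op_adjoint A g = Some v \<Longrightarrow> op_adjoint A (f + g) = Some (u + v)"
  by (simp add: op_adjoint_iff inner_right_distrib)

lemma adj_scaleR: "op_adjoint A f = Some u \<Longrightarrow> op_adjoint A (r *\<^sub>R f) = Some (r *\<^sub>R u)"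
  by (simp add: op_adjoint_iff)

lemma adj_scaleC:
  assumes "op_adjoint A f = Some u"
  shows "op_adjoint A (a *\<^sub>C f) = Some (a *\<^sub>C u)"
proof (rule op_adjoint_I)
  fix h v assume "A h = Some v"
  then have "(cnj a *\<^sub>C v) \<bullet> f = (cnj a *\<^sub>C h) \<bullet> u" by (intro op_adjoint_D[OF assms] scaleC)
  then show "v \<bullet> (a *\<^sub>C f) = h \<bullet> (a *\<^sub>C u)" by (simp add: inner_scaleC_left)
qed

lemma adj_minus: "op_adjoint A f = Some u \<Longrightarrow> op_adjoint A g = Some v \<Longrightarrow> op_adjoint A (f - g) = Some (u - v)"
  by (simp add: op_adjoint_iff inner_diff_right)

text \<open>Two solutions differ by some h with A^* A h = -h, whence |A h|^2 = -|h|^2.\<close>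

lemma D_unique:
  assumes "A f = Some v" "op_adjoint A v = Some (g - f)"
  shows "D g = f"
proof -
  obtain w where w: "A (D g) = Some w" "op_adjoint A w = Some (g - D g)" using D by blast
  have "A (D g - f) = Some (w - v)" by (rule minus[OF w(1) assms(1)])
  moreover have "op_adjoint A (w - v) = Some ((g - D g) - (g - f))" by (rule adj_minus[OF w(2) assms(2)])
  ultimately have "(w - v) \<bullet> (w - v) = (D g - f) \<bullet> ((g - D g) - (g - f))" by (metis op_adjoint_D)
  also have "\<dots> = - ((D g - f) \<bullet> (D g - f))" by (simp add: inner_diff_left inner_diff_right)
  finally have "(D g - f) \<bullet> (D g - f) \<le> 0" using inner_ge_zero[of "w - v"] by linarith
  then have "D g - f = 0" by (metis inner_ge_zero inner_eq_zero_iff antisym)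
  then show ?thesis by simp
qed

lemma D_sym: "D g \<bullet> h = g \<bullet> D h" and D_pos: "0 \<le> D g \<bullet> g" and D_le: "0 \<le> (g - D g) \<bullet> g"
  and D_norm: "norm (D g) \<le> norm g"
proof -
  obtain v where v: "A (D g) = Some v" "op_adjoint A v = Some (g - D g)" using D by blast
  obtain w where w: "A (D h) = Some w" "op_adjoint A w = Some (h - D h)" using D by blast
  have "v \<bullet> w = D g \<bullet> (h - D h)" "w \<bullet> v = D h \<bullet> (g - D g)"
    using op_adjoint_D v w by blast+
  then show "D g \<bullet> h = g \<bullet> D h" by (simp add: inner_diff_right inner_commute)
  have vv: "v \<bullet> v = D g \<bullet> (g - D g)" using op_adjoint_D v by blast
  then have le: "D g \<bullet> D g \<le> D g \<bullet> g" using inner_ge_zero[of v] by (simp add: inner_diff_right)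
  then show "0 \<le> D g \<bullet> g" using inner_ge_zero[of "D g"] by linarith
  have "(g - D g) \<bullet> g = (g - D g) \<bullet> (g - D g) + v \<bullet> v"
    unfolding vv by (simp add: inner_diff_left inner_diff_right inner_commute)
  then show "0 \<le> (g - D g) \<bullet> g" by simp
  have "norm (D g) * norm (D g) \<le> norm (D g) * norm g"
    using le norm_cauchy_schwarz[of "D g" g]
    by (simp add: power2_norm_eq_inner flip: power2_eq_square)
  then show "norm (D g) \<le> norm g" by (cases "norm (D g) = 0") (auto simp: mult_le_cancel_left)
qed

lemma D_lin: "bounded_linear D"
proof (rule bounded_linear_intro[where K=1])
  fix x y :: 'a and r :: real
  obtain v where v: "A (D x) = Some v" "op_adjoint A v = Some (x - D x)" using D by blast
  obtain w where w: "A (D y) = Some w" "op_adjoint A w = Some (y - D y)" using D by blast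
  show "D (x + y) = D x + D y"
    by (rule D_unique[OF add[OF v(1) w(1)]]) (use adj_add[OF v(2) w(2)] in \<open>simp add: algebra_simps\<close>)
  show "D (r *\<^sub>R x) = r *\<^sub>R D x"
    by (rule D_unique[OF scaleR[OF v(1)]]) (use adj_scaleR[OF v(2), of r] in \<open>simp add: algebra_simps\<close>)
  show "norm (D x) \<le> norm x * 1" using D_norm by simp
qed

lemma D_scaleC: "D (a *\<^sub>C x) = a *\<^sub>C D x"
proof -
  obtain v where v: "A (D x) = Some v" "op_adjoint A v = Some (x - D x)" using D by blast
  show ?thesis
    by (rule D_unique[OF scaleC[OF v(1)]]) (use adj_scaleC[OF v(2), of a] in \<open>simp add: scaleC_minus\<close>)
qed

lemma D_inj:
  assumes "D g = 0"
  shows "g = 0"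
proof -
  obtain v where v: "A (D g) = Some v" "op_adjoint A v = Some (g - D g)" using D by blast
  have "v = 0" using v(1) assms zero by simp
  then have "op_adjoint A 0 = Some g" using v(2) assms by simp
  moreover have "op_adjoint A 0 = Some 0" by (rule op_adjoint_I) simp
  ultimately show ?thesis by simp
qed

text \<open>A^* A = D^-1 - 1, domains included.\<close>

lemma AA_iff: "(op_adjoint A \<circ>\<^sub>m A) f = Some z \<longleftrightarrow> (\<exists>g. f = D g \<and> z = g - D g)"
proof
  assume "(op_adjoint A \<circ>\<^sub>m A) f = Some z"
  then obtain v where v: "A f = Some v" "op_adjoint A v = Some z" unfolding map_comp_Some by blast
  have "D (f + z) = f" by (rule D_unique[OF v(1)]) (use v(2) in simp)
  then show "\<exists>g. f = D g \<and> z = g - D g" by (intro exI[of _ "f + z"]) simp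
next
  assume "\<exists>g. f = D g \<and> z = g - D g"
  then show "(op_adjoint A \<circ>\<^sub>m A) f = Some z" using D unfolding map_comp_Some by blast
qed

text \<open>With \<open>D = (1 + A\<^sup>* A)\<^sup>-\<^sup>1\<close>, \<open>R = D\<^sup>1\<^sup>/\<^sup>2\<close> and \<open>C = (1 - D)\<^sup>1\<^sup>/\<^sup>2\<close>, the modulus is \<open>C R\<^sup>-\<^sup>1\<close>.\<close>

lemma modulus_exists:
  "\<exists>M. selfadjoint M \<and> positive_operator M \<and> M \<circ>\<^sub>m M = op_adjoint A \<circ>\<^sub>m A"
proof -
  have posD: "positive_map D"
    using D_lin D_sym D_pos by (simp add: positive_map_def symmetric_map_def)
  have pos1D: "positive_map (\<lambda>x. x - D x)"
    using D_lin D_sym D_le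
    by (simp add: positive_map_def symmetric_map_def bounded_linear_minus_id inner_diff)
  obtain R where R: "positive_map R" "\<forall>x. R (R x) = D x"
    "\<forall>T. bounded_linear T \<longrightarrow> (\<forall>x. T (D x) = D (T x)) \<longrightarrow> (\<forall>x. T (R x) = R (T x))"
    using positive_map_sqrt[OF posD] by blast
  obtain C where C: "positive_map C" "\<forall>x. C (C x) = x - D x"
    "\<forall>T. bounded_linear T \<longrightarrow> (\<forall>x. T (x - D x) = T x - D (T x)) \<longrightarrow> (\<forall>x. T (C x) = C (T x))"
    using positive_map_sqrt[OF pos1D] by blast
  \<comment> \<open>The fourth root of D serves the positivity of M: C g . R g = C (S g) . S g, as S
    commutes with C.\<close>
  obtain S where S: "positive_map S" "\<forall>x. S (S x) = R x"
    "\<forall>T. bounded_linear T \<longrightarrow> (\<forall>x. T (R x) = R (T x)) \<longrightarrow> (\<forall>x. T (S x) = S (T x))"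
    using positive_map_sqrt[OF R(1)] by blast
  have Rl: "bounded_linear R" and Rs: "\<And>x y. R x \<bullet> y = x \<bullet> R y"
    using R(1) by (auto simp: positive_map_def symmetric_map_def)
  have Cl: "bounded_linear C" and Cs: "\<And>x y. C x \<bullet> y = x \<bullet> C y" and Cp: "\<And>x. 0 \<le> C x \<bullet> x"
    using C(1) by (auto simp: positive_map_def symmetric_map_def)
  have Ss: "\<And>x y. S x \<bullet> y = x \<bullet> S y"
    using S(1) by (auto simp: positive_map_def symmetric_map_def)
  have linD: "D (x - y) = D x - D y" for x y by (rule linear_diff[OF bounded_linear.linear[OF D_lin]])
  have DC: "D (C x) = C (D x)" for x using C(3) D_lin linD by blast
  have CR: "C (R x) = R (C x)" for x using R(3) Cl DC by simp
  have CS: "C (S x) = S (C x)" for x using S(3) Cl CR by simp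
  have RC: "a *\<^sub>C R x = R (a *\<^sub>C x)" for a x using R(3) bounded_linear_scaleC D_scaleC by metis
  have CC: "a *\<^sub>C C x = C (a *\<^sub>C x)" for a x
  proof -
    have "\<forall>x. a *\<^sub>C (x - D x) = a *\<^sub>C x - D (a *\<^sub>C x)" by (simp add: scaleC_minus D_scaleC)
    then show ?thesis using C(3) bounded_linear_scaleC by metis
  qed
  have Radd: "R (x + y) = R x + R y" and Cadd: "C (x + y) = C x + C y"
    and Rdiff: "R (x - y) = R x - R y" and R0: "R 0 = 0" and C0: "C 0 = 0" for x y
    using bounded_linear.linear[OF Rl] bounded_linear.linear[OF Cl]
    by (auto simp: linear_add linear_diff linear_0)
  have split: "R (R x) + C (C x) = x" for x by (simp add: R(2) C(2))
  have Rinj0: "x = 0" if "R x = 0" for x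
    by (rule D_inj) (metis R(2) that R0)
  have Rinj: "x = y" if "R x = R y" for x y using Rinj0[of "x - y"] that by (simp add: Rdiff)
  define M where "M f = (if f \<in> range R then Some (C (inv R f)) else None)" for f
  have MR: "M (R g) = Some (C g)" for g
    using Rinj by (simp add: M_def inv_f_f inj_def)
  have M_iff: "M f = Some u \<longleftrightarrow> (\<exists>g. f = R g \<and> u = C g)" for f u
  proof
    assume "M f = Some u"
    then have f: "f \<in> range R" by (metis M_def option.distinct(1))
    then obtain g where "f = R g" by blast
    then show "\<exists>g. f = R g \<and> u = C g" using \<open>M f = Some u\<close> MR by auto
  qed (use MR in blast)
  have domM: "dom M = range R" by (auto simp: M_def split: if_splits)
  have lin: "linear_operator M"
    unfolding linear_operator_def domM using MR[of 0]
    by (auto simp: R0 C0 MR RC CC Cadd simp flip: Radd)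
  have "subspace (range R)"
    by (rule linear_subspace_image[OF bounded_linear.linear[OF Rl] subspace_UNIV])
  then have dense: "densely_defined M"
    unfolding densely_defined_def domM
  proof (rule dense_subspaceI)
    fix x assume "\<And>s. s \<in> range R \<Longrightarrow> x \<bullet> s = 0"
    then have "R x \<bullet> R x = 0" by (simp add: Rs)
    then show "x = 0" using Rinj0 by simp
  qed
  interpret M: dense_op M using lin dense by unfold_locales
  have "op_adjoint M = M"
  proof (rule option_fun_eqI)
    fix h k
    have "op_adjoint M h = Some k \<longleftrightarrow> (\<forall>g. C g \<bullet> h = R g \<bullet> k)"
      unfolding M.op_adjoint_iff M_iff by blast
    also have "\<dots> \<longleftrightarrow> C h = R k"
    proof
      assume *: "\<forall>g. C g \<bullet> h = R g \<bullet> k"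
      show "C h = R k"
        by (rule inner_eqI) (metis * Cs Rs inner_commute)
    next
      assume "C h = R k"
      then show "\<forall>g. C g \<bullet> h = R g \<bullet> k" by (simp add: Cs Rs)
    qed
    also have "\<dots> \<longleftrightarrow> M h = Some k"
    proof
      assume *: "C h = R k"
      \<comment> \<open>The preimage comes from R^2 + C^2 = 1: h = R R h + C C h = R R h + C R
        k.\<close>
      have "h = R (R h + C k)"
        using split[of h] * CR[of k] by (simp add: Radd)
      moreover have "k = C (R h + C k)"
        using split[of k] * CR[of h] by (simp add: Cadd)
      ultimately show "M h = Some k" unfolding M_iff by blast
    next
      assume "M h = Some k"
      then show "C h = R k" unfolding M_iff using CR by auto
    qed
    finally show "op_adjoint M h = Some k \<longleftrightarrow> M h = Some k" .
  qed
  then have sa: "selfadjoint M" using lin dense by (simp add: selfadjoint_def)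
  have pos: "positive_operator M"
    unfolding positive_operator_def domM
  proof
    fix f assume "f \<in> range R"
    then obtain g where g: "f = R g" by blast
    have "C g \<bullet> R g = C (S g) \<bullet> S g" by (metis CS S(2) Ss)
    then have "0 \<le> C g \<bullet> R g" using Cp by simp
    \<comment> \<open>This is the imaginary part of the form; symmetry of C R and antisymmetry of
      multiplication by i make it its own negative.\<close>
    moreover have "C g \<bullet> (\<i> *\<^sub>C R g) = 0"
    proof -
      have "C g \<bullet> (\<i> *\<^sub>C R g) = R g \<bullet> (\<i> *\<^sub>C C g)"
        by (metis CC CR Cs RC Rs)
      also have "\<dots> = (cnj \<i> *\<^sub>C R g) \<bullet> C g" by (simp add: inner_scaleC_left)
      also have "cnj \<i> *\<^sub>C R g = - (\<i> *\<^sub>C R g)"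
        using scaleC_minus[of \<i> 0 "R g"] scaleC_scaleC[of "-1" \<i> "R g"] scaleC_of_real[of "-1" "\<i> *\<^sub>C R g"]
        by simp
      finally show ?thesis by (simp add: inner_commute)
    qed
    ultimately show "cinner (the (M f)) f \<in> \<real>\<^sub>\<ge>\<^sub>0"
      by (simp add: g MR cinner_eq_inner complex_nonneg_Reals_iff)
  qed
  have "M \<circ>\<^sub>m M = op_adjoint A \<circ>\<^sub>m A"
  proof (rule option_fun_eqI)
    fix f z
    show "(M \<circ>\<^sub>m M) f = Some z \<longleftrightarrow> (op_adjoint A \<circ>\<^sub>m A) f = Some z"
      unfolding AA_iff
    proof
      assume "(M \<circ>\<^sub>m M) f = Some z"
      then obtain g k where g: "f = R g" "C g = R k" "z = C k" unfolding map_comp_Some M_iff by metis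
      define p where "p = R g + C k"
      have gp: "g = R p" using split[of g] g(2) CR[of k] by (simp add: p_def Radd)
      have kp: "k = C p" using split[of k] g(2) CR[of g] by (simp add: p_def Cadd)
      show "\<exists>g. f = D g \<and> z = g - D g"
        using g(1,3) gp kp R(2) C(2) by (intro exI[of _ p]) simp
    next
      assume "\<exists>g. f = D g \<and> z = g - D g"
      then obtain p where "f = R (R p)" "z = C (C p)" using R(2) C(2) by metis
      then show "(M \<circ>\<^sub>m M) f = Some z" unfolding map_comp_Some M_iff using CR by metis
    qed
  qed
  with sa pos show ?thesis by blast
qed

lemma modulus_spec: "selfadjoint (modulus A)" "positive_operator (modulus A)"
  "modulus A \<circ>\<^sub>m modulus A = op_adjoint A \<circ>\<^sub>m A"
  using someI_ex[OF modulus_exists] unfolding modulus_def by blast+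

text \<open>D(A^* A) is a core for A. An element q of the graph orthogonal to all pairs (D g, A D g)
  satisfies fst q . D g + fst q . (g - D g) = 0, that is, fst q . g = 0 for every g, so q =
  0.\<close>

lemma core:
  assumes v: "A f = Some v"
  shows "\<exists>h a w. h \<longlonglongrightarrow> f \<and> a \<longlonglongrightarrow> v \<and> (\<forall>n. A (h n) = Some (a n) \<and> op_adjoint A (a n) = Some (w n))"
proof -
  let ?S = "{p. A (fst p) = Some (snd p) \<and> (\<exists>w. op_adjoint A (snd p) = Some w)}"
  have S: "subspace ?S"
  proof (rule subspaceI)
    have "op_adjoint A 0 = Some 0" by (rule op_adjoint_I) simp
    then show "0 \<in> ?S" using zero by simp
    show "p + q \<in> ?S" if "p \<in> ?S" "q \<in> ?S" for p q using that add adj_add by auto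
    show "r *\<^sub>R p \<in> ?S" if "p \<in> ?S" for r p using that scaleR adj_scaleR by auto
  qed
  have "closure ?S \<subseteq> Map.graph A"
    by (rule closure_minimal[OF _ graph_closed]) (auto simp: Map.graph_def)
  obtain p where p: "p \<in> closure ?S" "\<And>s. s \<in> closure ?S \<Longrightarrow> ((f, v) - p) \<bullet> s = 0"
    by (rule orthogonal_decomposition[OF subspace_closure[OF S] closed_closure, of "(f, v)"]) blast
  define q where "q = (f, v) - p"
  have "q \<in> Map.graph A"
    unfolding q_def using p(1) \<open>closure ?S \<subseteq> Map.graph A\<close> v
    by (intro subspace_diff[OF graph_subspace]) (auto simp: in_graph)
  then have qA: "A (fst q) = Some (snd q)" by (cases q) (simp add: in_graph)
  have "fst q \<bullet> g = 0" for g
  proof -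
    obtain a where a: "A (D g) = Some a" "op_adjoint A a = Some (g - D g)" using D by blast
    then have "(D g, a) \<in> ?S" by simp
    then have "(D g, a) \<in> closure ?S" by (rule subsetD[OF closure_subset])
    then have "q \<bullet> (D g, a) = 0" unfolding q_def by (rule p(2))
    moreover have "snd q \<bullet> a = fst q \<bullet> (g - D g)" by (rule op_adjoint_D[OF a(2) qA])
    ultimately show ?thesis by (simp add: inner_prod_def inner_diff_right)
  qed
  then have "fst q = 0" by (metis inner_eq_zero_iff)
  then have "q = 0" using qA zero by (simp add: prod_eq_iff)
  then have "(f, v) \<in> closure ?S" using p(1) by (simp add: q_def)
  then obtain s where s: "\<And>n. s n \<in> ?S" "s \<longlonglongrightarrow> (f, v)" unfolding closure_sequential by blast
  from s(1) obtain w where "\<And>n. op_adjoint A (snd (s n)) = Some (w n)" by simp metis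
  then show ?thesis
    using s(1) tendsto_fst[OF s(2)] tendsto_snd[OF s(2)]
    by (intro exI[of _ "\<lambda>n. fst (s n)"] exI[of _ "\<lambda>n. snd (s n)"] exI[of _ w]) auto
qed

end

text \<open>|A h|^2 = A^* A h . h depends on A^* A only, so A and A' have equal norms on the common
  core, also at differences. A sequence in the core converging in the graph of A is therefore Cauchy
  in the graph of A', which is closed.\<close>

lemma same_AA_imp:
  assumes A: "closed_op A" and A': "closed_op A'" and eq: "op_adjoint A \<circ>\<^sub>m A = op_adjoint A' \<circ>\<^sub>m A'"
    and v: "A f = Some v"
  shows "\<exists>u. A' f = Some u \<and> norm u = norm v"
proof -
  interpret A: closed_op A by (rule A)
  interpret A': closed_op A' by (rule A')
  obtain h a w where h: "h \<longlonglongrightarrow> f" and a: "a \<longlonglongrightarrow> v"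
    and ha: "\<And>n. A (h n) = Some (a n)" "\<And>n. op_adjoint A (a n) = Some (w n)"
    using A.core[OF v] by blast
  have "\<exists>b. A' (h n) = Some b \<and> op_adjoint A' b = Some (w n)" for n
    using ha map_comp_Some[of "op_adjoint A" A "h n" "w n"] eq map_comp_Some[of "op_adjoint A'" A' "h n" "w n"]
    by auto
  then obtain b where b: "\<And>n. A' (h n) = Some (b n)" "\<And>n. op_adjoint A' (b n) = Some (w n)" by metis
  have nd: "norm (b m - b n) = norm (a m - a n)" for m n
  proof -
    have "(b m - b n) \<bullet> (b m - b n) = (h m - h n) \<bullet> (w m - w n)"
      by (rule A'.op_adjoint_D[OF A'.adj_minus[OF b(2) b(2)] A'.minus[OF b(1) b(1)]])
    moreover have "(a m - a n) \<bullet> (a m - a n) = (h m - h n) \<bullet> (w m - w n)"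
      by (rule A.op_adjoint_D[OF A.adj_minus[OF ha(2) ha(2)] A.minus[OF ha(1) ha(1)]])
    ultimately show ?thesis by (simp add: norm_eq_sqrt_inner)
  qed
  have nb: "norm (b n) = norm (a n)" for n
    using A'.op_adjoint_D[OF b(2) b(1), of n] A.op_adjoint_D[OF ha(2) ha(1), of n]
    by (simp add: norm_eq_sqrt_inner)
  have "Cauchy b"
    using LIMSEQ_imp_Cauchy[OF a] nd unfolding Cauchy_def dist_norm by simp
  then obtain u where u: "b \<longlonglongrightarrow> u" using Cauchy_convergent convergent_def by blast
  have "A' f = Some u" by (rule A'.A_closed[OF h u b(1)])
  moreover have "norm u = norm v"
    using tendsto_norm[OF u] tendsto_norm[OF a] LIMSEQ_unique by (simp add: nb)
  ultimately show ?thesis by blast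
qed

lemma (in positive_selfadjoint) closed_op_M: "closed_op M"
proof
  show "closed_operator M"
    unfolding closed_operator_def closed_sequential_limits
  proof (intro allI impI, elim conjE)
    fix p l assume p: "\<forall>n. p n \<in> Map.graph M" and l: "p \<longlonglongrightarrow> l"
    have "M (fst (p n)) = Some (snd (p n))" for n
      using p[rule_format, of n] by (cases "p n") (simp add: Map.graph_def)
    then have "M (fst l) = Some (snd l)"
      by (rule M_closed[OF tendsto_fst[OF l] tendsto_snd[OF l]])
    then show "l \<in> Map.graph M" by (cases l) (simp add: Map.graph_def)
  qed
qed

context closed_op
begin

lemma modulus_positive_selfadjoint: "positive_selfadjoint (modulus A)"
  using modulus_spec by unfold_locales

text \<open>By selfadjointness |A|^2 is the adjoint of |A| composed with |A|, so
  \<open>same_AA_imp\<close> applies. Together with \<open>of_modulus\<close> this yields D(|A|) =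
  D(A).\<close>

lemma modulus_of:
  assumes "A f = Some v"
  shows "\<exists>u. modulus A f = Some u \<and> norm u = norm v"
proof (rule same_AA_imp[of A "modulus A", OF _ positive_selfadjoint.closed_op_M[OF modulus_positive_selfadjoint]])
  show "closed_op A" by unfold_locales
  show "op_adjoint A \<circ>\<^sub>m A = op_adjoint (modulus A) \<circ>\<^sub>m modulus A"
    using modulus_spec by (simp add: selfadjoint_def)
qed (rule assms)

lemma of_modulus:
  assumes "modulus A f = Some u"
  shows "\<exists>v. A f = Some v \<and> norm v = norm u"
proof (rule same_AA_imp[of "modulus A" A, OF positive_selfadjoint.closed_op_M[OF modulus_positive_selfadjoint]])
  show "closed_op A" by unfold_locales
  show "op_adjoint (modulus A) \<circ>\<^sub>m modulus A = op_adjoint A \<circ>\<^sub>m A"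
    using modulus_spec by (simp add: selfadjoint_def)
qed (rule assms)

end

section \<open>Weakly quasinormal operators\<close>

lemma eq_on_subspace_and_complement:
  fixes U V :: "'a::{real_inner,complete_space} \<Rightarrow> 'a"
  assumes U: "bounded_linear U" and V: "bounded_linear V" and D: "subspace D"
    and on: "\<And>x. x \<in> D \<Longrightarrow> U x = V x" and perp: "\<And>z. (\<And>x. x \<in> D \<Longrightarrow> z \<bullet> x = 0) \<Longrightarrow> U z = V z"
  shows "U x = V x"
proof -
  obtain p where p: "p \<in> closure D" "\<And>s. s \<in> closure D \<Longrightarrow> (x - p) \<bullet> s = 0"
    by (rule orthogonal_decomposition[OF subspace_closure[OF D] closed_closure, of x]) blast
  have "closed {x. U x = V x}" by (intro closed_Collect_eq linear_continuous_on U V)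
  then have "closure D \<subseteq> {x. U x = V x}" using on by (intro closure_minimal) auto
  then have "U p = V p" using p(1) by auto
  moreover have "(x - p) \<bullet> y = 0" if "y \<in> D" for y by (rule p(2)[OF subsetD[OF closure_subset that]])
  then have "U (x - p) = V (x - p)" by (rule perp)
  ultimately show ?thesis
    using linear_diff[OF bounded_linear.linear[OF U]] linear_diff[OF bounded_linear.linear[OF V]] by simp
qed

text \<open>The closure of the relation is still bounded by K, hence the graph of a map on a closed
  domain; composing with the projection onto that domain makes the extension vanish on the
  complement.\<close>

lemma bounded_extension:
  fixes \<Gamma> :: "('a::{real_inner,complete_space} \<times> 'a) set"
  assumes \<Gamma>: "subspace \<Gamma>" and le: "\<And>x y. (x, y) \<in> \<Gamma> \<Longrightarrow> norm y \<le> K * norm x" and K: "0 \<le> K"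
  shows "\<exists>T. bounded_linear T \<and> (\<forall>x. norm (T x) \<le> K * norm x) \<and> (\<forall>x y. (x, y) \<in> \<Gamma> \<longrightarrow> T x = y) \<and>
    (\<forall>z. (\<forall>p\<in>\<Gamma>. z \<bullet> fst p = 0) \<longrightarrow> T z = 0)"
proof -
  have C: "subspace (closure \<Gamma>)" by (rule subspace_closure[OF \<Gamma>])
  have "closed {p::'a \<times> 'a. norm (snd p) \<le> K * norm (fst p)}"
    by (intro closed_Collect_le continuous_intros)
  then have "closure \<Gamma> \<subseteq> {p. norm (snd p) \<le> K * norm (fst p)}"
    using le by (intro closure_minimal) auto
  then have leC: "norm y \<le> K * norm x" if "(x, y) \<in> closure \<Gamma>" for x y using that by auto
  \<comment> \<open>The coordinates are exchanged because \<open>closed_subspace_snd_image\<close>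
    concerns the second one, while the domain is the first.\<close>
  let ?\<Delta> = "{p. (snd p, fst p) \<in> closure \<Gamma>}"
  have "subspace ?\<Delta>"
  proof (rule subspaceI)
    show "0 \<in> ?\<Delta>" using subspace_0[OF C] by (simp add: zero_prod_def)
    show "p + q \<in> ?\<Delta>" if "p \<in> ?\<Delta>" "q \<in> ?\<Delta>" for p q
      using that subspace_add[OF C, of "(snd p, fst p)" "(snd q, fst q)"] by simp
    show "r *\<^sub>R p \<in> ?\<Delta>" if "p \<in> ?\<Delta>" for r p
      using that subspace_scale[OF C, of "(snd p, fst p)" r] by simp
  qed
  moreover have "closed ?\<Delta>"
  proof -
    have "?\<Delta> = (\<lambda>p. (snd p, fst p)) -` closure \<Gamma>" by auto
    then show ?thesis by (auto intro!: closed_vimage continuous_intros)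
  qed
  moreover have "norm y \<le> K * norm x" if "(y, x) \<in> ?\<Delta>" for y x using leC that by simp
  ultimately have S: "subspace (snd ` ?\<Delta>)" "closed (snd ` ?\<Delta>)"
    using closed_subspace_snd_image[of ?\<Delta> K] by blast+
  obtain P where P: "projection P" "range P = snd ` ?\<Delta>" using projection_onto_exists[OF S] by blast
  have "\<exists>y. (P x, y) \<in> closure \<Gamma>" for x
  proof -
    have "P x \<in> snd ` ?\<Delta>" unfolding P(2)[symmetric] by (rule rangeI)
    then show ?thesis by auto
  qed
  then obtain T where T: "\<And>x. (P x, T x) \<in> closure \<Gamma>" by metis
  have uniq: "T x = y" if "(P x, y) \<in> closure \<Gamma>" for x y
  proof -
    have "(0, T x - y) \<in> closure \<Gamma>" using subspace_diff[OF C T[of x] that] by simp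
    then have "norm (T x - y) \<le> K * norm (0::'a)" by (rule leC)
    then show ?thesis by simp
  qed
  have Plin: "linear P" using projectionD(2)[OF P(1)] bounded_linear.linear by blast
  have fixP: "P x = x" if "(x, y) \<in> closure \<Gamma>" for x y
  proof -
    have "x \<in> snd ` ?\<Delta>" by (rule image_eqI[of _ _ "(y, x)"]) (use that in simp_all)
    then obtain z where "x = P z" unfolding P(2)[symmetric] by blast
    then show ?thesis by (simp add: projectionD(4)[OF P(1)])
  qed
  have bd: "norm (T x) \<le> K * norm x" for x
    using leC[OF T[of x]] mult_left_mono[OF projectionD(6)[OF P(1), of x] K] by linarith
  have "bounded_linear T"
  proof (rule bounded_linear_intro[where K=K])
    show "T (x + y) = T x + T y" for x y
      by (rule uniq) (use subspace_add[OF C T[of x] T[of y]] in \<open>simp add: linear_add[OF Plin]\<close>)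
    show "T (r *\<^sub>R x) = r *\<^sub>R T x" for r x
      by (rule uniq) (use subspace_scale[OF C T[of x], of r] in \<open>simp add: linear_scale[OF Plin]\<close>)
    show "norm (T x) \<le> norm x * K" for x using bd[of x] by (simp add: mult.commute)
  qed
  moreover have "T x = y" if "(x, y) \<in> \<Gamma>" for x y
  proof -
    have "(x, y) \<in> closure \<Gamma>" by (rule subsetD[OF closure_subset that])
    then show ?thesis using fixP uniq by metis
  qed
  moreover have "T z = 0" if z: "\<forall>p\<in>\<Gamma>. z \<bullet> fst p = 0" for z
  proof -
    have "closed {p::'a \<times> 'a. z \<bullet> fst p = 0}" by (intro closed_Collect_eq continuous_intros)
    then have "closure \<Gamma> \<subseteq> {p. z \<bullet> fst p = 0}" using z by (intro closure_minimal) auto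
    then have "z \<bullet> P z = 0" using T[of z] by auto
    then have "P z = 0" using projectionD(5)[OF P(1), of z] by (simp add: inner_commute)
    then show ?thesis using bd[of z] leC[OF T[of z]] by simp
  qed
  ultimately show ?thesis using bd by blast
qed

lemma projection_onto_eqI:
  assumes "orthogonal_projection P" "range P = S"
  shows "projection_onto S = P"
  unfolding projection_onto_def
proof (rule the_equality)
  fix Q assume Q: "orthogonal_projection Q \<and> range Q = S"
  have p: "projection P" "projection Q" using assms Q by (auto simp: orthogonal_projection_iff)
  have PQ: "P (Q x) = Q x" for x
  proof -
    have "Q x \<in> range P" using Q assms(2) by auto
    then show ?thesis using projectionD(4)[OF p(1)] by auto
  qed
  have QP: "Q (P x) = P x" for x
  proof -
    have "P x \<in> range Q" using Q assms(2) by auto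
    then show ?thesis using projectionD(4)[OF p(2)] by auto
  qed
  show "Q = P"
  proof (rule projection_eqI[OF p(2,1)])
    show "Q x \<bullet> x = P x \<bullet> x" for x
      using projectionD(3)[OF p(1)] projectionD(3)[OF p(2)] PQ QP by (metis inner_commute)
  qed
qed (use assms in blast)

lemma orthogonal_projection_exists:
  fixes S :: "'h::complex_hilbert_space set"
  assumes S: "subspace S" "closed S" and c: "\<And>a x. x \<in> S \<Longrightarrow> a *\<^sub>C x \<in> S"
  shows "\<exists>P. orthogonal_projection P \<and> range P = S"
proof -
  obtain P where P: "projection P" "range P = S" using projection_onto_exists[OF S] by blast
  have PS: "P x = x \<longleftrightarrow> x \<in> S" for x
    using P(2) projectionD(4)[OF P(1)] by (metis imageE rangeI)
  have "a *\<^sub>C P x = P (a *\<^sub>C x)" for a x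
    by (rule projection_commute[OF P(1) bounded_linear_scaleC inner_scaleC_left]) (simp_all add: PS c)
  then show ?thesis using P by (auto simp: orthogonal_projection_iff)
qed

sublocale closed_op \<subseteq> N: spectral_operator "modulus A" "spectral_measure_of (modulus A)"
proof -
  interpret positive_selfadjoint "modulus A" by (rule modulus_positive_selfadjoint)
  show "spectral_operator (modulus A) (spectral_measure_of (modulus A))"
    by unfold_locales (rule has_spectral_measure_of)
qed

section \<open>The smallest constant and the operators T\<close>

context closed_op
begin

abbreviation "N \<equiv> modulus A"
abbreviation "F \<equiv> spectral_measure_of (modulus A)"

lemma bound_iff:
  "weakly_quasinormal_bound A c \<longleftrightarrow> 0 \<le> c \<and>
    (\<forall>\<sigma>\<in>sets borel_nonneg. \<forall>f u v. A f = Some v \<longrightarrow> N f = Some u \<longrightarrow> (norm (F \<sigma> u))\<^sup>2 \<le> c * (norm (F \<sigma> v))\<^sup>2)"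
proof -
  have *: "Re (cinner (F \<sigma> x) x) = (norm (F \<sigma> x))\<^sup>2" if "\<sigma> \<in> sets borel_nonneg" for \<sigma> x
    using projectionD(5)[OF N.E_proj[OF that]] by (simp add: inner_eq_Re_cinner)
  show ?thesis
    unfolding weakly_quasinormal_bound_def
  proof (intro conj_cong refl ball_cong iffI allI impI ballI)
    fix \<sigma> f u v
    assume \<sigma>: "\<sigma> \<in> sets borel_nonneg" and f: "A f = Some v" "N f = Some u"
      and le: "\<forall>f\<in>dom A. Re (cinner (F \<sigma> (the (N f))) (the (N f))) \<le> c * Re (cinner (F \<sigma> (the (A f))) (the (A f)))"
    show "(norm (F \<sigma> u))\<^sup>2 \<le> c * (norm (F \<sigma> v))\<^sup>2"
      using le[rule_format, OF domI[of A f v, OF f(1)]] f by (simp add: *[OF \<sigma>])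
  next
    fix \<sigma> f
    assume \<sigma>: "\<sigma> \<in> sets borel_nonneg" and f: "f \<in> dom A"
      and le: "\<forall>f u v. A f = Some v \<longrightarrow> N f = Some u \<longrightarrow> (norm (F \<sigma> u))\<^sup>2 \<le> c * (norm (F \<sigma> v))\<^sup>2"
    obtain v where v: "A f = Some v" using f by blast
    obtain u where u: "N f = Some u" using modulus_of[OF v] by blast
    show "Re (cinner (F \<sigma> (the (N f))) (the (N f))) \<le> c * Re (cinner (F \<sigma> (the (A f))) (the (A f)))"
      using le v u by (simp add: *[OF \<sigma>])
  qed
qed

lemma bound_mono: "weakly_quasinormal_bound A c \<Longrightarrow> c \<le> c' \<Longrightarrow> weakly_quasinormal_bound A c'"
  unfolding bound_iff by (meson mult_right_mono order_trans zero_le_power2)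

text \<open>\<open>LEAST\<close> over the reals is meaningful only if the infimum is attained; it
  is, since each inequality survives passing to the infimum of the admissible c. If F \<sigma> v =
  0, any admissible c forces F \<sigma> u = 0.\<close>

lemma quasinormal_const:
  assumes ex: "weakly_quasinormal_bound A c"
  shows "weakly_quasinormal_bound A (quasinormal_const A)"
    and "weakly_quasinormal_bound A c' \<Longrightarrow> quasinormal_const A \<le> c'"
proof -
  let ?S = "{c. weakly_quasinormal_bound A c}"
  define m where "m = Inf ?S"
  have ne: "?S \<noteq> {}" using ex by blast
  have bdd: "bdd_below ?S" by (rule bdd_belowI[of _ 0]) (simp add: bound_iff)
  have low: "m \<le> c'" if "weakly_quasinormal_bound A c'" for c'
    unfolding m_def by (rule cInf_lower[OF _ bdd]) (use that in simp)
  have "weakly_quasinormal_bound A m"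
    unfolding bound_iff
  proof (intro conjI ballI allI impI)
    show "0 \<le> m" unfolding m_def by (rule cInf_greatest[OF ne]) (simp add: bound_iff)
    fix \<sigma> f u v assume *: "\<sigma> \<in> sets borel_nonneg" "A f = Some v" "N f = Some u"
    then have le: "(norm (F \<sigma> u))\<^sup>2 \<le> c' * (norm (F \<sigma> v))\<^sup>2" if "weakly_quasinormal_bound A c'" for c'
      using that unfolding bound_iff by blast
    show "(norm (F \<sigma> u))\<^sup>2 \<le> m * (norm (F \<sigma> v))\<^sup>2"
    proof (cases "F \<sigma> v = 0")
      case True
      then show ?thesis using le[OF ex] by simp
    next
      case False
      have "(norm (F \<sigma> u))\<^sup>2 / (norm (F \<sigma> v))\<^sup>2 \<le> m"
        unfolding m_def using le False by (intro cInf_greatest[OF ne]) (simp add: pos_divide_le_eq)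
      then show ?thesis using False by (simp add: pos_divide_le_eq)
    qed
  qed
  moreover from this have "quasinormal_const A = m"
    unfolding quasinormal_const_def by (rule Least_equality) (rule low)
  ultimately show "weakly_quasinormal_bound A (quasinormal_const A)"
    "weakly_quasinormal_bound A c' \<Longrightarrow> quasinormal_const A \<le> c'" using low by simp_all
qed

lemma weakly_quasinormal_iff: "weakly_quasinormal A \<longleftrightarrow> (\<exists>c. weakly_quasinormal_bound A c)"
  using linear closed_A dense by (simp add: weakly_quasinormal_def)

text \<open>Condition (ii) without the norm bound, expressed on values of A and |A|.\<close>

definition transfers :: "('a \<Rightarrow> 'a) \<Rightarrow> bool"
  where "transfers T \<longleftrightarrow> bounded_clinear T \<and> (\<forall>f v. A f = Some v \<longrightarrow> N f = Some (T v)) \<and>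
    (\<forall>f u. N f = Some u \<longrightarrow> N (T f) = Some (T u))"

text \<open>T A \<subseteq> |A| already gives T A = |A|, because A and |A| have the same
  domain.\<close>

lemma transfers_iff: "transfers T \<longleftrightarrow> bounded_clinear T \<and> everywhere T \<circ>\<^sub>m A = N \<and>
    everywhere T \<circ>\<^sub>m N \<subseteq>\<^sub>m N \<circ>\<^sub>m everywhere T"
proof -
  have "everywhere T \<circ>\<^sub>m A = N \<longleftrightarrow> (\<forall>f v. A f = Some v \<longrightarrow> N f = Some (T v))"
  proof
    assume eq: "everywhere T \<circ>\<^sub>m A = N"
    show "\<forall>f v. A f = Some v \<longrightarrow> N f = Some (T v)" unfolding eq[symmetric] by simp
  next
    assume *: "\<forall>f v. A f = Some v \<longrightarrow> N f = Some (T v)"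
    show "everywhere T \<circ>\<^sub>m A = N"
    proof (rule option_fun_eqI)
      fix f z
      show "(everywhere T \<circ>\<^sub>m A) f = Some z \<longleftrightarrow> N f = Some z"
        unfolding map_comp_Some using * of_modulus[of f z] by fastforce
    qed
  qed
  moreover have "everywhere T \<circ>\<^sub>m N \<subseteq>\<^sub>m N \<circ>\<^sub>m everywhere T \<longleftrightarrow> (\<forall>f u. N f = Some u \<longrightarrow> N (T f) = Some (T u))"
    unfolding map_le_def by (force simp: map_comp_def dom_def split: option.splits)
  ultimately show ?thesis unfolding transfers_def by blast
qed

lemma transfersD:
  assumes "transfers T"
  shows "bounded_linear T" "T (a *\<^sub>C x) = a *\<^sub>C T x" "A f = Some v \<Longrightarrow> N f = Some (T v)"
    "N f = Some u \<Longrightarrow> N (T f) = Some (T u)"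
  using assms by (auto simp: transfers_def bounded_clinear_def)

lemma bound_of_transfers:
  assumes T: "transfers T"
  shows "weakly_quasinormal_bound A ((onorm T)\<^sup>2)"
  unfolding bound_iff
proof (intro conjI ballI allI impI)
  fix \<sigma> f u v assume \<sigma>: "\<sigma> \<in> sets borel_nonneg" and v: "A f = Some v" and u: "N f = Some u"
  have "u = T v" using transfersD(3)[OF T v] u by simp
  then have "F \<sigma> u = T (F \<sigma> v)"
    using N.intertwines_imp_commute[OF transfersD(1)[OF T] transfersD(4)[OF T] \<sigma>] by simp
  then have "norm (F \<sigma> u) \<le> onorm T * norm (F \<sigma> v)" using onorm[OF transfersD(1)[OF T]] by simp
  then have "(norm (F \<sigma> u))\<^sup>2 \<le> (onorm T * norm (F \<sigma> v))\<^sup>2" by (rule power_mono) simp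
  then show "(norm (F \<sigma> u))\<^sup>2 \<le> (onorm T)\<^sup>2 * (norm (F \<sigma> v))\<^sup>2" by (simp add: power_mult_distrib)
qed simp

text \<open>\<open>T\<close> maps \<open>\<Sum> E(\<sigma>\<^sub>i) A f\<^sub>i\<close> to \<open>\<Sum> E(\<sigma>\<^sub>i) |A| f\<^sub>i\<close>. The invariant below makes the estimate
  \<open>\<parallel>\<Sum> E(\<sigma>\<^sub>i) |A| f\<^sub>i\<parallel>\<^sup>2 \<le> c \<parallel>\<Sum> E(\<sigma>\<^sub>i) A f\<^sub>i\<parallel>\<^sup>2\<close> inductive in the number of summands: cutting \<open>\<tau>\<close> along
  the new set \<open>\<sigma>\<close> absorbs the new vector \<open>f\<close> into \<open>g\<close> on \<open>\<tau> \<inter> \<sigma>\<close>, so that the \<open>\<sigma>\<^sub>i\<close> need not be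
  made disjoint.\<close>

lemma transfers_exists:
  assumes bound: "weakly_quasinormal_bound A c"
  shows "\<exists>T. transfers T \<and> onorm T \<le> sqrt c \<and> range T \<subseteq> closure (ran N)"
proof -
  have c: "0 \<le> c" and le: "\<And>\<sigma> f u v. \<sigma> \<in> sets borel_nonneg \<Longrightarrow> A f = Some v \<Longrightarrow> N f = Some u \<Longrightarrow>
      (norm (F \<sigma> u))\<^sup>2 \<le> c * (norm (F \<sigma> v))\<^sup>2"
    using bound unfolding bound_iff by blast+
  \<comment> \<open>The real span suffices: S is closed under complex scalars, as A, |A| and F
    \<sigma> are complex linear.\<close>
  define S where "S = {p. \<exists>\<sigma> f u v. \<sigma> \<in> sets borel_nonneg \<and> A f = Some v \<and> N f = Some u \<and> p = (F \<sigma> v, F \<sigma> u)}"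
  have S_in: "(F \<sigma> v, F \<sigma> u) \<in> span S" if "\<sigma> \<in> sets borel_nonneg" "A f = Some v" "N f = Some u" for \<sigma> f u v
    by (rule span_base) (use that in \<open>auto simp: S_def\<close>)
  have inv: "\<forall>\<tau>\<in>sets borel_nonneg. \<forall>g a b. A g = Some a \<longrightarrow> N g = Some b \<longrightarrow>
      (norm (F \<tau> (snd p + b)))\<^sup>2 \<le> c * (norm (F \<tau> (fst p + a)))\<^sup>2" if "p \<in> span S" for p
    using that
  proof (induction rule: span_induct_alt)
    case base
    then show ?case using le by simp
  next
    case (step r q p)
    obtain \<sigma> f u v where \<sigma>: "\<sigma> \<in> sets borel_nonneg" and v: "A f = Some v" and u: "N f = Some u"
      and q: "q = (F \<sigma> v, F \<sigma> u)" using step(1) unfolding S_def by blast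
    show ?case
    proof (intro ballI allI impI)
      fix \<tau> g a b assume \<tau>: "\<tau> \<in> sets borel_nonneg" and a: "A g = Some a" and b: "N g = Some b"
      have i: "\<tau> \<inter> \<sigma> \<in> sets borel_nonneg" and d: "\<tau> - \<sigma> \<in> sets borel_nonneg" using \<tau> \<sigma> by auto
      have on: "F (\<tau> \<inter> \<sigma>) (r *\<^sub>R F \<sigma> x + y + z) = F (\<tau> \<inter> \<sigma>) (y + (z + r *\<^sub>R x))" for x y z
        using N.E_Int[OF i \<sigma>] by (simp add: N.E_add[OF i] N.E_scale[OF i] Int_assoc)
      have off: "F (\<tau> - \<sigma>) (r *\<^sub>R F \<sigma> x + y + z) = F (\<tau> - \<sigma>) (y + z)" for x y z
      proof -
        have "(\<tau> - \<sigma>) \<inter> \<sigma> = {}" by auto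
        from N.E_orth[OF d \<sigma> this] show ?thesis by (simp add: N.E_add[OF d] N.E_scale[OF d])
      qed
      have "(norm (F (\<tau> \<inter> \<sigma>) (snd p + (b + r *\<^sub>R u))))\<^sup>2 \<le> c * (norm (F (\<tau> \<inter> \<sigma>) (fst p + (a + r *\<^sub>R v))))\<^sup>2"
        using step(2) i add[OF a scaleR[OF v]] N.add[OF b N.scaleR[OF u]] by blast
      moreover have "(norm (F (\<tau> - \<sigma>) (snd p + b)))\<^sup>2 \<le> c * (norm (F (\<tau> - \<sigma>) (fst p + a)))\<^sup>2"
        using step(2) d a b by blast
      ultimately show "(norm (F \<tau> (snd (r *\<^sub>R q + p) + b)))\<^sup>2 \<le> c * (norm (F \<tau> (fst (r *\<^sub>R q + p) + a)))\<^sup>2"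
        by (simp add: q N.E_Pythagoras[OF \<tau> \<sigma>] on off distrib_left)
    qed
  qed
  have sub: "subspace (span S)" by simp
  have bd: "norm y \<le> sqrt c * norm x" if "(x, y) \<in> span S" for x y
  proof -
    \<comment> \<open>For \<tau> = [0, \<infinity>) and g = 0 the invariant is the norm bound
      itself.\<close>
    have "(norm (F {0..} (y + 0)))\<^sup>2 \<le> c * (norm (F {0..} (x + 0)))\<^sup>2"
      using inv[OF that] N.space_in_sets zero N.zero by fastforce
    then have "(norm y)\<^sup>2 \<le> (sqrt c * norm x)\<^sup>2"
      using c by (simp add: N.E_space power_mult_distrib)
    then show ?thesis by (rule power2_le_imp_le) (use c in simp)
  qed
  obtain T where T: "bounded_linear T" "\<forall>x. norm (T x) \<le> sqrt c * norm x"
    "\<forall>x y. (x, y) \<in> span S \<longrightarrow> T x = y" "\<forall>z. (\<forall>p\<in>span S. z \<bullet> fst p = 0) \<longrightarrow> T z = 0"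
    using bounded_extension[OF sub bd] c by auto
  have D: "subspace (fst ` span S)"
    by (rule linear_subspace_image[OF _ sub]) (simp add: linear_fst)
  \<comment> \<open>V and its adjoint W both preserve the relation. On its domain T V = V T is then
    immediate; on the complement T vanishes, and V keeps the complement invariant because W
    preserves the domain. This is applied to F \<tau> and to complex scalars.\<close>
  have commute: "T (V x) = V (T x)"
    if V: "bounded_linear V" "\<And>p. p \<in> span S \<Longrightarrow> (V (fst p), V (snd p)) \<in> span S"
      and W: "\<And>x y. V x \<bullet> y = x \<bullet> W y" "\<And>p. p \<in> span S \<Longrightarrow> (W (fst p), W (snd p)) \<in> span S" for V W x
  proof (rule eq_on_subspace_and_complement[OF bounded_linear_compose[OF T(1) V(1)] bounded_linear_compose[OF V(1) T(1)] D])
    fix x assume "x \<in> fst ` span S"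
    then obtain y where y: "(x, y) \<in> span S" by force
    show "T (V x) = V (T x)" using V(2)[OF y] y T(3) by auto
  next
    fix z assume z: "\<And>x. x \<in> fst ` span S \<Longrightarrow> z \<bullet> x = 0"
    have "T z = 0" using T(4) z by blast
    moreover have "V z \<bullet> fst p = 0" if "p \<in> span S" for p
    proof -
      have "W (fst p) \<in> fst ` span S" by (rule image_eqI[OF _ W(2)[OF that]]) simp
      then show ?thesis using z W(1) by simp
    qed
    then have "T (V z) = 0" using T(4) by blast
    ultimately show "T (V z) = V (T z)" using linear_0[OF bounded_linear.linear[OF V(1)]] by simp
  qed
  have span_map: "(V (fst p), V (snd p)) \<in> span S"
    if V: "bounded_linear V" "\<And>q. q \<in> S \<Longrightarrow> (V (fst q), V (snd q)) \<in> span S" and p: "p \<in> span S" for V p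
  proof -
    have l: "linear V" using V(1) bounded_linear.linear by blast
    from p show ?thesis
    proof (induction rule: span_induct_alt)
      case base
      then show ?case using span_zero[of S] by (simp add: linear_0[OF l] zero_prod_def)
    next
      case (step r q p)
      then show ?case
        using span_add[OF span_scale[OF V(2)[OF step(1)], of r] step(2)]
        by (simp add: linear_add[OF l] linear_scale[OF l])
    qed
  qed
  have span_F: "(F \<tau> (fst p), F \<tau> (snd p)) \<in> span S" if \<tau>: "\<tau> \<in> sets borel_nonneg" and "p \<in> span S" for \<tau> p
  proof (rule span_map[OF N.E_lin[OF \<tau>] _ that(2)])
    fix q assume "q \<in> S"
    then obtain \<sigma> f u v where \<sigma>: "\<sigma> \<in> sets borel_nonneg" and v: "A f = Some v" and u: "N f = Some u"
      and q: "q = (F \<sigma> v, F \<sigma> u)" unfolding S_def by blast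
    have "\<tau> \<inter> \<sigma> \<in> sets borel_nonneg" using \<tau> \<sigma> by auto
    then show "(F \<tau> (fst q), F \<tau> (snd q)) \<in> span S" using S_in[OF _ v u] by (simp add: q N.E_Int[OF \<tau> \<sigma>])
  qed
  have span_C: "(a *\<^sub>C fst p, a *\<^sub>C snd p) \<in> span S" if "p \<in> span S" for a p
  proof (rule span_map[OF bounded_linear_scaleC _ that])
    fix q assume "q \<in> S"
    then obtain \<sigma> f u v where \<sigma>: "\<sigma> \<in> sets borel_nonneg" and v: "A f = Some v" and u: "N f = Some u"
      and q: "q = (F \<sigma> v, F \<sigma> u)" unfolding S_def by blast
    show "(a *\<^sub>C fst q, a *\<^sub>C snd q) \<in> span S"
      using S_in[OF \<sigma> scaleC[OF v] N.scaleC[OF u]] by (simp add: q N.E_scaleC[OF \<sigma>])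
  qed
  have TF: "T (F \<tau> x) = F \<tau> (T x)" if \<tau>: "\<tau> \<in> sets borel_nonneg" for \<tau> x
    by (rule commute[OF N.E_lin[OF \<tau>] span_F[OF \<tau>] projectionD(3)[OF N.E_proj[OF \<tau>]] span_F[OF \<tau>]])
  have TC: "T (a *\<^sub>C x) = a *\<^sub>C T x" for a x
    by (rule commute[OF bounded_linear_scaleC span_C inner_scaleC_left span_C])
  have TA: "N f = Some (T v)" if v: "A f = Some v" for f v
  proof -
    obtain u where u: "N f = Some u" using modulus_of[OF v] by blast
    have "(v, u) \<in> span S" using S_in[OF N.space_in_sets v u] by (simp add: N.E_space)
    then show ?thesis using T(3) u by simp
  qed
  have "transfers T"
    unfolding transfers_def bounded_clinear_def
    using T(1) TC TA N.commute_imp_intertwines[OF T(1) TF] by blast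
  moreover have "onorm T \<le> sqrt c" by (rule onorm_bound) (use T(2) c in auto)
  \<comment> \<open>F \<sigma> u = |A| F \<sigma> f, so T maps the domain of the relation into the
    range of |A|. Projecting onto the closure of that range changes T neither there nor on the
    complement, where T = 0.\<close>
  moreover have "range T \<subseteq> closure (ran N)"
  proof
    fix y assume "y \<in> range T"
    then obtain x where x: "y = T x" by blast
    have ranS: "snd p \<in> ran N" if "p \<in> span S" for p
      using that
    proof (induction rule: span_induct_alt)
      case base
      then show ?case using subspace_0[OF N.ran_subspace] by simp
    next
      case (step r q p)
      obtain \<sigma> f u v where \<sigma>: "\<sigma> \<in> sets borel_nonneg" and u: "N f = Some u"
        and q: "q = (F \<sigma> v, F \<sigma> u)" using step(1) unfolding S_def by blast
      have "snd q \<in> ran N" unfolding q snd_conv by (rule ranI[where m=N, OF N.E_intertwines[OF \<sigma> u]])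
      then show ?case
        using subspace_add[OF N.ran_subspace subspace_scale[OF N.ran_subspace] step(2)] by simp
    qed
    obtain P where P: "projection P" "range P = closure (ran N)"
      using projection_onto_exists[OF subspace_closure[OF N.ran_subspace] closed_closure] by blast
    have "P (T x) = T x"
    proof (rule eq_on_subspace_and_complement[OF bounded_linear_compose[OF projectionD(2)[OF P(1)] T(1)] T(1) D])
      fix x assume "x \<in> fst ` span S"
      then obtain y where y: "(x, y) \<in> span S" by force
      then have "T x \<in> closure (ran N)" using ranS[OF y] T(3) closure_subset by auto
      then obtain z where "T x = P z" using P(2) by blast
      then show "P (T x) = T x" by (simp add: projectionD(4)[OF P(1)])
    next
      fix z assume z: "\<And>x. x \<in> fst ` span S \<Longrightarrow> z \<bullet> x = 0"
      then have "T z = 0" using T(4) by blast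
      then show "P (T z) = T z" using linear_0[OF bounded_linear.linear[OF projectionD(2)[OF P(1)]]] by simp
    qed
    then show "y \<in> closure (ran N)" unfolding x P(2)[symmetric] by (metis rangeI)
  qed
  ultimately show ?thesis by blast
qed

end

section \<open>Isometry on the closed range and the polar decomposition\<close>

context closed_op
begin

lemma ran_scaleC: "x \<in> closure (ran A) \<Longrightarrow> a *\<^sub>C x \<in> closure (ran A)"
proof -
  assume x: "x \<in> closure (ran A)"
  have "(*\<^sub>C) a ` closure (ran A) \<subseteq> closure (ran A)"
  proof (rule image_closure_subset)
    show "continuous_on (closure (ran A)) ((*\<^sub>C) a)" by (rule linear_continuous_on[OF bounded_linear_scaleC])
    show "(*\<^sub>C) a ` ran A \<subseteq> closure (ran A)"
    proof
      fix y assume "y \<in> (*\<^sub>C) a ` ran A"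
      then obtain v where v: "v \<in> ran A" "y = a *\<^sub>C v" by blast
      then obtain f where "A f = Some v" unfolding ran_def by blast
      from scaleC[OF this, of a] have "y \<in> ran A" unfolding v(2) by (rule ranI[where m=A])
      then show "y \<in> closure (ran A)" by (rule subsetD[OF closure_subset])
    qed
  qed simp
  then show ?thesis using x by blast
qed

lemma N_zero_iff: "N x = Some 0 \<longleftrightarrow> (\<forall>u\<in>ran N. x \<bullet> u = 0)"
proof
  assume x: "N x = Some 0"
  show "\<forall>u\<in>ran N. x \<bullet> u = 0"
  proof
    fix u assume "u \<in> ran N"
    then obtain f where "N f = Some u" unfolding ran_def by blast
    then show "x \<bullet> u = 0" using N.M_sym[OF x] by simp
  qed
next
  assume *: "\<forall>u\<in>ran N. x \<bullet> u = 0"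
  show "N x = Some 0"
  proof (rule N.M_maximal)
    fix f u assume "N f = Some u"
    then have "u \<in> ran N" by (rule ranI)
    then show "u \<bullet> x = f \<bullet> 0" using * by (simp add: inner_commute)
  qed
qed

text \<open>A and |A| have the same kernel since their norms agree, and the kernel of a selfadjoint
  operator is the orthogonal complement of its range.\<close>

lemma kernel_iff: "x \<in> kernel A \<longleftrightarrow> (\<forall>u\<in>ran N. x \<bullet> u = 0)"
proof -
  have "A x = Some 0 \<longleftrightarrow> N x = Some 0"
    using modulus_of[of x 0] of_modulus[of x 0] by auto
  then show ?thesis by (simp add: kernel_def N_zero_iff)
qed

context
  fixes T
  assumes T: "transfers T"
begin

lemma T_isometric: "x \<in> closure (ran A) \<Longrightarrow> norm (T x) = norm x"
proof -
  assume x: "x \<in> closure (ran A)"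
  have Tl: "bounded_linear T" by (rule transfersD(1)[OF T])
  have "closed {x. norm (T x) = norm x}"
    by (intro closed_Collect_eq continuous_on_norm linear_continuous_on Tl continuous_on_id)
  moreover have "ran A \<subseteq> {x. norm (T x) = norm x}"
  proof
    fix v assume "v \<in> ran A"
    then obtain f where v: "A f = Some v" unfolding ran_def by blast
    show "v \<in> {x. norm (T x) = norm x}" using modulus_of[OF v] transfersD(3)[OF T v] by auto
  qed
  ultimately have "closure (ran A) \<subseteq> {x. norm (T x) = norm x}" by (intro closure_minimal)
  then show ?thesis using x by auto
qed

text \<open>An isometric image of a closed subspace is closed, so the comparison of closures reduces
  to the ranges themselves.\<close>

lemma T_image: "T ` closure (ran A) = closure (ran N)"
proof
  have Tl: "bounded_linear T" by (rule transfersD(1)[OF T])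
  have lin: "linear T" using Tl bounded_linear.linear by blast
  show "T ` closure (ran A) \<subseteq> closure (ran N)"
  proof (rule image_closure_subset[OF linear_continuous_on[OF Tl] closed_closure])
    show "T ` ran A \<subseteq> closure (ran N)"
    proof
      fix y assume "y \<in> T ` ran A"
      then obtain v where v: "v \<in> ran A" "y = T v" by blast
      then obtain f where "A f = Some v" unfolding ran_def by blast
      from transfersD(3)[OF T this] have "y \<in> ran N" unfolding v(2) by (rule ranI[where m=N])
      then show "y \<in> closure (ran N)" by (rule subsetD[OF closure_subset])
    qed
  qed
  let ?\<Gamma> = "{p. fst p \<in> closure (ran A) \<and> T (fst p) = snd p}"
  have S: "subspace (closure (ran A))" by (rule subspace_closure[OF ran_subspace])
  have "subspace ?\<Gamma>"
    using subspace_0[OF S] subspace_add[OF S] subspace_scale[OF S]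
    by (intro subspaceI) (auto simp: linear_0[OF lin] linear_add[OF lin] linear_scale[OF lin])
  moreover have "closed ?\<Gamma>"
  proof -
    have "closed (fst -` closure (ran A) :: ('a \<times> 'a) set)"
      by (intro closed_vimage closed_closure continuous_intros)
    moreover have "closed {p. T (fst p) = snd p}"
      by (intro closed_Collect_eq continuous_intros
          continuous_on_compose2[OF linear_continuous_on[OF Tl, of UNIV]]) auto
    ultimately have "closed (fst -` closure (ran A) \<inter> {p. T (fst p) = snd p})" by (rule closed_Int)
    moreover have "fst -` closure (ran A) \<inter> {p. T (fst p) = snd p} = ?\<Gamma>" by auto
    ultimately show ?thesis by simp
  qed
  moreover have "norm x \<le> 1 * norm y" if "(x, y) \<in> ?\<Gamma>" for x y using T_isometric that by auto
  ultimately have "closed (snd ` ?\<Gamma>)" by (rule closed_subspace_snd_image)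
  moreover have "snd ` ?\<Gamma> = T ` closure (ran A)" by (auto simp: image_iff)
  ultimately have cl: "closed (T ` closure (ran A))" by simp
  have "ran N \<subseteq> T ` closure (ran A)"
  proof
    fix u assume "u \<in> ran N"
    then obtain f where u: "N f = Some u" unfolding ran_def by blast
    then obtain v where v: "A f = Some v" using of_modulus by blast
    then have "v \<in> closure (ran A)" using subsetD[OF closure_subset ranI[where m=A, OF v]] by simp
    moreover have "u = T v" using transfersD(3)[OF T v] u by simp
    ultimately show "u \<in> T ` closure (ran A)" by blast
  qed
  then show "closure (ran N) \<subseteq> T ` closure (ran A)" by (rule closure_minimal[OF _ cl])
qed

lemma T_inner:
  assumes "x \<in> closure (ran A)" "y \<in> closure (ran A)"
  shows "T x \<bullet> T y = x \<bullet> y"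
proof -
  have lin: "linear T" using transfersD(1)[OF T] bounded_linear.linear by blast
  have "x + y \<in> closure (ran A)" using subspace_add[OF subspace_closure[OF ran_subspace]] assms by blast
  then have "(norm (T x + T y))\<^sup>2 = (norm (x + y))\<^sup>2" using T_isometric[of "x + y"] by (simp add: linear_add[OF lin])
  moreover have "(norm (T x))\<^sup>2 = (norm x)\<^sup>2" "(norm (T y))\<^sup>2 = (norm y)\<^sup>2"
    using T_isometric assms by simp_all
  ultimately show ?thesis
    unfolding power2_norm_eq_inner by (simp add: inner_left_distrib inner_right_distrib inner_commute)
qed

text \<open>With U = P T^*, U inverts T on \<open>closure (ran N)\<close> and vanishes on the
  complement, which is the kernel of A. These properties give the polar decomposition; a competitor
  agrees with U on the range of |A| and on the kernel, hence everywhere.\<close>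

lemma polar_isometry_eq:
  "everywhere (polar_isometry A) = everywhere (projection_onto (closure (ran A))) \<circ>\<^sub>m op_adjoint (everywhere T)"
proof -
  let ?S = "closure (ran A)"
  have Tl: "bounded_linear T" by (rule transfersD(1)[OF T])
  have S: "subspace ?S" by (rule subspace_closure[OF ran_subspace])
  obtain P where P: "orthogonal_projection P" "range P = ?S"
    using orthogonal_projection_exists[OF S closed_closure ran_scaleC] by blast
  have Pp: "projection P" and Pc: "\<And>a x. P (a *\<^sub>C x) = a *\<^sub>C P x"
    using P(1) by (auto simp: orthogonal_projection_iff)
  have PS: "P x \<in> ?S" for x unfolding P(2)[symmetric] by (rule rangeI)
  have Pfix: "P x = x" if "x \<in> ?S" for x
    using that projectionD(4)[OF Pp] unfolding P(2)[symmetric] by auto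
  have Plin: "linear P" using projectionD(2)[OF Pp] bounded_linear.linear by blast
  obtain T' where T': "bounded_linear T'" and adj: "\<And>x y. T x \<bullet> y = x \<bullet> T' y"
    using adjoint_map_exists[OF Tl] by blast
  have T'c: "T' (a *\<^sub>C x) = a *\<^sub>C T' x" for a x
  proof (rule inner_eqI)
    fix z
    have "z \<bullet> T' (a *\<^sub>C x) = T (cnj a *\<^sub>C z) \<bullet> x"
      using inner_scaleC_left[of "cnj a" "T z" x] by (simp add: transfersD(2)[OF T] flip: adj)
    also have "\<dots> = z \<bullet> (a *\<^sub>C T' x)" by (simp add: adj inner_scaleC_left)
    finally show "T' (a *\<^sub>C x) \<bullet> z = (a *\<^sub>C T' x) \<bullet> z" by (simp add: inner_commute)
  qed
  interpret eT: dense_op "everywhere T"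
  proof
    show "linear_operator (everywhere T)"
      using bounded_linear.linear[OF Tl] transfersD(2)[OF T]
      by (simp add: linear_operator_def linear_0 linear_add)
    show "densely_defined (everywhere T)" by (simp add: densely_defined_def dom_def)
  qed
  have adjT: "op_adjoint (everywhere T) g = Some (T' g)" for g
    by (rule eT.op_adjoint_I) (auto simp: adj)
  define U where "U x = P (T' x)" for x
  have Ul: "bounded_linear U"
    unfolding U_def by (rule bounded_linear_compose[OF projectionD(2)[OF Pp] T'])
  have Uc: "U (a *\<^sub>C x) = a *\<^sub>C U x" for a x by (simp add: U_def T'c Pc)
  \<comment> \<open>Preservation of inner products is known on \<open>closure (ran A)\<close> only,
    hence the test vector z enters through P z.\<close>
  have UT: "U (T y) = y" if y: "y \<in> ?S" for y
  proof (rule inner_eqI)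
    fix z
    have "U (T y) \<bullet> z = T' (T y) \<bullet> P z" by (simp add: U_def projectionD(3)[OF Pp])
    also have "\<dots> = T y \<bullet> T (P z)" by (metis adj inner_commute)
    also have "\<dots> = y \<bullet> P z" by (rule T_inner[OF y PS])
    also have "\<dots> = y \<bullet> z" using Pfix[OF y] projectionD(3)[OF Pp] by metis
    finally show "U (T y) \<bullet> z = y \<bullet> z" .
  qed
  have perp_closure: "z \<bullet> y = 0" if "\<forall>u\<in>ran N. z \<bullet> u = 0" "y \<in> closure (ran N)" for z y
  proof -
    have "closed {y. z \<bullet> y = 0}" by (intro closed_Collect_eq continuous_intros)
    then have "closure (ran N) \<subseteq> {y. z \<bullet> y = 0}" using that(1) by (intro closure_minimal) auto
    then show ?thesis using that(2) by auto
  qed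
  \<comment> \<open>T maps \<open>closure (ran A)\<close> into \<open>closure (ran N)\<close>, so
    its adjoint sends the complement of the latter into the complement of the former, which P
    kills.\<close>
  have Uperp: "U z = 0" if z: "\<forall>u\<in>ran N. z \<bullet> u = 0" for z
  proof (rule inner_eqI)
    fix w
    have "U z \<bullet> w = T' z \<bullet> P w" by (simp add: U_def projectionD(3)[OF Pp])
    also have "\<dots> = z \<bullet> T (P w)" by (metis adj inner_commute)
    also have "\<dots> = 0" by (rule perp_closure[OF z]) (use T_image PS in blast)
    finally show "U z \<bullet> w = 0 \<bullet> w" by simp
  qed
  have decomp: "\<exists>y q. y \<in> ?S \<and> x = T y + q \<and> (\<forall>u\<in>ran N. q \<bullet> u = 0) \<and> U x = y" for x
  proof -
    obtain p where p: "p \<in> closure (ran N)" "\<And>s. s \<in> closure (ran N) \<Longrightarrow> (x - p) \<bullet> s = 0"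
      by (rule orthogonal_decomposition[OF subspace_closure[OF N.ran_subspace] closed_closure, of x]) blast
    obtain y where y: "y \<in> ?S" "p = T y" using p(1) T_image by blast
    have q: "\<forall>u\<in>ran N. (x - p) \<bullet> u = 0" using p(2) closure_subset by blast
    have "U x = U (T y) + U (x - p)"
      using y(2) by (simp flip: linear_add[OF bounded_linear.linear[OF Ul]])
    then show ?thesis
      using y q UT[OF y(1)] Uperp[OF q] by (intro exI[of _ y] exI[of _ "x - p"]) simp
  qed
  have ker: "kernel (everywhere U) = kernel A"
  proof -
    have "U x = 0 \<longleftrightarrow> (\<forall>u\<in>ran N. x \<bullet> u = 0)" for x
      using decomp[of x] Uperp[of x] linear_0[OF bounded_linear.linear[OF Tl]] by auto
    then show ?thesis using kernel_iff by (auto simp: kernel_def[of "everywhere U"])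
  qed
  have isom: "partial_isometry U"
    unfolding partial_isometry_def
  proof (intro conjI allI impI)
    show "bounded_clinear U" using Ul Uc by (simp add: bounded_clinear_def)
    fix x assume x: "\<forall>y. U y = 0 \<longrightarrow> cinner x y = 0"
    obtain y q where y: "y \<in> ?S" "x = T y + q" "\<forall>u\<in>ran N. q \<bullet> u = 0" "U x = y" using decomp by blast
    have "x \<bullet> q = 0" using x Uperp[OF y(3)] by (simp add: inner_eq_Re_cinner)
    moreover have "q \<bullet> T y = 0" by (rule perp_closure[OF y(3)]) (use T_image y(1) in blast)
    ultimately have "q \<bullet> q = 0" by (simp add: y(2) inner_left_distrib inner_right_distrib inner_commute)
    then show "norm (U x) = norm x" using y T_isometric[OF y(1)] by simp
  qed
  have AU: "A = everywhere U \<circ>\<^sub>m N"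
  proof (rule option_fun_eqI)
    fix f v
    show "A f = Some v \<longleftrightarrow> (everywhere U \<circ>\<^sub>m N) f = Some v"
    proof
      assume v: "A f = Some v"
      have "v \<in> ?S" by (rule subsetD[OF closure_subset ranI[where m=A, OF v]])
      then show "(everywhere U \<circ>\<^sub>m N) f = Some v"
        unfolding map_comp_Some using transfersD(3)[OF T v] UT by simp
    next
      assume "(everywhere U \<circ>\<^sub>m N) f = Some v"
      then obtain u where u: "N f = Some u" "U u = v" unfolding map_comp_Some by auto
      obtain w where w: "A f = Some w" using of_modulus[OF u(1)] by blast
      have "w \<in> ?S" by (rule subsetD[OF closure_subset ranI[where m=A, OF w]])
      then show "A f = Some v" using transfersD(3)[OF T w] UT u w by auto
    qed
  qed
  have "polar_isometry A = U"
    unfolding polar_isometry_def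
  proof (rule the_equality)
    show "partial_isometry U \<and> kernel (everywhere U) = kernel A \<and> A = everywhere U \<circ>\<^sub>m N"
      using isom ker AU by blast
    fix V assume V: "partial_isometry V \<and> kernel (everywhere V) = kernel A \<and> A = everywhere V \<circ>\<^sub>m N"
    have Vl: "bounded_linear V" using V by (simp add: partial_isometry_def bounded_clinear_def)
    show "V = U"
    proof
      fix x show "V x = U x"
      proof (rule eq_on_subspace_and_complement[OF Vl Ul N.ran_subspace])
        fix u assume "u \<in> ran N"
        then obtain f where u: "N f = Some u" unfolding ran_def by blast
        have "(everywhere V \<circ>\<^sub>m N) f = (everywhere U \<circ>\<^sub>m N) f" using V AU by metis
        then show "V u = U u" using u by simp
      next
        fix z assume "\<And>u. u \<in> ran N \<Longrightarrow> z \<bullet> u = 0"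
        then have "\<forall>u\<in>ran N. z \<bullet> u = 0" by blast
        then have "z \<in> kernel (everywhere V)" "U z = 0" using V kernel_iff Uperp by auto
        then show "V z = U z" by (simp add: kernel_def)
      qed
    qed
  qed
  moreover have "projection_onto ?S = P" by (rule projection_onto_eqI[OF P])
  ultimately show ?thesis by (simp add: fun_eq_iff map_comp_def adjT U_def)
qed

end

text \<open>At \<sigma> = [0, \<infinity>) the inequality compares the squared norm of |A| f with c
  times that of A f, and both norms are equal.\<close>

lemma bound_ge_1:
  assumes bound: "weakly_quasinormal_bound A c" and ne: "A \<noteq> everywhere (\<lambda>_. 0)"
  shows "1 \<le> c"
proof -
  have "\<exists>f v. A f = Some v \<and> v \<noteq> 0"
  proof (rule ccontr)
    assume "\<nexists>f v. A f = Some v \<and> v \<noteq> 0"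
    then have 0: "A f = Some 0" if "f \<in> dom A" for f using that by auto
    \<comment> \<open>The hypothesis excludes the everywhere defined zero operator; a closed
      operator vanishing on its dense domain is that operator.\<close>
    have "A f = Some 0" for f
    proof -
      have "f \<in> closure (dom A)" using dense by (simp add: densely_defined_def)
      then obtain g where g: "\<And>n. g n \<in> dom A" "g \<longlonglongrightarrow> f" unfolding closure_sequential by blast
      show ?thesis by (rule A_closed[OF g(2) tendsto_const 0[OF g(1)]])
    qed
    then show False using ne by auto
  qed
  then obtain f v where v: "A f = Some v" "v \<noteq> 0" by blast
  obtain u where u: "N f = Some u" "norm u = norm v" using modulus_of[OF v(1)] by blast
  have "(norm (F {0..} u))\<^sup>2 \<le> c * (norm (F {0..} v))\<^sup>2"
    using bound N.space_in_sets u(1) v(1) unfolding bound_iff by blast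
  then have "1 * (norm v)\<^sup>2 \<le> c * (norm v)\<^sup>2" by (simp add: N.E_space u(2))
  then show ?thesis by (rule mult_right_le_imp_le) (use v(2) in simp)
qed

end

theorem theorem4p3:
  fixes A :: "'h::complex_hilbert_space operator" and c :: real
  assumes "linear_operator A" and "closed_operator A" and "densely_defined A"
    and "0 \<le> c"
  shows
    "((weakly_quasinormal A \<and> quasinormal_const A \<le> c) \<longleftrightarrow>
      (\<exists>T. bounded_clinear T \<and>
        everywhere T \<circ>\<^sub>m A = modulus A \<and>
        everywhere T \<circ>\<^sub>m modulus A \<subseteq>\<^sub>m modulus A \<circ>\<^sub>m everywhere T \<and>
        onorm T \<le> sqrt c))
    \<and> (weakly_quasinormal A \<longrightarrow> A \<noteq> everywhere (\<lambda>_. 0) \<longrightarrow> 1 \<le> quasinormal_const A)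
    \<and> (weakly_quasinormal A \<longrightarrow>
      (\<exists>T. bounded_clinear T \<and>
        everywhere T \<circ>\<^sub>m A = modulus A \<and>
        everywhere T \<circ>\<^sub>m modulus A \<subseteq>\<^sub>m modulus A \<circ>\<^sub>m everywhere T \<and>
        range T = closure (ran (modulus A)) \<and>
        onorm T = sqrt (quasinormal_const A)))
    \<and> (\<forall>T. bounded_clinear T \<longrightarrow>
        everywhere T \<circ>\<^sub>m A = modulus A \<longrightarrow>
        everywhere T \<circ>\<^sub>m modulus A \<subseteq>\<^sub>m modulus A \<circ>\<^sub>m everywhere T \<longrightarrow>
        onorm T \<le> sqrt c \<longrightarrow>
        (\<forall>x\<in>closure (ran A). norm (T x) = norm x) \<and>
        T ` closure (ran A) = closure (ran (modulus A)) \<and>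
        everywhere (polar_isometry A) =
          everywhere (projection_onto (closure (ran A))) \<circ>\<^sub>m op_adjoint (everywhere T))"
proof -
  interpret closed_op A using assms by unfold_locales
  have bound_c: "weakly_quasinormal_bound A c" if "transfers T" "onorm T \<le> sqrt c" for T
  proof (rule bound_mono[OF bound_of_transfers[OF that(1)]])
    have "(onorm T)\<^sup>2 \<le> (sqrt c)\<^sup>2"
      using that(2) onorm_pos_le[OF transfersD(1)[OF that(1)]] by (rule power_mono)
    then show "(onorm T)\<^sup>2 \<le> c" using assms(4) by simp
  qed
  have i_ii: "(weakly_quasinormal A \<and> quasinormal_const A \<le> c) \<longleftrightarrow> (\<exists>T. transfers T \<and> onorm T \<le> sqrt c)"
  proof
    assume "weakly_quasinormal A \<and> quasinormal_const A \<le> c"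
    then have "weakly_quasinormal_bound A c"
      using quasinormal_const(1) bound_mono unfolding weakly_quasinormal_iff by blast
    then show "\<exists>T. transfers T \<and> onorm T \<le> sqrt c" using transfers_exists by blast
  next
    assume "\<exists>T. transfers T \<and> onorm T \<le> sqrt c"
    then have "weakly_quasinormal_bound A c" using bound_c by blast
    then show "weakly_quasinormal A \<and> quasinormal_const A \<le> c"
      using quasinormal_const(2) unfolding weakly_quasinormal_iff by blast
  qed
  have iii: "1 \<le> quasinormal_const A" if "weakly_quasinormal A" "A \<noteq> everywhere (\<lambda>_. 0)"
    using that bound_ge_1 quasinormal_const(1) unfolding weakly_quasinormal_iff by blast
  have iv: "\<exists>T. transfers T \<and> range T = closure (ran N) \<and> onorm T = sqrt (quasinormal_const A)"
    if wq: "weakly_quasinormal A"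
  proof -
    obtain b where b: "weakly_quasinormal_bound A b" using wq unfolding weakly_quasinormal_iff by blast
    obtain T where T: "transfers T" "onorm T \<le> sqrt (quasinormal_const A)" "range T \<subseteq> closure (ran N)"
      using transfers_exists[OF quasinormal_const(1)[OF b]] by blast
    \<comment> \<open>\<open>bound_of_transfers\<close> makes the square of the norm an admissible
      constant, so the norm is at least the square root of the smallest one.\<close>
    have "quasinormal_const A \<le> (onorm T)\<^sup>2"
      by (rule quasinormal_const(2)[OF b bound_of_transfers[OF T(1)]])
    then have "sqrt (quasinormal_const A) \<le> onorm T"
      using onorm_pos_le[OF transfersD(1)[OF T(1)]] by (rule real_le_lsqrt[rotated])
    moreover have "closure (ran N) \<subseteq> range T" using T_image[OF T(1)] by blast
    ultimately show ?thesis using T by (intro exI[of _ T]) auto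
  qed
  have v: "(\<forall>x\<in>closure (ran A). norm (T x) = norm x) \<and> T ` closure (ran A) = closure (ran N) \<and>
      everywhere (polar_isometry A) =
        everywhere (projection_onto (closure (ran A))) \<circ>\<^sub>m op_adjoint (everywhere T)"
    if "transfers T" for T
    using T_isometric[OF that] T_image[OF that] polar_isometry_eq[OF that] by blast
  show ?thesis
    using i_ii iii iv v unfolding transfers_iff by (intro conjI) (blast | simp)+
qed

end
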